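(* For all $\chi\in\widehat{\mathcal O_{\mathbb E}^\times}$ and $\eta\in\widehat{\mathcal O_{\mathbb F}^\times}$ the map $(s,t)\mapsto\widetilde K_{s,t}^{\chi,\eta}$ extends to a holomorphic function from $\mathbb C^2$ to $\mathcal D'(\mathbb E)$, i.e. for every $\varphi\in C_c^\infty(\mathbb E)$ the function $\mathbb C^2\to\mathbb C$, $(s,t)\mapsto\langle\widetilde K_{s,t}^{\chi,\eta},\varphi\rangle$ is holomorphic. Moreover, $\widetilde K_{s,t}^{\chi,\eta}\in\mathcal D'(\mathbb E)_{s,t}^{\chi,\eta}$ for all $s,t\in\mathbb C$.
   Context: Fields. $\mathbb E/\mathbb F$ is a quadratic extension of non-archimedean local fields, $\mathbb E=\mathbb F(\alpha)$ with $\alpha\in\mathbb E\setminus\mathbb F$, $\alpha^2\in\mathbb F^\times\setminus\mathbb F^{\times2}$. For $k\in\{\mathbb E,\mathbb F\}$: $\mathcal O_k$ is the ring of integers, $\mathcal O_k^\times$ its units, $\varpi_k$ a chosen uniformizer, $q_k$ the residue cardinality, $\nu_k$ the valuation, $|\cdot|_k$ the absolute value with $d(ax)=|a|_k\,dx$ for Haar measure $dx$ on $k$ (so $|\varpi_k|_k=q_k^{-1}$). After possibly multiplying $\alpha$ by a power of $\varpi_{\mathbb F}$, either $\alpha^2\in\mathcal O_{\mathbb F}^\times$ (the case where $\mathbb E/\mathbb F$ is unramified, $q_{\mathbb E}=q_{\mathbb F}^2$) or $\alpha^2\in\varpi_{\mathbb F}\mathcal O_{\mathbb F}^\times$ (the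 case where $\mathbb E/\mathbb F$ is ramified, $q_{\mathbb E}=q_{\mathbb F}$). Elements of $\mathbb E$ are written $x=x_1+x_2\alpha$ with $x_1,x_2\in\mathbb F$. Haar measures are normalized so that $\mathcal O_k$ has measure $1$, and $dx=dx_1\,dx_2$. Characters. $\widehat{\mathcal O_k^\times}$ is the set of (continuous) characters of $\mathcal O_k^\times$; for $\chi\in\widehat{\mathcal O_k^\times}$, $s\in\mathbb C$, $\chi_s(x)=\chi(\varpi_k^{-\nu_k(x)}x)|x|_k^s$ ($x\in k^\times$). Distributions. $\mathcal D'(\mathbb E)$ is the space of all linear functionals on $C_c^\infty(\mathbb E)$ (locally constant compactly supported functions); locally integrable functions are viewed as distributions via $dx$. $\mathcal D'(\mathbb E)_{s,t}^{\chi,\eta}$ is the space of $u\in\mathcal D'(\mathbb E)$ such that, in the sense of distributions, (a) for all $a\in\mathbb F^\times$: $u(ax)=\chi_{s-\frac12}(a)\eta_{t+\frac12}(a)^{-1}u(x)$ on $\mathbb E$; (b) for all $b\in\mathbb F^\times$: $u(\frac{x}{1-bx})=\chi_{s-\frac12}((1-bx)^2)^{-1}u(x)$ on $\mathbb E\setminus\{b^{-1}\}$. (Here $\langle u(a\cdot),\varphi\rangle=|a|_{\mathbb E}^{-1}\langle u,\varphi(a^{-1}\cdot)\rangle$, and $\langle u(\frac{\cdot}{1-b\cdot}),\varphi\rangle=\langle u,|1+b\cdot|_{\mathbb E}^{-2}\varphi(\frac{\cdot}{1+b\cdot})\rangle$ for $\varphi\in C_c^\infty(\mathbb E\setminus\{b^{-1}\})$.)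 Kernels. For $x\in\mathbb E\setminus\mathbb F$ put $K_{s,t}^{\chi,\eta}(x)=\chi_{s-\frac12}(x^2)\,(\chi_{s-\frac12}\eta_{t+\frac12})\big(\frac{x_2}{x_1^2-x_2^2\alpha^2}\big)$; this is locally integrable on $\mathbb E$ for $\operatorname{Re}(2s\pm t+\frac12)>0$. For such $(s,t)$ put $\widetilde K_{s,t}^{\chi,\eta}=\lambda_+\lambda_-K_{s,t}^{\chi,\eta}$, where $\lambda_\pm=1-q_{\mathbb F}^{-(2s\pm t+\frac12)}$ if $\chi|_{\mathcal O_{\mathbb F}^\times}\cdot\eta^{\pm1}=1$ and $\lambda_\pm=1$ otherwise (these are the inverse local $L$-factors $L(\frac12,\chi_s|_{\mathbb F^\times}\cdot\eta_t^{\pm1})^{-1}$).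
   Formalization: The uniformizers are assumed compatible: ϖ_F = ϖ_E if E/F is unramified and ϖ_F = ϖ_E² if ramified. For arbitrary choices λ_± need not be the inverse L-factors and the continuation can fail, e.g. when χ(ϖ_F/ϖ_E) ≠ 1 in the unramified case with η = χ^{-1} on O_F^×. *)

theory Defs
  imports "HOL-Analysis.Analysis"
begin

section \<open>Non-archimedean local fields\<close>

text \<open>Normalized discrete valuations; the value of \<open>val\<close> at \<open>0\<close> is irrelevant.\<close>

class discretely_valued_field = field +
  fixes val :: "'a \<Rightarrow> int"
  assumes val_mult: "x \<noteq> 0 \<Longrightarrow> y \<noteq> 0 \<Longrightarrow> val (x * y) = val x + val y"
    and val_add: "x \<noteq> 0 \<Longrightarrow> y \<noteq> 0 \<Longrightarrow> x + y \<noteq> 0 \<Longrightarrow> min (val x) (val y) \<le> val (x + y)"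
    and val_surj: "\<exists>x. x \<noteq> 0 \<and> val x = n"

context discretely_valued_field
begin

definition integers :: "'a set" where
  "integers = {x. x = 0 \<or> 0 \<le> val x}"

definition maximal_ideal :: "'a set" where
  "maximal_ideal = {x. x = 0 \<or> 0 < val x}"

definition int_units :: "'a set" where
  "int_units = {x. x \<noteq> 0 \<and> val x = 0}"

definition residue_field :: "'a set set" where
  "residue_field = integers // {(x, y). x \<in> integers \<and> y \<in> integers \<and> x - y \<in> maximal_ideal}"

definition residue_card :: "'a itself \<Rightarrow> nat" where
  "residue_card _ = card (residue_field :: 'a set set)"

text \<open>The normalized absolute value. It is the modulus of multiplication for Haar measure:
  \<open>d(ax) = absval a dx\<close>.\<close>

definition absval :: "'a \<Rightarrow> real" where
  "absval x = (if x = 0 then 0 else real (residue_card TYPE('a)) powi (- val x))"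

end

text \<open>A non-archimedean local field is a field which is complete with respect to a discrete
  valuation with finite residue field. The metric, and hence topology and Borel sets, is the one
  given by the normalized absolute value.\<close>

class nonarch_local_field = discretely_valued_field + complete_space +
  assumes finite_residue_field: "finite (residue_field :: 'a set set)"
    and dist_absval: "dist x y = absval (x - y)"

definition normalized_haar_measure :: "'a::nonarch_local_field measure \<Rightarrow> bool" where
  "normalized_haar_measure M \<longleftrightarrow>
     sets M = sets borel \<and>
     (\<forall>a. \<forall>A\<in>sets borel. emeasure M ((\<lambda>x. a + x) ` A) = emeasure M A) \<and>
     emeasure M integers = 1"


section \<open>Characters\<close>

definition unit_characters :: "('a::nonarch_local_field \<Rightarrow> complex) set" where
  "unit_characters = {chi. continuous_on int_units chi \<and>
     (\<forall>x\<in>int_units. chi x \<noteq> 0) \<and>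
     (\<forall>x\<in>int_units. \<forall>y\<in>int_units. chi (x * y) = chi x * chi y)}"

text \<open>The quasicharacter \<open>chi_s\<close> of the multiplicative group, for the uniformizer \<open>\<pi>\<close>.\<close>

definition quasichar :: "'a::nonarch_local_field \<Rightarrow> ('a \<Rightarrow> complex) \<Rightarrow> complex \<Rightarrow> 'a \<Rightarrow> complex" where
  "quasichar \<pi> chi s x = chi (\<pi> powi (- val x) * x) * complex_of_real (absval x) powr s"


section \<open>Distributions\<close>

text \<open>Elements of \<open>C\<^sub>c\<^sup>\<infinity>(U)\<close> for open \<open>U\<close>, extended by zero to the whole field.\<close>

definition test_functions :: "'a::nonarch_local_field set \<Rightarrow> ('a \<Rightarrow> complex) set" where
  "test_functions U = {\<phi>.
     (\<forall>x. \<exists>V. open V \<and> x \<in> V \<and> (\<forall>y\<in>V. \<phi> y = \<phi> x)) \<and>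
     compact (closure {x. \<phi> x \<noteq> 0}) \<and> closure {x. \<phi> x \<noteq> 0} \<subseteq> U}"

text \<open>Only the values on \<^term>\<open>test_functions UNIV\<close> matter.\<close>

definition distributions :: "(('a::nonarch_local_field \<Rightarrow> complex) \<Rightarrow> complex) set" where
  "distributions = {u.
     (\<forall>\<phi>\<in>test_functions UNIV. \<forall>\<psi>\<in>test_functions UNIV. u (\<lambda>x. \<phi> x + \<psi> x) = u \<phi> + u \<psi>) \<and>
     (\<forall>c. \<forall>\<phi>\<in>test_functions UNIV. u (\<lambda>x. c * \<phi> x) = c * u \<phi>)}"

definition fun_distribution ::
    "'a::nonarch_local_field measure \<Rightarrow> ('a \<Rightarrow> complex) \<Rightarrow> ('a \<Rightarrow> complex) \<Rightarrow> complex" where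
  "fun_distribution M f \<phi> = (\<integral>x. f x * \<phi> x \<partial>M)"

text \<open>The distribution \<open>u(ax)\<close>, for \<open>a \<noteq> 0\<close>.\<close>

definition distr_dilate ::
    "'a::nonarch_local_field \<Rightarrow> (('a \<Rightarrow> complex) \<Rightarrow> complex) \<Rightarrow> ('a \<Rightarrow> complex) \<Rightarrow> complex" where
  "distr_dilate a u \<phi> = inverse (complex_of_real (absval a)) * u (\<lambda>x. \<phi> (inverse a * x))"

text \<open>The distribution \<open>u(x/(1-bx))\<close>, to be applied to \<open>\<phi> \<in> C\<^sub>c\<^sup>\<infinity>(E - {1/b})\<close>. At the point
  \<open>x = -1/b\<close> the function which \<open>u\<close> is applied to is \<open>0\<close> because \<open>inverse 0 = 0\<close>; near that point it
  vanishes because \<open>\<phi>\<close> has compact support.\<close>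

definition distr_moebius ::
    "'a::nonarch_local_field \<Rightarrow> (('a \<Rightarrow> complex) \<Rightarrow> complex) \<Rightarrow> ('a \<Rightarrow> complex) \<Rightarrow> complex" where
  "distr_moebius b u \<phi> =
     u (\<lambda>x. inverse (complex_of_real (absval (1 + b * x)) ^ 2) * \<phi> (x / (1 + b * x)))"

definition distr_times ::
    "('a::nonarch_local_field \<Rightarrow> complex) \<Rightarrow> (('a \<Rightarrow> complex) \<Rightarrow> complex) \<Rightarrow> ('a \<Rightarrow> complex) \<Rightarrow> complex" where
  "distr_times g u \<phi> = u (\<lambda>x. g x * \<phi> x)"


section \<open>The quadratic extension\<close>

text \<open>\<open>E\<close> and \<open>F\<close> are the types \<open>'e\<close> and \<open>'f\<close>, and \<open>\<iota>\<close> is the inclusion of \<open>F\<close> into \<open>E\<close>.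
  The uniformizers are chosen compatibly, \<open>\<pi>\<^sub>F = \<pi>\<^sub>E\<^sup>e\<close> with \<open>e\<close> the ramification index. This says
  that \<open>chi_s(\<pi>\<^sub>F) = q\<^sub>F powr (-2s)\<close> for all \<open>chi\<close> and \<open>s\<close>, so that \<open>lambda_factor\<close> below is an inverse
  local L-factor; for other choices it is not.\<close>

locale quadratic_extension =
  fixes \<iota> :: "'f::nonarch_local_field \<Rightarrow> 'e::nonarch_local_field"
    and \<alpha> :: 'e and \<pi>E :: 'e and \<pi>F :: 'f
  assumes incl_add: "\<iota> (a + b) = \<iota> a + \<iota> b"
    and incl_mult: "\<iota> (a * b) = \<iota> a * \<iota> b"
    and incl_one: "\<iota> 1 = 1"
    and incl_continuous: "continuous_on UNIV \<iota>"
    and alpha_notin: "\<alpha> \<notin> range \<iota>"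
    and alpha_sq: "\<exists>d. d \<noteq> 0 \<and> (\<nexists>c. d = c ^ 2) \<and> \<alpha> ^ 2 = \<iota> d"
    and generated: "\<exists>x1 x2. x = \<iota> x1 + \<iota> x2 * \<alpha>"
    and uniformizerE: "\<pi>E \<noteq> 0" "val \<pi>E = 1"
    and uniformizerF: "\<pi>F \<noteq> 0" "val \<pi>F = 1"
    and unramified_or_ramified:
      "\<alpha> ^ 2 \<in> \<iota> ` int_units \<and> residue_card TYPE('e) = residue_card TYPE('f) ^ 2 \<and> \<iota> \<pi>F = \<pi>E
       \<or> \<alpha> ^ 2 \<in> \<iota> ` ((\<lambda>u. \<pi>F * u) ` int_units) \<and> residue_card TYPE('e) = residue_card TYPE('f)
         \<and> \<iota> \<pi>F = \<pi>E ^ 2"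

definition coords ::
    "('f::nonarch_local_field \<Rightarrow> 'e::nonarch_local_field) \<Rightarrow> 'e \<Rightarrow> 'e \<Rightarrow> 'f \<times> 'f" where
  "coords \<iota> \<alpha> x = (THE p. x = \<iota> (fst p) + \<iota> (snd p) * \<alpha>)"

text \<open>The element \<open>\<alpha>\<^sup>2\<close> of \<open>F\<close> is \<open>inv \<iota> (\<alpha> ^ 2)\<close>. The values on \<open>F\<close>, which is a null set,
  are irrelevant.\<close>

definition kernel ::
    "('f::nonarch_local_field \<Rightarrow> 'e::nonarch_local_field) \<Rightarrow> 'e \<Rightarrow> 'e \<Rightarrow> 'f \<Rightarrow>
     ('e \<Rightarrow> complex) \<Rightarrow> ('f \<Rightarrow> complex) \<Rightarrow> complex \<Rightarrow> complex \<Rightarrow> 'e \<Rightarrow> complex" where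
  "kernel \<iota> \<alpha> \<pi>E \<pi>F chi eta s t x =
     (let x1 = fst (coords \<iota> \<alpha> x); x2 = snd (coords \<iota> \<alpha> x);
          y = x2 / (x1 ^ 2 - x2 ^ 2 * inv \<iota> (\<alpha> ^ 2))
      in quasichar \<pi>E chi (s - 1/2) (x ^ 2) *
         (quasichar \<pi>E chi (s - 1/2) (\<iota> y) * quasichar \<pi>F eta (t + 1/2) y))"

text \<open>\<open>\<lambda>\<^sub>+\<close> and \<open>\<lambda>\<^sub>-\<close> are the cases \<open>\<epsilon> = 1\<close> and \<open>\<epsilon> = -1\<close>.\<close>

definition lambda_factor ::
    "int \<Rightarrow> ('f::nonarch_local_field \<Rightarrow> 'e::nonarch_local_field) \<Rightarrow>
     ('e \<Rightarrow> complex) \<Rightarrow> ('f \<Rightarrow> complex) \<Rightarrow> complex \<Rightarrow> complex \<Rightarrow> complex" where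
  "lambda_factor \<epsilon> \<iota> chi eta s t =
     (if \<forall>u\<in>int_units. chi (\<iota> u) * eta u powi \<epsilon> = 1
      then 1 - of_nat (residue_card TYPE('f)) powr (- (2 * s + of_int \<epsilon> * t + 1/2))
      else 1)"

definition normalized_kernel ::
    "('f::nonarch_local_field \<Rightarrow> 'e::nonarch_local_field) \<Rightarrow> 'e \<Rightarrow> 'e \<Rightarrow> 'f \<Rightarrow>
     ('e \<Rightarrow> complex) \<Rightarrow> ('f \<Rightarrow> complex) \<Rightarrow> complex \<Rightarrow> complex \<Rightarrow> 'e \<Rightarrow> complex" where
  "normalized_kernel \<iota> \<alpha> \<pi>E \<pi>F chi eta s t x =
     lambda_factor 1 \<iota> chi eta s t * lambda_factor (- 1) \<iota> chi eta s t * kernel \<iota> \<alpha> \<pi>E \<pi>F chi eta s t x"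

definition equivariant_distributions ::
    "('f::nonarch_local_field \<Rightarrow> 'e::nonarch_local_field) \<Rightarrow> 'e \<Rightarrow> 'f \<Rightarrow>
     ('e \<Rightarrow> complex) \<Rightarrow> ('f \<Rightarrow> complex) \<Rightarrow> complex \<Rightarrow> complex \<Rightarrow>
     (('e \<Rightarrow> complex) \<Rightarrow> complex) set" where
  "equivariant_distributions \<iota> \<pi>E \<pi>F chi eta s t = {u \<in> distributions.
     (\<forall>a. a \<noteq> 0 \<longrightarrow> (\<forall>\<phi>\<in>test_functions UNIV.
        distr_dilate (\<iota> a) u \<phi> =
        quasichar \<pi>E chi (s - 1/2) (\<iota> a) * inverse (quasichar \<pi>F eta (t + 1/2) a) * u \<phi>)) \<and>
     (\<forall>b. b \<noteq> 0 \<longrightarrow> (\<forall>\<phi>\<in>test_functions (- {inverse (\<iota> b)}).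
        distr_moebius (\<iota> b) u \<phi> =
        distr_times (\<lambda>x. inverse (quasichar \<pi>E chi (s - 1/2) ((1 - \<iota> b * x) ^ 2))) u \<phi>))}"


section \<open>Holomorphic functions of two variables\<close>

text \<open>Complex differentiability at every point of \<open>\<complex>\<^sup>2\<close>: the real derivative exists and is
  complex linear.\<close>

definition holomorphic2 :: "(complex \<times> complex \<Rightarrow> complex) \<Rightarrow> bool" where
  "holomorphic2 f \<longleftrightarrow> (\<forall>z. \<exists>a b. (f has_derivative (\<lambda>h. a * fst h + b * snd h)) (at z))"

end

theory Submission
  imports Defs "HOL-Complex_Analysis.Conformal_Mappings"
begin

text \<open>
  Write \<open>K\<close> for the kernel. Dilation by \<open>a \<in> F\<close> multiplies \<open>K\<close> by a quasicharacter, so that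
  \<open>\<langle>K, \<phi> - \<phi>(x/a)\<rangle> = (1 - c\<^sub>a) \<langle>K, \<phi>\<rangle>\<close>, where \<open>\<phi> - \<phi>(x/a)\<close> vanishes near \<open>0\<close>. If the relevant
  character of the units of \<open>F\<close> is trivial, then \<open>1 - c\<^sub>a\<close> is the factor \<open>\<lambda>\<^sub>-\<close> for \<open>a = \<pi>\<^sub>F\<close>; otherwise it
  is a nonzero constant for a suitable unit \<open>a\<close>. Close to \<open>F - {0}\<close> the kernel is likewise multiplied
  by a quasicharacter under the maps \<open>x\<^sub>1 + x\<^sub>2 \<alpha> \<mapsto> x\<^sub>1 + c x\<^sub>2 \<alpha>\<close>, which fix \<open>F\<close>; the same trick gives
  the factor \<open>\<lambda>\<^sub>+\<close>. After both steps only test functions vanishing near \<open>F\<close> are left, and on these \<open>K\<close> is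
  a finite sum of exponentials in \<open>(s, t)\<close>. This defines the continuation for all \<open>(s, t)\<close>, and its
  equivariance follows from that of \<open>K\<close> by the identity theorem.
\<close>

text \<open>The two Jacobians explain the exponents. Dilation by a in F has modulus |a|_E = |a|_F^2,
  scaling of the second coordinate by c has modulus |c|_F. Together with the shifts \<sigma> = s -
  1/2 and \<tau> = t + 1/2 they turn the multipliers at a uniformizer into q_F^(-(2s - t + 1/2)) and
  q_F^(-(2s + t + 1/2)). The obstacle is that the second scaling is not E-linear: K is homogeneous
  under it only on a cone around F, where x and its norm differ from c1 and c1^2 by factors near 1.
  That cone is not a neighbourhood of 0, so its indicator serves as a cutoff only after the
  singularity at 0 has been removed; this fixes the order of the steps. Absolute convergence comes
  from the same scalings: each cuts its domain into shells, and the integral is dominated by a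
  geometric series. The factor in the Moebius equivariance depends on s, hence so does the test
  function; it splits into finitely many exponentials in s, after which the identity theorem along
  lines in the direction of s suffices.\<close>

section \<open>Topological algebra of local fields\<close>

lemma val_one [simp]: "val (1::'a::discretely_valued_field) = 0"
  using val_mult[of "1::'a" 1] by simp

lemma val_uminus [simp]: "val (- x) = val (x::'a::discretely_valued_field)"
proof (cases "x = 0")
  case False
  have "val (-1::'a) = 0"
    using val_mult[of "-1::'a" "-1"] by simp
  then show ?thesis
    using val_mult[of "-1" x] False by simp
qed simp

lemma val_inverse:
  fixes x :: "'a::discretely_valued_field"
  assumes "x \<noteq> 0"
  shows "val (inverse x) = - val x"
  using val_mult[of x "inverse x"] assms by simp

lemma val_power:
  fixes x :: "'a::discretely_valued_field"
  assumes "x \<noteq> 0"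
  shows "val (x ^ n) = int n * val x"
  by (induction n) (simp_all add: assms val_mult algebra_simps)

lemma val_power_int:
  fixes x :: "'a::discretely_valued_field"
  assumes "x \<noteq> 0"
  shows "val (x powi n) = n * val x"
  using assms by (simp add: power_int_def val_power val_inverse)

text \<open>The classes of 0 and 1 differ because 1 has valuation 0. With base q > 1 the powers of q
  separate valuations, and q^(-n) tends to 0.\<close>

lemma one_less_residue_card: "1 < residue_card TYPE('a::nonarch_local_field)"
proof -
  define R where "R = {(x, y). x \<in> integers \<and> y \<in> integers \<and> x - y \<in> (maximal_ideal :: 'a set)}"
  have RF: "(residue_field :: 'a set set) = integers // R"
    by (simp add: residue_field_def R_def)
  have "(0::'a) \<in> integers" "(1::'a) \<in> integers"
    by (simp_all add: integers_def)
  then have "R `` {0::'a} \<in> residue_field" "R `` {1::'a} \<in> residue_field"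
    unfolding RF by (auto intro: quotientI)
  moreover have "(1::'a) \<in> R `` {1}" "(1::'a) \<notin> R `` {0}"
    by (auto simp: R_def integers_def maximal_ideal_def)
  ultimately have "card {R `` {0::'a}, R `` {1::'a}} \<le> residue_card TYPE('a)"
    "R `` {0::'a} \<noteq> R `` {1}"
    unfolding residue_card_def by (auto intro!: card_mono finite_residue_field)
  then show ?thesis
    by simp
qed

lemma residue_card_pos [simp]: "0 < residue_card TYPE('a::nonarch_local_field)"
  using one_less_residue_card[where 'a='a] by linarith

abbreviation qcard :: "'a::nonarch_local_field itself \<Rightarrow> real" where
  "qcard T \<equiv> real (residue_card T)"

lemma qcard_gt_1: "1 < qcard TYPE('a::nonarch_local_field)"
  using one_less_residue_card by simp

lemma qcard_pos: "0 < qcard TYPE('a::nonarch_local_field)"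
  using qcard_gt_1[where 'a='a] by linarith

lemma absval_eq:
  "x \<noteq> 0 \<Longrightarrow> absval (x::'a::nonarch_local_field) = qcard TYPE('a) powi (- val x)"
  by (simp add: absval_def)

lemma absval_0 [simp]: "absval (0::'a::nonarch_local_field) = 0"
  by (simp add: absval_def)

lemma absval_pos: "x \<noteq> 0 \<Longrightarrow> 0 < absval (x::'a::nonarch_local_field)"
  by (simp add: absval_eq qcard_pos zero_less_power_int)

lemma absval_nonneg [simp]: "0 \<le> absval (x::'a::nonarch_local_field)"
  using absval_pos[of x] by (cases "x = 0") auto

lemma absval_eq_0_iff [simp]: "absval (x::'a::nonarch_local_field) = 0 \<longleftrightarrow> x = 0"
  by (cases "x = 0") (use absval_pos[of x] in auto)

lemma absval_pos_iff [simp]: "0 < absval (x::'a::nonarch_local_field) \<longleftrightarrow> x \<noteq> 0"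
  using absval_pos[of x] by auto

lemma absval_le_0_iff [simp]: "absval (x::'a::nonarch_local_field) \<le> 0 \<longleftrightarrow> x = 0"
  using absval_pos[of x] by (cases "x = 0") (simp_all add: not_le)

lemma absval_mult: "absval (x * y) = absval x * absval (y::'a::nonarch_local_field)"
  by (cases "x = 0"; cases "y = 0") (simp_all add: absval_eq val_mult flip: power_int_add)

lemma absval_1 [simp]: "absval (1::'a::nonarch_local_field) = 1"
  by (simp add: absval_eq)

lemma absval_uminus [simp]: "absval (- x) = absval (x::'a::nonarch_local_field)"
  by (simp add: absval_def)

lemma absval_minus_commute: "absval (x - y) = absval (y - x :: 'a::nonarch_local_field)"
  using absval_uminus[of "x - y"] by simp

lemma absval_inverse: "absval (inverse x) = inverse (absval (x::'a::nonarch_local_field))"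
proof (cases "x = 0")
  case False
  then show ?thesis
    using absval_mult[of x "inverse x"] by (simp add: field_simps)
qed simp

lemma absval_divide: "absval (x / y) = absval x / absval (y::'a::nonarch_local_field)"
  by (simp add: divide_inverse absval_mult absval_inverse)

lemma absval_power: "absval (x ^ n) = absval (x::'a::nonarch_local_field) ^ n"
  by (induction n) (simp_all add: absval_mult)

lemma powi_le_iff: "(1::real) < q \<Longrightarrow> q powi m \<le> q powi n \<longleftrightarrow> m \<le> n"
  using power_int_increasing[of m n q] power_int_strict_increasing[of n m q] by (cases "m \<le> n") auto

lemma absval_le_iff:
  fixes x y :: "'a::nonarch_local_field"
  assumes "x \<noteq> 0" "y \<noteq> 0"
  shows "absval x \<le> absval y \<longleftrightarrow> val y \<le> val x"
  using assms by (simp add: absval_eq powi_le_iff[OF qcard_gt_1])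

lemma absval_eq_iff:
  fixes x y :: "'a::nonarch_local_field"
  assumes "x \<noteq> 0" "y \<noteq> 0"
  shows "absval x = absval y \<longleftrightarrow> val y = val x"
  using absval_le_iff[OF assms] absval_le_iff[OF assms(2,1)] by auto

lemma absval_add: "absval (x + y) \<le> max (absval x) (absval (y::'a::nonarch_local_field))"
proof (cases "x = 0 \<or> y = 0 \<or> x + y = 0")
  case False
  then have "min (val x) (val y) \<le> val (x + y)"
    by (intro val_add) auto
  then show ?thesis
    using False absval_le_iff[of "x + y" x] absval_le_iff[of "x + y" y] by (auto simp: min_def split: if_splits)
qed (auto simp: le_max_iff_disj)

text \<open>Isosceles principle: the reverse inequality is the ultrametric one for x = (x + y) +
  (-y).\<close>

lemma absval_add_eq:
  fixes x y :: "'a::nonarch_local_field"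
  assumes "absval y < absval x"
  shows "absval (x + y) = absval x"
  using absval_add[of x y] absval_add[of "x + y" "- y"] assms by (simp add: max_def split: if_splits)

section \<open>Continuity of the field operations\<close>

instance nonarch_local_field \<subseteq> topological_ab_group_add
proof
  fix a b :: 'a
  show "LIM x (nhds a \<times>\<^sub>F nhds b). fst x + snd x :> nhds (a + b)"
    unfolding tendsto_iff eventually_prod_filter
  proof (intro allI impI)
    fix e :: real assume "e > 0"
    have "dist (x + y) (a + b) < e" if "dist x a < e" "dist y b < e" for x y
      using absval_add[of "x - a" "y - b"] that by (auto simp: dist_absval algebra_simps)
    then show "\<exists>Pf Pg. eventually Pf (nhds a) \<and> eventually Pg (nhds b) \<and>
      (\<forall>x y. Pf x \<longrightarrow> Pg y \<longrightarrow> dist (fst (x, y) + snd (x, y)) (a + b) < e)"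
      using \<open>e > 0\<close>
      by (intro exI[of _ "\<lambda>x. dist x a < e"] exI[of _ "\<lambda>x. dist x b < e"])
         (auto simp: eventually_nhds_metric)
  qed
  have "dist (- x) (- a) = dist x a" for x
    using absval_uminus[of "x - a"] by (simp add: dist_absval)
  then show "(uminus \<longlongrightarrow> - a) (nhds a)"
    by (auto simp: tendsto_iff eventually_nhds_metric)
qed

lemma tendsto_iff_absval:
  "(f \<longlongrightarrow> (l::'a::nonarch_local_field)) F \<longleftrightarrow> ((\<lambda>x. absval (f x - l)) \<longlongrightarrow> 0) F"
  by (simp add: tendsto_dist_iff[of f l] dist_absval)

lemma tendsto_absval [tendsto_intros]:
  assumes "(f \<longlongrightarrow> (l::'a::nonarch_local_field)) F"
  shows "((\<lambda>x. absval (f x)) \<longlongrightarrow> absval l) F"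
  using tendsto_dist[OF assms tendsto_const[of 0]] by (simp add: dist_absval)

lemma continuous_absval [continuous_intros]:
  fixes f :: "'b::topological_space \<Rightarrow> 'a::nonarch_local_field"
  shows "continuous_on S f \<Longrightarrow> continuous_on S (\<lambda>x. absval (f x))"
  by (auto simp: continuous_on_def intro: tendsto_absval)

instance nonarch_local_field \<subseteq> topological_semigroup_mult
proof
  fix a b :: 'a
  have 1: "(fst \<longlongrightarrow> a) (nhds a \<times>\<^sub>F nhds b)" "(snd \<longlongrightarrow> b) (nhds a \<times>\<^sub>F nhds b)"
    by (rule filterlim_fst, rule filterlim_snd)
  then have 2: "((\<lambda>p. absval (fst p - a)) \<longlongrightarrow> 0) (nhds a \<times>\<^sub>F nhds b)"
    "((\<lambda>p. absval (snd p - b)) \<longlongrightarrow> 0) (nhds a \<times>\<^sub>F nhds b)"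
    by (simp_all only: tendsto_iff_absval)
  define g where "g p = absval (fst p - a) * absval (snd p) + absval a * absval (snd p - b)" for p
  have "(g \<longlongrightarrow> 0 * absval b + absval a * 0) (nhds a \<times>\<^sub>F nhds b)"
    unfolding g_def by (intro tendsto_add tendsto_mult tendsto_const tendsto_absval 1 2)
  then have g: "(g \<longlongrightarrow> 0) (nhds a \<times>\<^sub>F nhds b)"
    by simp
  have le: "absval (fst p * snd p - a * b) \<le> g p" for p
  proof -
    have "fst p * snd p - a * b = (fst p - a) * snd p + a * (snd p - b)"
      by (simp add: algebra_simps)
    then have "absval (fst p * snd p - a * b) \<le> max (absval ((fst p - a) * snd p)) (absval (a * (snd p - b)))"
      by (metis absval_add)
    also have "\<dots> \<le> absval ((fst p - a) * snd p) + absval (a * (snd p - b))"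
      by simp
    finally show ?thesis by (simp add: absval_mult g_def)
  qed
  show "LIM x (nhds a \<times>\<^sub>F nhds b). fst x * snd x :> nhds (a * b)"
    unfolding tendsto_iff_absval
    by (rule tendsto_sandwich[OF _ _ tendsto_const g]) (simp_all only: le absval_nonneg eventually_True)
qed

instance nonarch_local_field \<subseteq> topological_comm_monoid_mult ..

text \<open>Once f x is closer to l than |l|, the isosceles principle applies: the absolute value
  attains its limit exactly.\<close>

lemma eventually_absval_eq:
  fixes l :: "'a::nonarch_local_field"
  assumes "(f \<longlongrightarrow> l) F" "l \<noteq> 0"
  shows "eventually (\<lambda>x. absval (f x) = absval l) F"
proof -
  have "eventually (\<lambda>x. absval (f x - l) < absval l) F"
    using assms by (intro order_tendstoD(2)[of _ 0]) (auto simp flip: tendsto_iff_absval)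
  then show ?thesis
    by eventually_elim (metis absval_add_eq diff_add_cancel add.commute)
qed

lemma eventually_nz:
  fixes l :: "'a::nonarch_local_field"
  assumes "(f \<longlongrightarrow> l) F" "l \<noteq> 0"
  shows "eventually (\<lambda>x. f x \<noteq> 0) F"
  using eventually_absval_eq[OF assms] by eventually_elim (use assms(2) in auto)

lemma tendsto_inverse_field [tendsto_intros]:
  fixes l :: "'a::nonarch_local_field"
  assumes "(f \<longlongrightarrow> l) F" "l \<noteq> 0"
  shows "((\<lambda>x. inverse (f x)) \<longlongrightarrow> inverse l) F"
  unfolding tendsto_iff_absval
proof (rule Lim_transform_eventually)
  show "((\<lambda>x. absval (f x - l) / (absval l * absval l)) \<longlongrightarrow> 0) F"
    using assms by (intro tendsto_divide_zero) (auto simp flip: tendsto_iff_absval)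
  show "\<forall>\<^sub>F x in F. absval (f x - l) / (absval l * absval l) = absval (inverse (f x) - inverse l)"
    using eventually_absval_eq[OF assms] eventually_nz[OF assms]
  proof eventually_elim
    case (elim x)
    have "inverse (f x) - inverse l = - ((f x - l) / (f x * l))"
      using elim assms(2) by (simp add: field_simps)
    then have "absval (inverse (f x) - inverse l) = absval ((f x - l) / (f x * l))"
      by (metis absval_uminus)
    then show ?case
      using elim by (simp add: absval_divide absval_mult)
  qed
qed

lemma tendsto_divide_field [tendsto_intros]:
  fixes l :: "'a::nonarch_local_field"
  assumes "(f \<longlongrightarrow> k) F" "(g \<longlongrightarrow> l) F" "l \<noteq> 0"
  shows "((\<lambda>x. f x / g x) \<longlongrightarrow> k / l) F"
  using assms unfolding divide_inverse by (intro tendsto_intros)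

section \<open>Balls\<close>

text \<open>Radii come from the value group and are indexed by the valuation, so that membership is
  an inequality between integers and these closed balls are open as well.\<close>

definition vball :: "'a::nonarch_local_field \<Rightarrow> int \<Rightarrow> 'a set" where
  "vball c n = {x. absval (x - c) \<le> qcard TYPE('a) powi (- n)}"

lemma mem_vball_iff_val:
  "x \<in> vball c n \<longleftrightarrow> x = c \<or> n \<le> val (x - c :: 'a::nonarch_local_field)"
  by (cases "x = c") (simp_all add: vball_def absval_eq powi_le_iff[OF qcard_gt_1])

lemma vball_0_0: "vball 0 0 = (integers :: 'a::nonarch_local_field set)"
  by (auto simp: mem_vball_iff_val integers_def)

lemma vball_0_1: "vball 0 1 = (maximal_ideal :: 'a::nonarch_local_field set)"
  by (auto simp: mem_vball_iff_val maximal_ideal_def)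

lemma vball_eq_cball: "vball c n = cball (c::'a::nonarch_local_field) (qcard TYPE('a) powi (- n))"
  by (auto simp: vball_def dist_absval absval_minus_commute)

lemma closed_vball [simp]: "closed (vball c n)"
  by (simp add: vball_eq_cball)

lemma center_in_vball [simp]: "c \<in> vball c n"
  by (simp add: vball_def)

text \<open>By the ultrametric inequality every point of a ball serves as its center.\<close>

lemma vball_eqI:
  assumes "y \<in> vball c n"
  shows "vball y n = vball c (n::int)"
proof -
  have *: "vball y n \<subseteq> vball c n" if "y \<in> vball c n" for y c :: 'a
  proof
    fix x assume "x \<in> vball y n"
    then show "x \<in> vball c n"
      using that absval_add[of "x - y" "y - c"] by (auto simp: vball_def)
  qed
  have "c \<in> vball y n"
    using assms by (simp add: vball_def absval_minus_commute)
  then show ?thesis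
    using * assms by blast
qed

lemma vball_mono: "m \<le> n \<Longrightarrow> vball c n \<subseteq> vball c m"
  by (auto simp: mem_vball_iff_val)

text \<open>Balls that meet are nested. With the empty set they are therefore stable under
  intersection, as a generator for uniqueness of measures must be.\<close>

lemma vball_Int:
  assumes "m \<le> n" "vball c m \<inter> vball d n \<noteq> {}"
  shows "vball c m \<inter> vball d n = vball d n"
proof -
  obtain x where x: "x \<in> vball c m" "x \<in> vball d n"
    using assms by auto
  then have "vball d n \<subseteq> vball c m"
    using vball_eqI[OF x(1)] vball_eqI[OF x(2)] vball_mono[OF assms(1), of x] by simp
  then show ?thesis by blast
qed

lemma open_vball [simp]: "open (vball c n)"
  unfolding open_contains_ball
proof
  fix x assume x: "x \<in> vball c n"
  have "ball x (qcard TYPE('a) powi (- n)) \<subseteq> vball x n"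
    by (auto simp: vball_eq_cball)
  then show "\<exists>e>0. ball x e \<subseteq> vball c n"
    using vball_eqI[OF x] by (intro exI[of _ "qcard TYPE('a) powi (- n)"]) auto
qed

lemma vball_in_open:
  fixes x :: "'a::nonarch_local_field"
  assumes "open U" "x \<in> U"
  obtains n :: nat where "vball x (int n) \<subseteq> U"
proof -
  obtain e where e: "e > 0" "ball x e \<subseteq> U"
    using assms open_contains_ball by blast
  obtain n where n: "(1 / qcard TYPE('a)) ^ n < e"
    using real_arch_pow_inv[OF e(1), of "1 / qcard TYPE('a)"] qcard_gt_1[where 'a='a] by auto
  have "vball x (int n) \<subseteq> ball x e"
    using n by (auto simp: vball_eq_cball power_int_minus power_int_def divide_inverse power_inverse)
  then show ?thesis
    using e that by blast
qed

lemma vball_image: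
  fixes a c d :: "'a::nonarch_local_field"
  assumes "a \<noteq> 0"
  shows "(\<lambda>x. d + a * x) ` vball c n = vball (d + a * c) (n + val a)"
proof -
  have "x \<in> vball c n \<longleftrightarrow> d + a * x \<in> vball (d + a * c) (n + val a)" for x
  proof (cases "x = c")
    case False
    have "d + a * x - (d + a * c) = a * (x - c)"
      by (simp add: algebra_simps)
    then show ?thesis
      using False assms by (auto simp: mem_vball_iff_val val_mult)
  qed simp
  moreover have "y = d + a * ((y - d) / a)" for y
    using assms by simp
  ultimately show ?thesis
    by (metis (no_types, lifting) image_iff subsetI subset_antisym)
qed

text \<open>Congruence modulo the maximal ideal is distance at most q^(-1), so residue classes are
  balls of level 1. This turns the algebraic number \<open>residue_card\<close> into a count of
  balls.\<close>

lemma integers_partition: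
  "disjoint (residue_field :: 'a::nonarch_local_field set set)"
  "\<Union> residue_field = (integers :: 'a::nonarch_local_field set)"
  "(X :: 'a::nonarch_local_field set) \<in> residue_field \<Longrightarrow> \<exists>c. X = vball c 1"
proof -
  define R where "R = {(x, y). x \<in> integers \<and> y \<in> integers \<and> x - y \<in> (maximal_ideal :: 'a set)}"
  have RF: "(residue_field :: 'a set set) = integers // R"
    by (simp add: residue_field_def R_def)
  have R: "(x, y) \<in> R \<longleftrightarrow> x \<in> vball 0 0 \<and> y \<in> vball x 1" for x y
  proof -
    have "y \<in> vball 0 0" if "x \<in> vball 0 0" "y \<in> vball x 1"
      using that vball_eqI[OF that(1)] vball_mono[of 0 1 x] by auto
    moreover have "x - y \<in> vball 0 1 \<longleftrightarrow> y \<in> vball x 1"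
      by (simp add: vball_def absval_minus_commute)
    ultimately show ?thesis
      unfolding R_def by (auto simp flip: vball_0_0 vball_0_1)
  qed
  have "equiv integers R"
  proof (rule equivI)
    show "R \<subseteq> integers \<times> integers" "refl_on integers R"
      by (auto simp: R_def refl_on_def maximal_ideal_def)
    show "sym R" "trans R"
    proof -
      show "sym R"
        unfolding R_def sym_def by (auto simp flip: vball_0_1 simp: vball_def absval_minus_commute)
      show "trans R"
      proof (rule transI)
        fix x y z assume "(x, y) \<in> R" "(y, z) \<in> R"
        then show "(x, z) \<in> R"
          using vball_eqI[of y x 1] by (auto simp: R)
      qed
    qed
  qed
  then show "disjoint (residue_field :: 'a set set)" "\<Union> residue_field = (integers :: 'a set)"
    unfolding RF using quotient_disj[of integers R] Union_quotient[of integers R]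
    by (auto simp: disjoint_def)
  show "\<exists>c. X = vball c 1" if X: "X \<in> residue_field"
  proof -
    obtain x where x: "x \<in> integers" "X = R `` {x}"
      using X unfolding RF by (rule quotientE)
    then have "X = vball x 1"
      by (auto simp: R vball_0_0)
    then show ?thesis ..
  qed
qed

text \<open>Transport of the residue classes along x -> d + a x with val a = n, which shifts the
  level of every ball by n.\<close>

lemma vball_split:
  fixes d :: "'a::nonarch_local_field"
  obtains B where "finite B" "card B = residue_card TYPE('a)" "disjoint B" "\<Union> B = vball d n"
    "\<And>X. X \<in> B \<Longrightarrow> \<exists>c. X = vball c (n + 1)"
proof -
  obtain a :: 'a where a: "a \<noteq> 0" "val a = n"
    using val_surj by blast
  define f where "f = (\<lambda>x. d + a * x)"
  have inj: "inj f"
    using a by (auto simp: f_def inj_on_def)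
  have vb: "f ` vball c m = vball (f c) (m + n)" for c m
    using vball_image[OF a(1), of d c m] a by (simp add: f_def)
  show ?thesis
  proof
    show "finite ((`) f ` residue_field)"
      using finite_residue_field by blast
    show "card ((`) f ` residue_field) = residue_card TYPE('a)"
      unfolding residue_card_def
      by (intro card_image inj_onI) (simp add: inj_image_eq_iff[OF inj])
    show "disjoint ((`) f ` residue_field)"
      using integers_partition(1)[where 'a='a] unfolding disjoint_def
      by (simp add: inj_image_eq_iff[OF inj] flip: image_Int[OF inj])
    show "\<Union> ((`) f ` residue_field) = vball d n"
      using vb[of 0 0] unfolding image_Union[symmetric] integers_partition(2) vball_0_0 by (simp add: f_def)
    show "\<exists>c. X = vball c (n + 1)" if X: "X \<in> (`) f ` residue_field" for X
    proof -
      obtain Y where Y: "Y \<in> residue_field" "X = f ` Y"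
        using X by blast
      obtain c where "Y = vball c 1"
        using integers_partition(3)[OF Y(1)] by blast
      then show ?thesis
        using Y(2) vb[of c 1] by (metis add.commute)
    qed
  qed
qed

lemma vball_cover:
  fixes d :: "'a::nonarch_local_field"
  shows "\<exists>B. finite B \<and> \<Union> B = vball d n \<and> (\<forall>X\<in>B. \<exists>c. X = vball c (n + int k))"
proof (induction k)
  case 0
  show ?case by (intro exI[of _ "{vball d n}"]) auto
next
  case (Suc k)
  then obtain B where B: "finite B" "\<Union> B = vball d n" "\<forall>X\<in>B. \<exists>c. X = vball c (n + int k)"
    by blast
  have "\<exists>C. finite C \<and> \<Union> C = X \<and> (\<forall>Y\<in>C. \<exists>c. Y = vball c (n + int (Suc k)))"
    if X: "X \<in> B" for X
  proof -
    obtain c where c: "X = vball c (n + int k)"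
      using B(3) X by blast
    obtain C where C: "finite C" "\<Union> C = X" "\<And>Y. Y \<in> C \<Longrightarrow> \<exists>c. Y = vball c (n + int k + 1)"
      using vball_split[of c "n + int k"] unfolding c by metis
    then show ?thesis
      by (intro exI[of _ C]) (simp add: algebra_simps)
  qed
  then obtain C where C: "\<And>X. X \<in> B \<Longrightarrow> finite (C X) \<and> \<Union> (C X) = X \<and>
      (\<forall>Y\<in>C X. \<exists>c. Y = vball c (n + int (Suc k)))"
    by metis
  show ?case
  proof (intro exI[of _ "\<Union> (C ` B)"] conjI ballI)
    show "finite (\<Union> (C ` B))"
      using B(1) C by blast
    have "\<Union> (\<Union> (C ` B)) = (\<Union>X\<in>B. \<Union> (C X))"
      by blast
    also have "\<dots> = (\<Union>X\<in>B. X)"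
      using C by simp
    finally show "\<Union> (\<Union> (C ` B)) = vball d n"
      using B(2) by simp
    fix Y assume "Y \<in> \<Union> (C ` B)"
    then show "\<exists>c. Y = vball c (n + int (Suc k))"
      using C by blast
  qed
qed

text \<open>Completeness is inherited because the ball is closed, and \<open>vball_cover\<close>
  gives total boundedness.\<close>

lemma compact_vball [simp]: "compact (vball (d::'a::nonarch_local_field) n)"
  unfolding compact_eq_totally_bounded
proof (intro conjI allI impI)
  show "complete (vball d n)"
    by (simp add: complete_eq_closed)
  fix e :: real assume "e > 0"
  then obtain k where k: "vball (0::'a) (int k) \<subseteq> ball 0 e"
    using vball_in_open[of "ball (0::'a) e" 0] by auto
  \<comment> \<open>\<open>nat (int k - n)\<close> is 0 if the ball itself is already small enough;
    in either case the pieces have level at least k.\<close>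
  obtain B where B: "finite B" "\<Union> B = vball d n" "\<forall>X\<in>B. \<exists>c. X = vball c (n + int (nat (int k - n)))"
    using vball_cover[of d n "nat (int k - n)"] by blast
  have "\<exists>c. X \<subseteq> ball c e" if X: "X \<in> B" for X
  proof -
    obtain c where "X = vball c (n + int (nat (int k - n)))"
      using B(3) X by blast
    then have "X \<subseteq> vball c (int k)"
      using vball_mono[of "int k" "n + int (nat (int k - n))" c] by auto
    also have "\<dots> \<subseteq> ball c e"
    proof
      fix x assume "x \<in> vball c (int k)"
      then have "x - c \<in> vball 0 (int k)"
        by (simp add: vball_def)
      with k show "x \<in> ball c e"
        by (auto simp: dist_absval absval_minus_commute)
    qed
    finally show ?thesis ..
  qed
  then obtain c where c: "\<And>X. X \<in> B \<Longrightarrow> X \<subseteq> ball (c X) e"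
    by metis
  have "\<Union> B \<subseteq> (\<Union>x\<in>c ` B. ball x e)"
    using c by blast
  then show "\<exists>K. finite K \<and> vball d n \<subseteq> (\<Union>x\<in>K. ball x e)"
    using B(1,2) by (metis finite_imageI)
qed

lemma bounded_in_vball:
  fixes S :: "'a::nonarch_local_field set"
  assumes "bounded S"
  obtains n where "S \<subseteq> vball 0 n"
proof -
  obtain e where e: "\<And>x. x \<in> S \<Longrightarrow> dist 0 x \<le> e"
    using assms bounded_any_center[of S 0] by auto
  obtain n where "e < qcard TYPE('a) ^ n"
    using real_arch_pow[OF qcard_gt_1] by blast
  then have "S \<subseteq> vball 0 (- int n)"
    using e by (fastforce simp: vball_def dist_absval power_int_def)
  then show ?thesis
    by (rule that)
qed

text \<open>A fixed ball contains finitely many balls of a given level, and the balls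
  \<open>vball 0 (- int m)\<close> exhaust the field. Countability makes every open set a countable
  union of balls.\<close>

lemma countable_vballs: "countable {vball (c::'a::nonarch_local_field) n | c n. True}"
proof -
  have *: "countable {vball c n | c. c \<in> vball (0::'a) (- int m)}" for n m
  proof -
    define k where "k = nat (n + int m)"
    obtain B where B: "finite B" "\<Union> B = vball (0::'a) (- int m)" "\<forall>X\<in>B. \<exists>c. X = vball c (- int m + int k)"
      using vball_cover[of "0::'a" "- int m" k] by blast
    show "countable {vball c n | c. c \<in> vball (0::'a) (- int m)}"
    proof (cases "n + int m \<ge> 0")
      case True
      then have "{vball c n | c. c \<in> vball (0::'a) (- int m)} \<subseteq> B"
      proof safe
        fix c assume "c \<in> vball (0::'a) (- int m)"
        then obtain X where X: "X \<in> B" "c \<in> X"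
          using B(2) by blast
        then obtain d where "X = vball d n"
          using B(3) True by (auto simp: k_def)
        with X show "vball c n \<in> B"
          using vball_eqI by metis
      qed
      then show ?thesis
        using B(1) by (meson countable_finite finite_subset)
    next
      case False
      have "vball c n = vball 0 n" if "c \<in> vball (0::'a) (- int m)" for c
        using that False vball_mono[of n "- int m" 0] by (intro vball_eqI) auto
      then have "{vball c n | c. c \<in> vball (0::'a) (- int m)} \<subseteq> {vball 0 n}"
        by blast
      then show ?thesis
        by (meson countable_finite finite.emptyI finite.insertI finite_subset)
    qed
  qed
  have "{vball (c::'a) n | c n. True} \<subseteq> (\<Union>n. \<Union>m. {vball c n | c. c \<in> vball (0::'a) (- int m)})"
  proof
    fix X assume "X \<in> {vball (c::'a) n | c n. True}"
    then obtain c :: 'a and n where X: "X = vball c n"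
      by blast
    obtain l where l: "{c} \<subseteq> vball 0 l"
      using bounded_in_vball[of "{c}"] by auto
    moreover have "vball 0 l \<subseteq> vball (0::'a) (- int (nat (- l)))"
      by (intro vball_mono) auto
    ultimately have "c \<in> vball 0 (- int (nat (- l)))"
      by blast
    then show "X \<in> (\<Union>n. \<Union>m. {vball c n | c. c \<in> vball (0::'a) (- int m)})"
      using X by blast
  qed
  moreover have "countable (\<Union>n. \<Union>m. {vball c n | c. c \<in> vball (0::'a) (- int m)})"
    by (intro countable_UN countableI_type *)
  ultimately show ?thesis
    by (rule countable_subset)
qed

section \<open>Haar measure\<close>

text \<open>Haar invariance without the normalization, so that it also covers images of Haar
  measure, whose mass on \<open>integers\<close> is not known in advance.\<close>

definition translation_invariant :: "'a::nonarch_local_field measure \<Rightarrow> bool" where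
  "translation_invariant M \<longleftrightarrow> sets M = sets borel \<and>
     (\<forall>a. \<forall>A\<in>sets borel. emeasure M ((\<lambda>x. a + x) ` A) = emeasure M A)"

text \<open>The point p is split off because a Moebius map is controlled only on balls that miss its
  pole. Apart from p, open sets are countable unions of such balls.\<close>

lemma sets_borel_vballs:
  fixes p :: "'a::nonarch_local_field"
  shows "sets borel = sigma_sets UNIV (insert {} (insert {p} {vball c n | c n. p \<notin> vball c n}))"
    (is "_ = sigma_sets UNIV ?G")
proof -
  have "sigma_sets UNIV {S. open S} = sigma_sets UNIV ?G"
  proof (rule sigma_sets_eqI)
    fix U :: "'a set" assume "U \<in> {S. open S}"
    then have U: "open U"
      by simp
    define B where "B = {vball c n | c n. p \<notin> vball c n \<and> vball c n \<subseteq> U}"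
    have "countable B"
      by (rule countable_subset[OF _ countable_vballs]) (auto simp: B_def)
    moreover have "B \<subseteq> sigma_sets UNIV ?G"
      by (auto simp: B_def)
    ultimately have 1: "\<Union> B \<in> sigma_sets UNIV ?G"
      by (intro sigma_sets_UNION) auto
    have 2: "{p} \<in> sigma_sets UNIV ?G"
      by auto
    have "U - {p} = \<Union> B"
    proof
      show "U - {p} \<subseteq> \<Union> B"
      proof
        fix x assume x: "x \<in> U - {p}"
        have "open (U - {p})"
          using U by (simp add: open_Diff)
        then obtain n :: nat where "vball x (int n) \<subseteq> U - {p}"
          using x vball_in_open by blast
        then have "vball x (int n) \<in> B"
          by (auto simp: B_def)
        then show "x \<in> \<Union> B"
          using center_in_vball by (rule UnionI)
      qed
      show "\<Union> B \<subseteq> U - {p}"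
        by (auto simp: B_def)
    qed
    then have "U = \<Union> B \<or> U = \<Union> B \<union> {p}"
      by (cases "p \<in> U") auto
    then show "U \<in> sigma_sets UNIV ?G"
      using 1 sigma_sets_Un[OF 1 2] by (elim disjE) simp_all
  next
    fix X assume "X \<in> ?G"
    then have "X \<in> sets borel"
      by auto
    then show "X \<in> sigma_sets UNIV {S. open S}"
      by (simp add: borel_def)
  qed
  then show ?thesis
    by (simp add: borel_def)
qed

lemma borel_integers [measurable]: "(integers :: 'a::nonarch_local_field set) \<in> sets borel"
  by (simp flip: vball_0_0)

lemma measure_eqI_vball:
  fixes M N :: "'a::nonarch_local_field measure" and p :: 'a
  assumes sets: "sets M = sets borel" "sets N = sets borel"
    and eq: "\<And>c n. p \<notin> vball c n \<Longrightarrow> emeasure M (vball c n) = emeasure N (vball c n)"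
    and fin: "\<And>c n. p \<notin> vball c n \<Longrightarrow> emeasure M (vball c n) \<noteq> \<infinity>"
    and p: "emeasure M {p} = 0" "emeasure N {p} = 0"
  shows "M = N"
proof -
  let ?G = "insert {} (insert {p} {vball c n | c n. p \<notin> vball c n})"
  show ?thesis
  proof (rule measure_eqI_generator_eq_countable[of ?G UNIV M N "insert {p} {vball c n | c n. p \<notin> vball c n}"])
    show "Int_stable ?G"
    proof (rule Int_stableI)
      fix X Y assume XY: "X \<in> ?G" "Y \<in> ?G"
      have *: "vball c m \<inter> vball d n \<in> ?G" if "p \<notin> vball c m" "p \<notin> vball d n" for c d m n
        using that vball_Int[of m n c d] vball_Int[of n m d c]
        by (cases "vball c m \<inter> vball d n = {}"; cases "m \<le> n") (auto simp: Int_commute)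
      from XY show "X \<inter> Y \<in> ?G"
      proof (elim insertE CollectE exE conjE)
        fix c d m n
        assume "X = vball c m" "p \<notin> vball c m" "Y = vball d n" "p \<notin> vball d n"
        then show ?thesis using * by blast
      qed auto
    qed
    show "emeasure M X = emeasure N X" if "X \<in> ?G" for X
      using that eq p by auto
    show "sets M = sigma_sets UNIV ?G" "sets N = sigma_sets UNIV ?G"
      using sets sets_borel_vballs[of p] by simp_all
    show "countable (insert {p} {vball c n | c n. p \<notin> vball c n})"
      by (intro countable_insert countable_subset[OF _ countable_vballs]) auto
    show "\<Union> (insert {p} {vball c n | c n. p \<notin> vball c n}) = UNIV"
    proof -
      have "x \<in> \<Union> {vball c n | c n. p \<notin> vball c n}" if "x \<noteq> p" for x
      proof -
        obtain n :: nat where "vball x (int n) \<subseteq> - {p}"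
          using vball_in_open[of "- {p}" x] \<open>x \<noteq> p\<close> by auto
        then show ?thesis
          by (intro UnionI[of "vball x (int n)"]) auto
      qed
      then show ?thesis by blast
    qed
    show "emeasure M X \<noteq> \<infinity>" if "X \<in> insert {p} {vball c n | c n. p \<notin> vball c n}" for X
      using that fin p by auto
  qed auto
qed

context
  fixes M :: "'a::nonarch_local_field measure"
  assumes M: "translation_invariant M"
begin

lemma emeasure_vball_center: "emeasure M (vball c n) = emeasure M (vball 0 n)"
proof -
  have "(\<lambda>x. c + x) ` vball 0 n = vball c n"
    using vball_image[of 1 c 0 n] by simp
  then show ?thesis
    using M borel_closed[OF closed_vball[of 0 n]] unfolding translation_invariant_def
    by (elim conjE allE[of _ c] ballE[of _ _ "vball 0 n"]) simp_all
qed

text \<open>A ball consists of q disjoint balls of the next level, all of the same mass by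
  translation.\<close>

lemma emeasure_vball_step: "emeasure M (vball c n) = ennreal (qcard TYPE('a)) * emeasure M (vball d (n + 1))"
proof -
  obtain B where B: "finite B" "card B = residue_card TYPE('a)" "disjoint B" "\<Union> B = vball c n"
    "\<And>X. X \<in> B \<Longrightarrow> \<exists>c. X = vball c (n + 1)"
    using vball_split by blast
  have "X \<in> sets M" if X: "X \<in> B" for X
    using B(5)[OF X] M by (auto simp: translation_invariant_def)
  then have "emeasure M (\<Union>X\<in>B. X) = (\<Sum>X\<in>B. emeasure M X)"
    using B(1,3) by (intro sum_emeasure[symmetric]) (auto simp: disjoint_family_on_def disjoint_def)
  also have "\<dots> = (\<Sum>X\<in>B. emeasure M (vball d (n + 1)))"
  proof (rule sum.cong)
    fix X assume "X \<in> B"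
    then obtain e where "X = vball e (n + 1)"
      using B(5) by blast
    then show "emeasure M X = emeasure M (vball d (n + 1))"
      using emeasure_vball_center[of e] emeasure_vball_center[of d] by simp
  qed simp
  finally show ?thesis
    using B(2,4) by (simp add: ennreal_of_nat_eq_real_of_nat)
qed

lemma emeasure_vball: "emeasure M (vball c n) = ennreal (qcard TYPE('a) powi (- n)) * emeasure M integers"
proof -
  let ?q = "qcard TYPE('a)"
  \<comment> \<open>The mass of \<open>integers\<close> may be infinite here, so the passage to
    smaller balls multiplies by \<open>inverse ?q\<close> instead of cancelling.\<close>
  have one: "ennreal (inverse ?q) * ennreal ?q = 1"
    using qcard_pos[where 'a='a] by (subst ennreal_mult[symmetric]) auto
  have down: "ennreal (?q powi (- (i - 1))) = ennreal ?q * ennreal (?q powi (- i))" for i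
  proof -
    have "?q powi (- (i - 1)) = ?q powi (1 + - i)"
      by (rule arg_cong[where f = "power_int ?q"]) simp
    also have "\<dots> = ?q * ?q powi (- i)"
      by (subst power_int_add) simp_all
    finally show ?thesis
      by (simp only:) (rule ennreal_mult, simp_all)
  qed
  have "emeasure M (vball 0 n) = ennreal (?q powi (- n)) * emeasure M integers"
  proof (induction n rule: int_induct[where k = 0])
    case base
    show ?case by (simp add: vball_0_0)
  next
    case (step1 i)
    have "emeasure M (vball 0 (i + 1)) = (ennreal (inverse ?q) * ennreal ?q) * emeasure M (vball 0 (i + 1))"
      by (simp only: one mult_1_left)
    also have "\<dots> = ennreal (inverse ?q) * emeasure M (vball 0 i)"
      by (simp only: mult.assoc flip: emeasure_vball_step[of 0 i 0])
    also have "\<dots> = ennreal (inverse ?q) * (ennreal ?q * ennreal (?q powi (- (i + 1))) * emeasure M integers)"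
      using down[of "i + 1"] step1 by (simp only: add_diff_cancel_right')
    also have "\<dots> = (ennreal (inverse ?q) * ennreal ?q) * (ennreal (?q powi (- (i + 1))) * emeasure M integers)"
      by (simp only: mult.assoc)
    finally show ?case
      by (simp only: one mult_1_left)
  next
    case (step2 i)
    then show ?case
      using emeasure_vball_step[of 0 "i - 1" 0] by (simp only: down diff_add_cancel mult.assoc)
  qed
  then show ?thesis
    by (simp only: emeasure_vball_center[of c])
qed

lemma emeasure_vball_finite: "emeasure M integers < \<infinity> \<Longrightarrow> emeasure M (vball c n) < \<infinity>"
  by (simp add: emeasure_vball ennreal_mult_less_top)

lemma emeasure_singleton_0:
  assumes "emeasure M integers < \<infinity>"
  shows "emeasure M {p} = 0"
proof -
  let ?q = "qcard TYPE('a)"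
  have "emeasure M {p} \<le> ennreal ((1 / ?q) ^ n) * emeasure M integers" for n
  proof -
    have "emeasure M {p} \<le> emeasure M (vball p (int n))"
      using M by (intro emeasure_mono) (auto simp: translation_invariant_def)
    then show ?thesis
      by (simp add: emeasure_vball power_int_minus power_inverse divide_inverse)
  qed
  moreover have "(\<lambda>n. ennreal ((1 / ?q) ^ n) * emeasure M integers) \<longlonglongrightarrow> ennreal 0 * emeasure M integers"
    using assms qcard_gt_1[where 'a='a]
    by (intro tendsto_mult_ennreal tendsto_ennrealI tendsto_const LIMSEQ_power_zero) auto
  ultimately have "emeasure M {p} \<le> 0"
    by (intro LIMSEQ_le_const[of "\<lambda>n. ennreal ((1 / ?q) ^ n) * emeasure M integers"]) auto
  then show ?thesis by simp
qed

end

text \<open>Invariance and the mass of \<open>integers\<close> determine the mass of every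
  ball.\<close>

lemma haar_unique:
  fixes M N :: "'a::nonarch_local_field measure"
  assumes "translation_invariant M" "translation_invariant N"
    and "emeasure M integers = 1" "emeasure N integers = ennreal k"
  shows "N = density M (\<lambda>_. ennreal k)"
proof (rule measure_eqI_vball[where p = 0])
  have sets: "sets M = sets borel" "sets N = sets borel"
    using assms by (auto simp: translation_invariant_def)
  show "sets N = sets borel" "sets (density M (\<lambda>_. ennreal k)) = sets borel"
    using sets by auto
  show "emeasure N (vball c n) = emeasure (density M (\<lambda>_. ennreal k)) (vball c n)" for c n
    using sets by (simp add: emeasure_density_const emeasure_vball[OF assms(1)] emeasure_vball[OF assms(2)] assms(3,4) mult.commute)
  show "emeasure N (vball c n) \<noteq> \<infinity>" for c n
    using emeasure_vball_finite[OF assms(2)] assms(4) by (metis ennreal_less_top infinity_ennreal_def less_irrefl)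
  show "emeasure N {0} = 0"
    using emeasure_singleton_0[OF assms(2)] assms(4) by simp
  show "emeasure (density M (\<lambda>_. ennreal k)) {0} = 0"
    using emeasure_singleton_0[OF assms(1)] assms(3) sets by (simp add: emeasure_density_const)
qed

locale haar =
  fixes M :: "'a::nonarch_local_field measure"
  assumes normalized: "normalized_haar_measure M"
begin

lemma sets_M [simp, measurable_cong]: "sets M = sets borel"
  using normalized by (simp add: normalized_haar_measure_def)

lemma space_M [simp]: "space M = UNIV"
  using sets_eq_imp_space_eq[OF sets_M] by simp

lemma trans_inv_M: "translation_invariant M"
  using normalized by (simp add: normalized_haar_measure_def translation_invariant_def)

lemma emeasure_integers: "emeasure M integers = 1"
  using normalized by (simp add: normalized_haar_measure_def)

lemma emeasure_M_vball: "emeasure M (vball c n) = ennreal (qcard TYPE('a) powi (- n))"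
  using emeasure_vball[OF trans_inv_M] by (simp add: emeasure_integers)

lemma emeasure_M_singleton: "emeasure M {p} = 0"
  using emeasure_singleton_0[OF trans_inv_M] by (simp add: emeasure_integers)

lemma emeasure_compact:
  assumes "compact S"
  shows "emeasure M S < \<infinity>"
proof -
  obtain n where "S \<subseteq> vball 0 n"
    using assms compact_imp_bounded bounded_in_vball by blast
  then have "emeasure M S \<le> emeasure M (vball 0 n)"
    by (intro emeasure_mono) auto
  also have "\<dots> < \<infinity>"
    by (simp add: emeasure_M_vball)
  finally show ?thesis .
qed

text \<open>\<open>T\<close> multiplies volumes by \<open>k\<close>; the image measure measures preimages, whence \<open>1 / k\<close>.\<close>

definition has_modulus :: "('a \<Rightarrow> 'a) \<Rightarrow> real \<Rightarrow> bool" where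
  "has_modulus T k \<longleftrightarrow> T \<in> borel \<rightarrow>\<^sub>M borel \<and> 0 < k \<and> distr M borel T = density M (\<lambda>_. ennreal (1 / k))"

lemma has_modulus_emeasure:
  assumes "has_modulus T k" "A \<in> sets borel"
  shows "emeasure M (T -` A) = ennreal (1 / k) * emeasure M A"
proof -
  have "emeasure (distr M borel T) A = emeasure M (T -` A)"
    using assms by (subst emeasure_distr) (auto simp: has_modulus_def cong: measurable_cong_sets)
  then show ?thesis
    using assms by (simp add: has_modulus_def emeasure_density_const)
qed

lemma has_modulus_unique:
  assumes "has_modulus T k" "has_modulus T l"
  shows "k = l"
proof -
  have "ennreal (1 / k) * 1 = ennreal (1 / l) * 1"
    using has_modulus_emeasure[OF assms(1), of integers] has_modulus_emeasure[OF assms(2), of integers]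
    by (simp add: emeasure_integers)
  then show ?thesis
    using assms by (simp add: has_modulus_def ennreal_inj)
qed

lemma has_modulus_comp:
  assumes T: "has_modulus T k" and S: "has_modulus S l"
  shows "has_modulus (\<lambda>x. T (S x)) (k * l)"
proof -
  have m [measurable]: "T \<in> borel \<rightarrow>\<^sub>M borel" "S \<in> borel \<rightarrow>\<^sub>M borel"
    using assms by (auto simp: has_modulus_def)
  have "distr M borel (\<lambda>x. T (S x)) = density M (\<lambda>_. ennreal (1 / (k * l)))"
  proof (rule measure_eqI)
    fix A assume "A \<in> sets (distr M borel (\<lambda>x. T (S x)))"
    then have A [measurable]: "A \<in> sets borel"
      by simp
    have TA: "T -` A \<in> sets borel"
      using measurable_sets[OF m(1) A] by simp
    have "emeasure (distr M borel (\<lambda>x. T (S x))) A = emeasure M (S -` (T -` A))"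
      by (subst emeasure_distr) (auto simp: vimage_def)
    also have "\<dots> = ennreal (1 / l) * (ennreal (1 / k) * emeasure M A)"
      by (simp add: has_modulus_emeasure[OF S TA] has_modulus_emeasure[OF T A])
    also have "\<dots> = (ennreal (1 / l) * ennreal (1 / k)) * emeasure M A"
      by (rule mult.assoc[symmetric])
    also have "ennreal (1 / l) * ennreal (1 / k) = ennreal (1 / l * (1 / k))"
      using assms by (intro ennreal_mult[symmetric]) (auto simp: has_modulus_def)
    also have "1 / l * (1 / k) = 1 / (k * l)"
      by simp
    finally show "emeasure (distr M borel (\<lambda>x. T (S x))) A = emeasure (density M (\<lambda>_. ennreal (1 / (k * l)))) A"
      by (simp add: emeasure_density_const)
  qed simp
  then show ?thesis
    using assms by (simp add: has_modulus_def)
qed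

text \<open>The image of Haar measure under an additive homeomorphism is invariant again, hence a
  multiple of it by uniqueness. The multiple is finite because the preimage of
  \<open>integers\<close> is compact, and positive because that preimage contains a ball around
  0.\<close>

lemma has_modulus_exists:
  assumes add: "\<And>x y. T (x + y) = T x + T y"
    and cont: "continuous_on UNIV T" "continuous_on UNIV S"
    and inv: "\<And>x. T (S x) = x" "\<And>x. S (T x) = x"
  shows "\<exists>k. has_modulus T k"
proof -
  have T [measurable]: "T \<in> borel \<rightarrow>\<^sub>M borel"
    using cont(1) by (rule borel_measurable_continuous_onI)
  have vim: "T -` A = S ` A" for A
    using inv by (auto simp: image_iff) (metis inv(2))
  define N where "N = distr M borel T"
  have N: "emeasure N A = emeasure M (T -` A)" if "A \<in> sets borel" for A
    using that unfolding N_def by (subst emeasure_distr) auto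
  have tN: "translation_invariant N"
    unfolding translation_invariant_def
  proof (intro conjI allI ballI)
    show "sets N = sets borel"
      by (simp add: N_def)
    fix a and A :: "'a set" assume A: "A \<in> sets borel"
    have "(\<lambda>x. a + x) ` A = (\<lambda>x. - a + x) -` A"
      by (auto simp: image_iff intro!: bexI[of _ "_ - a"])
    also have "\<dots> \<in> sets borel"
    proof -
      have "(\<lambda>x. - a + x) \<in> borel \<rightarrow>\<^sub>M borel"
        by (intro borel_measurable_continuous_onI continuous_intros)
      from measurable_sets[OF this A] show ?thesis by simp
    qed
    finally have aA: "(\<lambda>x. a + x) ` A \<in> sets borel" .
    have TA: "T -` A \<in> sets borel"
      using measurable_sets[OF T A] by simp
    have Sadd: "S (x + y) = S x + S y" for x y
      using add[of "S x" "S y"] inv by metis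
    have "T -` (\<lambda>x. a + x) ` A = (\<lambda>x. S a + x) ` (T -` A)"
      unfolding vim by (simp add: image_image Sadd)
    then show "emeasure N ((\<lambda>x. a + x) ` A) = emeasure N A"
      using trans_inv_M TA by (simp add: N[OF A] N[OF aA] translation_invariant_def)
  qed
  have i: "emeasure N integers = emeasure M (S ` integers)"
    using N[of integers] vim by (simp flip: vball_0_0)
  have "compact (S ` integers)"
    using cont(2) by (intro compact_continuous_image) (auto intro: continuous_on_subset simp flip: vball_0_0)
  then have fin: "emeasure N integers < \<infinity>"
    using emeasure_compact i by metis
  have "T 0 + 0 = T 0 + T 0"
    using add[of 0 0] by simp
  then have "T 0 = 0"
    by (simp only: add_left_cancel)
  then have "0 \<in> T -` integers"
    by (simp add: integers_def)
  moreover have "open (T -` integers)"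
    using cont(1) by (intro open_vimage) (auto simp flip: vball_0_0)
  ultimately obtain n :: nat where "vball 0 (int n) \<subseteq> T -` integers"
    by (metis vball_in_open)
  then have "emeasure M (vball 0 (int n)) \<le> emeasure M (T -` integers)"
    using measurable_sets[OF T, of integers] by (intro emeasure_mono) (auto simp flip: vball_0_0)
  moreover have "0 < emeasure M (vball 0 (int n))"
    by (simp add: emeasure_M_vball)
  ultimately have "0 < emeasure N integers"
    unfolding i vim by (rule order.strict_trans2[rotated])
  with fin obtain k where k: "emeasure N integers = ennreal k" "k > 0"
    by (cases "emeasure N integers") auto
  have "N = density M (\<lambda>_. ennreal k)"
    using haar_unique[OF trans_inv_M tN emeasure_integers k(1)] .
  \<comment> \<open>Here k is the factor of the image measure, so the modulus is its
    reciprocal.\<close>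
  then have "has_modulus T (1 / k)"
    using k(2) T by (simp add: has_modulus_def N_def)
  then show ?thesis ..
qed

text \<open>The constant is read off from one set: the preimage of \<open>integers\<close> is the
  ball of level - val a around 0.\<close>

lemma has_modulus_mult:
  assumes "a \<noteq> 0"
  shows "has_modulus (\<lambda>x. a * x) (absval a)"
proof -
  have "\<exists>k. has_modulus (\<lambda>x. a * x) k"
    by (rule has_modulus_exists[where S = "\<lambda>x. inverse a * x"])
       (use assms in \<open>auto simp: algebra_simps intro!: continuous_intros\<close>)
  then obtain k where k: "has_modulus (\<lambda>x. a * x) k"
    by blast
  have "a * x \<in> integers \<longleftrightarrow> x \<in> vball 0 (- val a)" for x
    using assms by (cases "x = 0") (auto simp: mem_vball_iff_val val_mult integers_def)
  then have "(\<lambda>x. a * x) -` integers = vball 0 (- val a)"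
    by blast
  then have "ennreal (qcard TYPE('a) powi val a) = ennreal (1 / k)"
    using has_modulus_emeasure[OF k, of integers]
    by (simp add: emeasure_M_vball emeasure_integers)
  then have "1 / k = qcard TYPE('a) powi val a"
    using k qcard_pos[where 'a='a] by (simp add: has_modulus_def ennreal_inj)
  then have "k = 1 / qcard TYPE('a) powi val a"
    by (metis inverse_eq_divide inverse_inverse_eq)
  then have "k = absval a"
    using assms by (simp add: absval_eq power_int_minus divide_inverse)
  with k show ?thesis by simp
qed

lemma has_modulus_nn_integral:
  assumes "has_modulus T k" and f [measurable]: "f \<in> borel_measurable borel"
  shows "(\<integral>\<^sup>+x. f (T x) \<partial>M) = ennreal (1 / k) * (\<integral>\<^sup>+x. f x \<partial>M)"
proof -
  have T [measurable]: "T \<in> borel \<rightarrow>\<^sub>M borel"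
    using assms by (simp add: has_modulus_def)
  have "(\<integral>\<^sup>+x. f (T x) \<partial>M) = (\<integral>\<^sup>+x. f x \<partial>distr M borel T)"
    by (subst nn_integral_distr) auto
  also have "\<dots> = (\<integral>\<^sup>+x. f x \<partial>density M (\<lambda>_. ennreal (1 / k)))"
    using assms by (simp add: has_modulus_def)
  also have "\<dots> = ennreal (1 / k) * (\<integral>\<^sup>+x. f x \<partial>M)"
    by (subst nn_integral_density) (auto simp: nn_integral_cmult)
  finally show ?thesis .
qed

lemma has_modulus_integral:
  fixes f :: "'a \<Rightarrow> complex"
  assumes "has_modulus T k" and f [measurable]: "f \<in> borel_measurable borel"
  shows "(\<integral>x. f (T x) \<partial>M) = of_real (1 / k) * (\<integral>x. f x \<partial>M)"
proof -
  have T [measurable]: "T \<in> borel \<rightarrow>\<^sub>M borel"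
    using assms by (simp add: has_modulus_def)
  have "(\<integral>x. f (T x) \<partial>M) = (\<integral>x. f x \<partial>distr M borel T)"
    by (subst integral_distr) auto
  also have "\<dots> = (\<integral>x. f x \<partial>density M (\<lambda>_. ennreal (1 / k)))"
    using assms by (simp add: has_modulus_def)
  also have "\<dots> = of_real (1 / k) * (\<integral>x. f x \<partial>M)"
    using assms(1) by (subst integral_density) (auto simp: has_modulus_def scaleR_conv_of_real)
  finally show ?thesis .
qed

end

section \<open>Change of variables under Moebius maps\<close>

text \<open>For functions continuous off a closed exceptional set that take a default value on it: a
  Moebius map at its pole, the kernel on F.\<close>

lemma borel_measurable_continuous_on_open_const:
  fixes f :: "'a::topological_space \<Rightarrow> 'b::topological_space"
  assumes "open U" "continuous_on U f" "\<And>x. x \<notin> U \<Longrightarrow> f x = c"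
  shows "f \<in> borel_measurable borel"
proof (rule borel_measurableI)
  fix V :: "'b set" assume "open V"
  then have "open (f -` V \<inter> U)"
    using assms(1,2) continuous_on_open_vimage by blast
  then have 1: "f -` V \<inter> U \<in> sets borel"
    by simp
  have 2: "- U \<in> sets borel"
    using assms(1) by simp
  have "f -` V = (f -` V \<inter> U) \<union> (if c \<in> V then - U else {})"
    using assms(3) by auto
  also have "\<dots> \<in> sets borel"
    using sets.Un[OF 1 2] 1 by auto
  finally show "f -` V \<inter> space borel \<in> sets borel"
    by simp
qed

text \<open>With z = x/(1 + b x) one has 1 - b z = 1/(1 + b x). On a ball that misses 1/b the
  isosceles principle makes |1 - b z| constant, so there the inverse map z/(1 - b z) is a similarity
  of ratio |1 - b c|^(-2).\<close>

lemma moebius_vball: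
  fixes b c :: "'a::nonarch_local_field"
  assumes b: "b \<noteq> 0" and p: "inverse b \<notin> vball c n"
  shows "1 - b * c \<noteq> 0"
    and "1 + b * x \<noteq> 0 \<and> x / (1 + b * x) \<in> vball c n \<longleftrightarrow>
      x \<in> vball (c / (1 - b * c)) (n - 2 * val (1 - b * c))" (is "?L \<longleftrightarrow> ?R")
    and "1 + b * x \<noteq> 0 \<Longrightarrow> x / (1 + b * x) \<in> vball c n \<Longrightarrow>
      absval (1 + b * x) = inverse (absval (1 - b * c))"
proof -
  show nz: "1 - b * c \<noteq> 0"
  proof
    assume "1 - b * c = 0"
    then have "c = inverse b"
      using b by (simp add: field_simps)
    with p show False by simp
  qed
  let ?r = "qcard TYPE('a) powi (- n)" and ?d = "absval (1 - b * c)"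
  define c' where "c' = c / (1 - b * c)"
  have d: "?d > 0"
    using nz by simp
  have "1 - b * c = b * (inverse b - c)"
    using b by (simp add: algebra_simps)
  \<comment> \<open>The point 1/b lies outside the ball, so moving c within the ball changes b c by
    less than |1 - b c|.\<close>
  then have r: "absval b * ?r < ?d"
    using p b by (simp add: vball_def absval_mult)
  have R: "?R \<longleftrightarrow> absval (x - c') \<le> ?r / ?d ^ 2"
  proof -
    have "qcard TYPE('a) powi (- (n - 2 * val (1 - b * c))) = ?r / ?d ^ 2"
    proof -
      have "qcard TYPE('a) powi (- (n - 2 * val (1 - b * c))) =
          qcard TYPE('a) powi (- n + (val (1 - b * c) + val (1 - b * c)))"
        by (rule arg_cong[where f = "power_int _"]) simp
      also have "\<dots> = ?r * (qcard TYPE('a) powi val (1 - b * c)) ^ 2"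
        by (subst power_int_add, simp, subst power_int_add) (simp_all only: power2_eq_square, simp_all)
      also have "\<dots> = ?r / ?d ^ 2"
        using nz by (simp add: absval_eq power_int_minus field_simps)
      finally show ?thesis .
    qed
    then show ?thesis
      by (simp add: vball_def c'_def)
  qed
  have c'1: "1 + b * c' = inverse (1 - b * c)"
    using nz by (simp add: c'_def field_simps)
  have one: "absval (1 + b * x) = inverse ?d" if "1 + b * x \<noteq> 0" "x / (1 + b * x) \<in> vball c n"
  proof -
    let ?z = "x / (1 + b * x)"
    have "absval (c - ?z) \<le> ?r"
      using that(2) by (simp add: vball_def absval_minus_commute)
    then have "absval (b * (c - ?z)) \<le> absval b * ?r"
      by (simp add: absval_mult mult_left_mono)
    then have "absval (b * (c - ?z)) < ?d"
      using r by linarith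
    then have "absval ((1 - b * c) + b * (c - ?z)) = ?d"
      by (rule absval_add_eq)
    moreover have "(1 - b * c) + b * (c - ?z) = inverse (1 + b * x)"
      using that(1) by (simp add: field_simps)
    ultimately show ?thesis
      by (metis absval_inverse inverse_inverse_eq)
  qed
  then show "1 + b * x \<noteq> 0 \<Longrightarrow> x / (1 + b * x) \<in> vball c n \<Longrightarrow>
      absval (1 + b * x) = inverse (absval (1 - b * c))" .
  have diff: "absval (x / (1 + b * x) - c) = absval (x - c') * ?d ^ 2"
    if "absval (1 + b * x) = inverse ?d" "1 + b * x \<noteq> 0"
  proof -
    have "x / (1 + b * x) - c = (x - c') * (1 - b * c) / (1 + b * x)"
    proof -
      have "x / (1 + b * x) - c = (x - c * (1 + b * x)) / (1 + b * x)"
        using that(2) by (simp add: diff_divide_distrib)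
      also have "x - c * (1 + b * x) = x * (1 - b * c) - c' * (1 - b * c)"
      proof -
        have "c' * (1 - b * c) = c"
          using nz by (simp add: c'_def)
        then show ?thesis
          by (simp only:) (simp add: algebra_simps)
      qed
      finally show ?thesis
        by (simp add: left_diff_distrib)
    qed
    then have "absval (x / (1 + b * x) - c) = absval (x - c') * ?d / inverse ?d"
      by (simp only: absval_mult absval_divide that(1))
    then show ?thesis
      by (simp add: power2_eq_square divide_inverse mult.assoc)
  qed
  show "?L \<longleftrightarrow> ?R"
  proof
    assume L: ?L
    then have "absval (x - c') * ?d ^ 2 \<le> ?r"
      using diff one by (simp add: vball_def)
    then show ?R
      using d by (simp add: R field_simps)
  next
    assume ?R
    then have le: "absval (x - c') * ?d ^ 2 \<le> ?r"
      using d by (simp add: R field_simps)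
    have "absval (b * (x - c')) * ?d ^ 2 \<le> absval b * ?r"
      using le by (simp add: absval_mult mult.assoc mult_left_mono)
    also have "\<dots> < ?d"
      by (rule r)
    finally have "absval (b * (x - c')) * ?d ^ 2 < inverse ?d * ?d ^ 2"
      using d by (simp add: power2_eq_square)
    then have "absval (b * (x - c')) < inverse ?d"
      using d by (simp only: mult_less_cancel_right) auto
    then have "absval (b * (x - c')) < absval (1 + b * c')"
      by (simp only: c'1 absval_inverse)
    then have "absval ((1 + b * c') + b * (x - c')) = absval (1 + b * c')"
      by (rule absval_add_eq)
    moreover have "(1 + b * c') + b * (x - c') = 1 + b * x"
      by (simp add: algebra_simps)
    ultimately have eq: "absval (1 + b * x) = inverse ?d"
      by (simp only: c'1 absval_inverse)
    then have "1 + b * x \<noteq> 0"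
      using d by auto
    with eq diff le show ?L
      by (simp add: vball_def)
  qed
qed

context haar
begin

lemma moebius_measurable [measurable]: "(\<lambda>x. x / (1 + b * x)) \<in> borel_measurable borel"
  if "b \<noteq> 0" for b :: 'a
proof (rule borel_measurable_continuous_on_open_const[of "{x. 1 + b * x \<noteq> 0}" _ 0])
  show "open {x. 1 + b * x \<noteq> 0}"
    by (intro open_Collect_neq continuous_intros)
  show "continuous_on {x. 1 + b * x \<noteq> 0} (\<lambda>x. x / (1 + b * x))"
    unfolding continuous_on_def by (auto intro!: tendsto_intros)
qed auto

lemma moebius_weight_measurable [measurable]:
  "(\<lambda>x. inverse (absval (1 + b * x) ^ 2)) \<in> borel_measurable borel" for b :: 'a
proof -
  have [measurable]: "(\<lambda>x. absval (1 + b * x)) \<in> borel_measurable borel"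
    by (intro borel_measurable_continuous_onI continuous_intros)
  show ?thesis by measurable
qed

text \<open>On the preimage of a ball of radius r that misses 1/b, the density is the constant |1 -
  b c|^2 and the volume is r |1 - b c|^(-2). Such balls and the null point 1/b determine the
  measure.\<close>

lemma distr_moebius_measure:
  assumes b: "b \<noteq> 0"
  shows "distr (density M (\<lambda>x. ennreal (inverse (absval (1 + b * x) ^ 2)))) borel (\<lambda>x. x / (1 + b * x)) = M"
    (is "distr ?D borel ?f = M")
proof (rule measure_eqI_vball[where p = "inverse b"])
  note [measurable] = moebius_measurable[OF b]
  have em: "emeasure (distr ?D borel ?f) A =
      (\<integral>\<^sup>+x. ennreal (inverse (absval (1 + b * x) ^ 2)) * indicator (?f -` A) x \<partial>M)"
    if [measurable]: "A \<in> sets borel" for A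
  proof -
    have "emeasure (distr ?D borel ?f) A = emeasure ?D (?f -` A)"
      by (subst emeasure_distr) auto
    also have "\<dots> = (\<integral>\<^sup>+x. ennreal (inverse (absval (1 + b * x) ^ 2)) * indicator (?f -` A) x \<partial>M)"
      using measurable_sets[OF moebius_measurable[OF b] that] by (intro emeasure_density) auto
    finally show ?thesis .
  qed
  fix c n assume p: "inverse b \<notin> vball c n"
  let ?d = "absval (1 - b * c)" and ?B = "vball (c / (1 - b * c)) (n - 2 * val (1 - b * c))"
  note mv = moebius_vball[OF b p]
  have "emeasure (distr ?D borel ?f) (vball c n) = (\<integral>\<^sup>+x. ennreal (?d ^ 2) * indicator ?B x \<partial>M)"
  proof (subst em)
    show "(\<integral>\<^sup>+x. ennreal (inverse (absval (1 + b * x) ^ 2)) * indicator (?f -` vball c n) x \<partial>M)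
        = (\<integral>\<^sup>+x. ennreal (?d ^ 2) * indicator ?B x \<partial>M)"
    proof (rule nn_integral_cong)
      fix x
      show "ennreal (inverse (absval (1 + b * x) ^ 2)) * indicator (?f -` vball c n) x
          = ennreal (?d ^ 2) * indicator ?B x"
      proof (cases "1 + b * x \<noteq> 0 \<and> ?f x \<in> vball c n")
        case True
        then show ?thesis
          using mv(2)[of x] mv(3)[of x] by (simp add: indicator_def power_inverse)
      next
        case False
        \<comment> \<open>If 1 + b x = 0, then \<open>?f x = 0\<close> may lie in the ball, but the
          weight there is \<open>inverse 0 = 0\<close>.\<close>
        then have "x \<notin> ?B"
          using mv(2) by blast
        with False show ?thesis
          by (auto simp: indicator_def)
      qed
    qed
  qed simp
  also have "\<dots> = ennreal (?d ^ 2) * emeasure M ?B"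
    by (simp add: nn_integral_cmult_indicator)
  also have "\<dots> = ennreal (?d ^ 2 * qcard TYPE('a) powi (- (n - 2 * val (1 - b * c))))"
    by (simp add: emeasure_M_vball ennreal_mult)
  also have "?d ^ 2 * qcard TYPE('a) powi (- (n - 2 * val (1 - b * c))) = qcard TYPE('a) powi (- n)"
    (is "_ = ?r")
  proof -
    have "?d ^ 2 = qcard TYPE('a) powi (- val (1 - b * c) + - val (1 - b * c))"
      using mv(1) by (subst power_int_add) (simp_all add: absval_eq power2_eq_square)
    then have "?d ^ 2 * qcard TYPE('a) powi (- (n - 2 * val (1 - b * c))) =
      qcard TYPE('a) powi ((- val (1 - b * c) + - val (1 - b * c)) + - (n - 2 * val (1 - b * c)))"
      by (subst power_int_add[of _ "_ + _"]) simp_all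
    then show ?thesis
      by simp
  qed
  finally have 1: "emeasure (distr ?D borel ?f) (vball c n) = ennreal ?r" .
  show "emeasure (distr ?D borel ?f) (vball c n) = emeasure M (vball c n)"
    unfolding 1 emeasure_M_vball ..
  show "emeasure (distr ?D borel ?f) (vball c n) \<noteq> \<infinity>"
    unfolding 1 by simp
next
  note [measurable] = moebius_measurable[OF b]
  \<comment> \<open>Off the pole of \<open>?f\<close>, equality would give b x = 1 + b x; at the
    pole \<open>?f x\<close> is 0 by division by zero.\<close>
  have "?f x \<noteq> inverse b" for x
    using b by (cases "1 + b * x = 0") (auto simp: field_simps)
  then have "?f -` {inverse b} = {}"
    by auto
  then show "emeasure (distr ?D borel ?f) {inverse b} = 0"
    by (subst emeasure_distr) auto
qed (auto simp: emeasure_M_singleton)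

lemma integral_moebius:
  fixes g :: "'a \<Rightarrow> complex"
  assumes b: "b \<noteq> 0" and g [measurable]: "g \<in> borel_measurable borel"
  shows "(\<integral>x. of_real (inverse (absval (1 + b * x) ^ 2)) * g (x / (1 + b * x)) \<partial>M) = (\<integral>x. g x \<partial>M)"
proof -
  note [measurable] = moebius_measurable[OF b]
  let ?D = "density M (\<lambda>x. ennreal (inverse (absval (1 + b * x) ^ 2)))"
  have "(\<integral>x. g x \<partial>M) = (\<integral>x. g x \<partial>distr ?D borel (\<lambda>x. x / (1 + b * x)))"
    by (simp only: distr_moebius_measure[OF b])
  also have "\<dots> = (\<integral>x. g (x / (1 + b * x)) \<partial>?D)"
    by (subst integral_distr) auto
  also have "\<dots> = (\<integral>x. of_real (inverse (absval (1 + b * x) ^ 2)) * g (x / (1 + b * x)) \<partial>M)"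
    by (subst integral_density) (auto simp: scaleR_conv_of_real)
  finally show ?thesis ..
qed

end

section \<open>Test functions and quasicharacters\<close>

lemma locally_constant_imp_closed:
  assumes "\<And>x. \<forall>\<^sub>F y in nhds x. f y = f x"
  shows "closed {x. f x \<noteq> c}"
proof -
  have "open {x. f x = c}"
  proof (subst open_subopen, intro ballI)
    fix x assume x: "x \<in> {x. f x = c}"
    obtain S where S: "open S" "x \<in> S" "\<forall>y\<in>S. f y = f x"
      using assms[of x] unfolding eventually_nhds by (elim exE conjE)
    have "S \<subseteq> {x. f x = c}"
    proof
      fix y assume "y \<in> S"
      then show "y \<in> {x. f x = c}"
        using S(3) x by simp
    qed
    with S(1,2) show "\<exists>T. open T \<and> x \<in> T \<and> T \<subseteq> {x. f x = c}"
      by blast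
  qed
  moreover have "- {x. f x \<noteq> c} = {x. f x = c}"
    by auto
  ultimately show ?thesis
    unfolding closed_def by simp
qed

text \<open>Local constancy makes the set where \<phi> is nonzero closed, so it coincides with the
  closure in the definition.\<close>

lemma test_functions_iff:
  "\<phi> \<in> test_functions U \<longleftrightarrow>
    (\<forall>x. \<forall>\<^sub>F y in nhds x. \<phi> y = \<phi> x) \<and> compact {x. \<phi> x \<noteq> 0} \<and> {x. \<phi> x \<noteq> 0} \<subseteq> U"
proof -
  have "closure {x. \<phi> x \<noteq> 0} = {x. \<phi> x \<noteq> 0}" if "\<forall>x. \<forall>\<^sub>F y in nhds x. \<phi> y = \<phi> x"
    using that by (intro closure_closed locally_constant_imp_closed) blast
  then show ?thesis
    unfolding test_functions_def eventually_nhds mem_Collect_eq by metis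
qed

lemma test_functionsD:
  assumes "\<phi> \<in> test_functions U"
  shows "\<forall>\<^sub>F y in nhds x. \<phi> y = \<phi> x" "compact {x. \<phi> x \<noteq> 0}" "{x. \<phi> x \<noteq> 0} \<subseteq> U"
  using assms by (auto simp: test_functions_iff)

lemma test_functions_mono: "\<phi> \<in> test_functions U \<Longrightarrow> \<phi> \<in> test_functions UNIV"
  by (simp add: test_functions_iff)

lemma test_functionsI:
  assumes "\<And>x. \<forall>\<^sub>F y in nhds x. \<phi> y = \<phi> x" "compact C" "\<And>x. \<phi> x \<noteq> 0 \<Longrightarrow> x \<in> C"
  shows "\<phi> \<in> test_functions UNIV"
proof -
  have "closed {x. \<phi> x \<noteq> 0}"
    by (rule locally_constant_imp_closed) (rule assms(1))
  moreover have "{x. \<phi> x \<noteq> 0} = C \<inter> {x. \<phi> x \<noteq> 0}"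
    using assms(3) by auto
  ultimately have "compact {x. \<phi> x \<noteq> 0}"
    using assms(2) by (metis compact_Int_closed)
  then show ?thesis
    using assms(1) by (auto simp: test_functions_iff)
qed

text \<open>Asking for local constancy of g only where \<phi> is nonzero admits factors that are
  singular elsewhere, such as the kernel or the indicator of a cone.\<close>

lemma test_functions_times:
  assumes \<phi>: "\<phi> \<in> test_functions UNIV"
    and g: "\<And>x. \<phi> x \<noteq> 0 \<Longrightarrow> \<forall>\<^sub>F y in nhds x. g y = g x"
  shows "(\<lambda>x. g x * \<phi> x) \<in> test_functions UNIV"
proof (rule test_functionsI[OF _ test_functionsD(2)[OF \<phi>]])
  show "\<forall>\<^sub>F y in nhds x. g y * \<phi> y = g x * \<phi> x" for x
  proof (cases "\<phi> x = 0")
    case True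
    show ?thesis
      using test_functionsD(1)[OF \<phi>, of x] by eventually_elim (simp add: True)
  next
    case False
    from test_functionsD(1)[OF \<phi>, of x] g[OF False] show ?thesis
      by (rule eventually_elim2) simp
  qed
qed auto

lemma test_functions_cmult: "\<phi> \<in> test_functions UNIV \<Longrightarrow> (\<lambda>x. c * \<phi> x) \<in> test_functions UNIV"
  by (rule test_functions_times) auto

lemma test_functions_lincomb:
  assumes \<phi>: "\<phi> \<in> test_functions UNIV" and \<psi>: "\<psi> \<in> test_functions UNIV"
  shows "(\<lambda>x. \<phi> x + \<psi> x) \<in> test_functions UNIV" "(\<lambda>x. \<phi> x - \<psi> x) \<in> test_functions UNIV"
proof -
  have C: "compact ({x. \<phi> x \<noteq> 0} \<union> {x. \<psi> x \<noteq> 0})"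
    using \<phi> \<psi> by (intro compact_Un test_functionsD(2))
  have ev: "\<forall>\<^sub>F y in nhds x. \<phi> y = \<phi> x \<and> \<psi> y = \<psi> x" for x
    using \<phi> \<psi> by (intro eventually_conj test_functionsD(1))
  show "(\<lambda>x. \<phi> x + \<psi> x) \<in> test_functions UNIV"
    by (rule test_functionsI[OF eventually_mono[OF ev] C]) auto
  show "(\<lambda>x. \<phi> x - \<psi> x) \<in> test_functions UNIV"
    by (rule test_functionsI[OF eventually_mono[OF ev] C]) auto
qed

lemma test_functions_sum:
  assumes "\<And>i. i \<in> I \<Longrightarrow> f i \<in> test_functions UNIV"
  shows "(\<lambda>x. \<Sum>i\<in>I. f i x) \<in> test_functions UNIV"
  using assms
proof (induction I rule: infinite_finite_induct)
  case (insert i I)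
  then show ?case
    by (simp add: test_functions_lincomb)
qed (auto simp: test_functions_iff)

lemma test_functions_compose:
  assumes \<phi>: "\<phi> \<in> test_functions UNIV"
    and cont: "continuous_on UNIV T" "continuous_on UNIV S"
    and inv: "\<And>x. S (T x) = x"
  shows "(\<lambda>x. \<phi> (T x)) \<in> test_functions UNIV"
proof (rule test_functionsI)
  show "compact (S ` {x. \<phi> x \<noteq> 0})"
    using cont(2) \<phi> by (intro compact_continuous_image test_functionsD(2)) (auto intro: continuous_on_subset)
  show "x \<in> S ` {x. \<phi> x \<noteq> 0}" if "\<phi> (T x) \<noteq> 0" for x
    using that inv by (intro image_eqI[of _ _ "T x"]) auto
  show "\<forall>\<^sub>F y in nhds x. \<phi> (T y) = \<phi> (T x)" for x
  proof -
    have "filterlim T (nhds (T x)) (nhds x)"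
      using cont(1) by (simp add: continuous_on_eq_continuous_at continuous_at tendsto_at_iff_tendsto_nhds)
    then show ?thesis
      by (rule eventually_compose_filterlim[OF test_functionsD(1)[OF \<phi>, of "T x"]])
  qed
qed

text \<open>Finitely many open sets on which g is constant cover the compact set. This is what turns
  pairings with the kernel into finite sums of exponentials.\<close>

lemma finite_image_locally_constant:
  assumes "compact C" "\<And>x. x \<in> C \<Longrightarrow> \<forall>\<^sub>F y in nhds x. g y = g x"
  shows "finite (g ` C)"
proof -
  have "\<exists>S. open S \<and> x \<in> S \<and> (\<forall>y\<in>S. g y = g x)" if "x \<in> C" for x
    using assms(2)[OF that] unfolding eventually_nhds .
  then obtain S where S: "\<And>x. x \<in> C \<Longrightarrow> open (S x) \<and> x \<in> S x \<and> (\<forall>y\<in>S x. g y = g x)"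
    by metis
  obtain D where D: "D \<subseteq> C" "finite D" "C \<subseteq> (\<Union>x\<in>D. S x)"
    using compactE_image[OF assms(1), of C S] S by (metis UN_I subsetI)
  have "g ` C \<subseteq> g ` D"
  proof
    fix y assume "y \<in> g ` C"
    then obtain x where x: "x \<in> C" "y = g x" by blast
    then obtain d where d: "d \<in> D" "x \<in> S d"
      using D(3) by blast
    then have "g x = g d"
      using D(1) S by blast
    then show "y \<in> g ` D"
      using x d by blast
  qed
  then show ?thesis
    using D(2) finite_surj by blast
qed

lemma (in haar) test_functions_borel:
  assumes "\<phi> \<in> test_functions UNIV"
  shows "\<phi> \<in> borel_measurable borel"
proof (rule borel_measurable_continuous_onI)
  have "isCont \<phi> x" for x
    unfolding isCont_def using test_functionsD(1)[OF assms, of x]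
    by (intro tendsto_eventually) (auto simp: eventually_at_filter elim: eventually_mono)
  then show "continuous_on UNIV \<phi>"
    by (simp add: continuous_on_eq_continuous_at)
qed

lemma (in haar) test_functions_integrable:
  assumes "\<phi> \<in> test_functions UNIV"
  shows "integrable M \<phi>"
proof -
  let ?C = "{x. \<phi> x \<noteq> 0}"
  have fin: "finite (\<phi> ` ?C)"
    using assms test_functionsD by (intro finite_image_locally_constant) blast+
  then have "finite (norm ` \<phi> ` ?C)"
    by simp
  then obtain B where B: "\<And>x. \<phi> x \<noteq> 0 \<Longrightarrow> norm (\<phi> x) \<le> B"
    using finite_imp_bounded[OF fin] by (auto simp: bounded_iff)
  have C: "?C \<in> sets M"
    using test_functionsD(2)[OF assms] by (simp add: borel_closed compact_imp_closed)
  show ?thesis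
  proof (rule integrableI_bounded_set[where A = ?C and B = B])
    show "\<phi> \<in> borel_measurable M"
      using test_functions_borel[OF assms] by simp
    show "emeasure M ?C < \<infinity>"
      using emeasure_compact test_functionsD(2)[OF assms] by blast
  qed (use C B in auto)
qed

text \<open>As w^2 - 1 = (w - 1)(w + 1) and |w + 1| >= 3/2 whenever |w - 1| < 1/2, squaring
  increases the distance from 1 by a factor 3/2 inside that disc. Unless z = 1, iteration leaves the
  disc.\<close>

lemma power_two_power_eq_1:
  fixes z :: complex
  assumes "\<And>k. norm (z ^ (2 ^ k) - 1) < 1 / 2"
  shows "z = 1"
proof (rule ccontr)
  assume "z \<noteq> 1"
  have le: "(3 / 2) ^ k * norm (z - 1) \<le> norm (z ^ (2 ^ k) - 1)" for k
  proof (induction k)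
    case (Suc k)
    let ?w = "z ^ (2 ^ k)"
    have "2 = norm ((?w + 1) - (?w - 1))"
      by simp
    also have "\<dots> \<le> norm (?w + 1) + norm (?w - 1)"
      by (rule norm_triangle_ineq4)
    finally have "3 / 2 \<le> norm (?w + 1)"
      using assms[of k] by simp
    then have "(3 / 2) * ((3 / 2) ^ k * norm (z - 1)) \<le> norm (?w + 1) * norm (?w - 1)"
      using Suc by (intro mult_mono) auto
    also have "\<dots> = norm ((?w + 1) * (?w - 1))"
      by (simp only: norm_mult)
    also have "(?w + 1) * (?w - 1) = ?w ^ 2 - 1"
      using square_diff_one_factored[of ?w] by (simp only: power2_eq_square)
    also have "?w ^ 2 = z ^ (2 ^ Suc k)"
      by (simp only: power_Suc2 power_mult)
    finally show ?case
      by (simp add: mult.assoc)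
  qed simp
  obtain k where "1 / norm (z - 1) < (3 / 2 :: real) ^ k"
    using real_arch_pow[of "3 / 2"] by auto
  then have "1 < (3 / 2) ^ k * norm (z - 1)"
    using \<open>z \<noteq> 1\<close> by (simp add: field_simps)
  with le[of k] assms[of k] show False
    by linarith
qed

text \<open>The reason is that \<open>\<complex>\<^sup>\<times>\<close> has no small subgroups.\<close>

lemma unit_character_trivial_near_1:
  assumes chi: "chi \<in> unit_characters"
  shows "\<forall>\<^sub>F x::'a::nonarch_local_field in nhds 1. x \<in> int_units \<and> chi x = 1"
proof -
  have c: "continuous_on int_units chi" and nz: "\<And>x. x \<in> int_units \<Longrightarrow> chi x \<noteq> 0"
    and m: "\<And>x y. x \<in> int_units \<Longrightarrow> y \<in> int_units \<Longrightarrow> chi (x * y) = chi x * chi y"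
    using chi by (auto simp: unit_characters_def)
  have one: "(1::'a) \<in> int_units"
    by (simp add: int_units_def)
  have chi1: "chi 1 = 1"
    using m[OF one one] nz[OF one] by simp
  have units: "x \<in> int_units" if "x \<in> vball 1 1" for x :: 'a
  proof -
    have "absval (x - 1) \<le> inverse (qcard TYPE('a))"
      using that by (simp add: vball_def power_int_minus)
    also have "\<dots> < absval (1::'a)"
      using qcard_gt_1[where 'a='a] by (simp add: inverse_less_1_iff)
    finally have "absval (1 + (x - 1)) = absval (1::'a)"
      by (rule absval_add_eq)
    then have "absval x = absval (1::'a)"
      by simp
    then show ?thesis
      using absval_eq_iff[of x 1] by (cases "x = 0") (auto simp: int_units_def)
  qed
  obtain d where d: "d > 0" "\<And>x. x \<in> int_units \<Longrightarrow> dist x 1 < d \<Longrightarrow> dist (chi x) (chi 1) < 1 / 2"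
    using c one unfolding continuous_on_iff by (metis half_gt_zero_iff zero_less_one)
  obtain n :: nat where n: "vball (1::'a) (int n) \<subseteq> ball 1 d"
    using vball_in_open[of "ball (1::'a) d" 1] d(1) by auto
  \<comment> \<open>Level at least 1 keeps the ball inside the units, level at least n keeps it
    where chi differs from 1 by less than 1/2.\<close>
  define N where "N = max 1 (int n)"
  have N: "vball (1::'a) N \<subseteq> vball 1 1" "vball (1::'a) N \<subseteq> ball 1 d"
    using vball_mono[of 1 N 1] vball_mono[of "int n" N 1] n by (auto simp: N_def)
  \<comment> \<open>The ball is closed under squaring because |x + 1| <= 1. All x^(2^k) therefore
    stay in it, as \<open>power_two_power_eq_1\<close> demands.\<close>
  have sq: "x ^ 2 \<in> vball 1 N" if x: "x \<in> vball 1 N" for x :: 'a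
  proof -
    have "absval x = 1"
      using units[of x] N(1) x by (auto simp: int_units_def absval_eq)
    then have "absval (x + 1) \<le> 1"
      using absval_add[of x 1] by simp
    moreover have "x ^ 2 - 1 = (x - 1) * (x + 1)"
      by (simp add: algebra_simps power2_eq_square)
    ultimately have "absval (x ^ 2 - 1) \<le> absval (x - 1)"
      by (simp add: absval_mult mult_left_le)
    then show ?thesis
      using x by (simp add: vball_def)
  qed
  have "x \<in> int_units \<and> chi x = 1" if x: "x \<in> vball 1 N" for x
  proof
    show "x \<in> int_units"
      using units N(1) x by blast
    have pow: "x ^ (2 ^ k) \<in> vball 1 N \<and> chi (x ^ (2 ^ k)) = chi x ^ (2 ^ k)" for k
    proof (induction k)
      case (Suc k)
      let ?y = "x ^ (2 ^ k)"
      have y: "?y \<in> int_units"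
        using units N(1) Suc by blast
      have e: "x ^ (2 ^ Suc k) = ?y ^ 2" "chi x ^ (2 ^ Suc k) = (chi x ^ (2 ^ k)) ^ 2"
        by (simp_all only: power_Suc2 power_mult)
      have "chi (?y ^ 2) = chi ?y ^ 2"
        by (simp only: power2_eq_square m[OF y y])
      then show ?case
        using sq[of ?y] Suc by (simp only: e)
    qed (use x in simp)
    show "chi x = 1"
    proof (rule power_two_power_eq_1)
      fix k
      have "x ^ (2 ^ k) \<in> int_units" "dist (x ^ (2 ^ k)) 1 < d"
        using pow[of k] units N by (auto simp: dist_commute)
      then have "dist (chi (x ^ (2 ^ k))) (chi 1) < 1 / 2"
        by (rule d(2))
      then show "norm (chi x ^ (2 ^ k) - 1) < 1 / 2"
        using pow[of k] chi1 by (simp add: dist_norm)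
    qed
  qed
  moreover have "\<forall>\<^sub>F x in nhds 1. x \<in> vball (1::'a) N"
    by (rule eventually_nhds_in_open) simp_all
  ultimately show ?thesis
    by (auto elim: eventually_mono)
qed

section \<open>Quasicharacters\<close>

locale quasicharacter =
  fixes \<pi> :: "'a::nonarch_local_field" and chi :: "'a \<Rightarrow> complex"
  assumes pi: "\<pi> \<noteq> 0" "val \<pi> = 1" and chi: "chi \<in> unit_characters"
begin

abbreviation Q :: "complex \<Rightarrow> 'a \<Rightarrow> complex" where
  "Q \<equiv> quasichar \<pi> chi"

lemma chi_mult: "x \<in> int_units \<Longrightarrow> y \<in> int_units \<Longrightarrow> chi (x * y) = chi x * chi y"
  and chi_nonzero: "x \<in> int_units \<Longrightarrow> chi x \<noteq> 0"
  using chi by (auto simp: unit_characters_def)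

lemma chi_1 [simp]: "chi 1 = 1"
  using chi_mult[of 1 1] chi_nonzero[of 1] by (simp add: int_units_def)

lemma unit_part: "x \<noteq> 0 \<Longrightarrow> \<pi> powi (- val x) * x \<in> int_units"
  using pi by (simp add: int_units_def val_mult val_power_int)

text \<open>Rests on the convention \<open>0 powr s = 0\<close>; it is the reason why the kernel
  vanishes on F.\<close>

lemma Q_0 [simp]: "Q s 0 = 0"
  by (simp add: quasichar_def)

lemma Q_1 [simp]: "Q s 1 = 1"
  by (simp add: quasichar_def)

lemma Q_unit: "u \<in> int_units \<Longrightarrow> Q s u = chi u"
  by (simp add: quasichar_def int_units_def absval_eq)

lemma Q_pi: "Q s \<pi> = complex_of_real (absval \<pi>) powr s"
  using pi by (simp add: quasichar_def power_int_minus)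

lemma Q_mult:
  assumes "x \<noteq> 0" "y \<noteq> 0"
  shows "Q s (x * y) = Q s x * Q s y"
proof -
  have "\<pi> powi (- val (x * y)) * (x * y) = (\<pi> powi (- val x) * x) * (\<pi> powi (- val y) * y)"
    using assms pi by (simp add: val_mult power_int_diff power_int_minus field_simps)
  then have "chi (\<pi> powi (- val (x * y)) * (x * y)) = chi (\<pi> powi (- val x) * x) * chi (\<pi> powi (- val y) * y)"
    using chi_mult[OF unit_part[OF assms(1)] unit_part[OF assms(2)]] by (simp only:)
  moreover have "complex_of_real (absval (x * y)) powr s = complex_of_real (absval x) powr s * complex_of_real (absval y) powr s"
    unfolding absval_mult of_real_mult by (rule powr_times_real) simp_all
  ultimately show ?thesis
    by (simp add: quasichar_def)
qed

lemma Q_nonzero: "x \<noteq> 0 \<Longrightarrow> Q s x \<noteq> 0"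
  using chi_nonzero unit_part by (simp add: quasichar_def)

lemma Q_inverse: "Q s (inverse x) = inverse (Q s x)"
proof (cases "x = 0")
  case False
  then have "Q s x * Q s (inverse x) = 1"
    using Q_mult[of x "inverse x" s] by simp
  then show ?thesis
    by (metis inverse_unique)
qed simp

lemma Q_divide: "x \<noteq> 0 \<Longrightarrow> y \<noteq> 0 \<Longrightarrow> Q s (x / y) = Q s x / Q s y"
  by (simp add: divide_inverse Q_mult Q_inverse)

lemma Q_power2: "Q s (x ^ 2) = Q s x ^ 2"
  by (cases "x = 0") (simp_all add: power2_eq_square Q_mult)

text \<open>All dependence on s is moved into one exponential with real frequency ln |x|; the
  holomorphy statements below reduce to this.\<close>

lemma Q_exp:
  assumes "x \<noteq> 0"
  shows "Q s x = Q 0 x * exp (s * of_real (ln (absval x)))"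
  using assms by (simp add: quasichar_def powr_def Ln_of_real)

lemma Q_trivial_near_1: "\<forall>\<^sub>F x in nhds 1. \<forall>s. Q s x = 1"
  using unit_character_trivial_near_1[OF chi] by eventually_elim (simp add: Q_unit)

text \<open>Since f x / l tends to 1 and near 1 every \<open>Q s\<close> is just chi, one
  neighbourhood serves all s at once.\<close>

lemma Q_locally_constant:
  assumes "(f \<longlongrightarrow> l) F" "l \<noteq> 0"
  shows "\<forall>\<^sub>F x in F. \<forall>s. Q s (f x) = Q s l"
proof -
  have "((\<lambda>x. f x / l) \<longlongrightarrow> l / l) F"
    using assms by (intro tendsto_intros)
  then have "filterlim (\<lambda>x. f x / l) (nhds 1) F"
    using assms by simp
  then have "\<forall>\<^sub>F x in F. \<forall>s. Q s (f x / l) = 1"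
    by (rule eventually_compose_filterlim[OF Q_trivial_near_1])
  then show ?thesis
    using eventually_nz[OF assms]
  proof eventually_elim
    case (elim x)
    then show ?case
      using Q_divide[of "f x" l] assms(2) Q_nonzero[of l] by (auto simp: divide_eq_eq)
  qed
qed

end

section \<open>Coordinates on the quadratic extension\<close>

lemma absval_less_1_iff: "a \<noteq> 0 \<Longrightarrow> absval (a::'a::nonarch_local_field) < 1 \<longleftrightarrow> 0 < val a"
  using absval_le_iff[of 1 a] by (simp add: not_le[symmetric])

context quadratic_extension
begin

lemma incl_0 [simp]: "\<iota> 0 = 0"
  using incl_add[of 0 0] by (metis add.right_neutral add_left_cancel)

lemma incl_uminus: "\<iota> (- a) = - \<iota> a"
  using incl_add[of a "- a"] by (simp add: eq_neg_iff_add_eq_0 add.commute)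

lemma incl_diff: "\<iota> (a - b) = \<iota> a - \<iota> b"
  using incl_add[of a "- b"] by (simp add: incl_uminus)

lemma incl_nonzero: "a \<noteq> 0 \<Longrightarrow> \<iota> a \<noteq> 0"
  using incl_mult[of a "inverse a"] incl_one by auto

lemma incl_eq_0_iff [simp]: "\<iota> a = 0 \<longleftrightarrow> a = 0"
  using incl_nonzero by auto

lemma inj_incl: "inj \<iota>"
proof (rule injI)
  fix a b assume "\<iota> a = \<iota> b"
  then have "\<iota> (a - b) = 0"
    by (simp add: incl_diff)
  then show "a = b" by simp
qed

lemma incl_inverse: "\<iota> (inverse a) = inverse (\<iota> a)"
proof (cases "a = 0")
  case False
  then have "\<iota> a * \<iota> (inverse a) = 1"
    by (simp add: incl_one flip: incl_mult)
  then show ?thesis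
    by (metis inverse_unique)
qed simp

lemma incl_divide: "\<iota> (a / b) = \<iota> a / \<iota> b"
  by (simp add: divide_inverse incl_mult incl_inverse)

lemma incl_power: "\<iota> (a ^ n) = \<iota> a ^ n"
  by (induction n) (simp_all add: incl_one incl_mult)

lemma tendsto_incl [tendsto_intros]: "(f \<longlongrightarrow> a) F \<Longrightarrow> ((\<lambda>x. \<iota> (f x)) \<longlongrightarrow> \<iota> a) F"
  using incl_continuous by (rule continuous_on_tendsto_compose) auto

text \<open>|a| < 1 means that a^n tends to 0, a topological property which the continuous map
  \<open>\<iota>\<close> preserves.\<close>

lemma absval_incl_less_1:
  assumes "absval a < 1"
  shows "absval (\<iota> a) < 1"
proof (rule ccontr)
  assume "\<not> absval (\<iota> a) < 1"
  then have ge: "1 \<le> absval (\<iota> (a ^ n))" for n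
    by (simp add: incl_power absval_power)
  have "(\<lambda>n. absval (a ^ n - 0)) \<longlonglongrightarrow> 0"
    using assms by (simp add: absval_power LIMSEQ_realpow_zero)
  then have "(\<lambda>n. a ^ n) \<longlonglongrightarrow> 0"
    by (simp only: tendsto_iff_absval)
  then have "(\<lambda>n. absval (\<iota> (a ^ n))) \<longlonglongrightarrow> absval (\<iota> 0)"
    by (intro tendsto_intros)
  then have "1 \<le> absval (\<iota> 0)"
    using ge by (intro LIMSEQ_le_const) auto
  then show False by simp
qed

lemma val_incl_pi_pos: "0 < val (\<iota> \<pi>F)"
  using unramified_or_ramified uniformizerE by (auto simp: val_power)

text \<open>Let e be the valuation of \<open>\<iota> \<pi>F\<close>. If \<open>\<iota> u\<close> had
  negative valuation, \<open>\<pi>F * u ^ e\<close> would have absolute value < 1 in F while its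
  image had valuation e (1 + val (\<iota> u)) <= 0. The same applies to the inverse of u.\<close>

lemma val_incl_unit:
  assumes u: "u \<in> int_units"
  shows "val (\<iota> u) = 0"
proof -
  have "0 \<le> val (\<iota> u)" if u: "u \<in> int_units" for u
  proof (rule ccontr)
    assume neg: "\<not> 0 \<le> val (\<iota> u)"
    define n where "n = nat (val (\<iota> \<pi>F))"
    have u0: "u \<noteq> 0" "val u = 0"
      using u by (auto simp: int_units_def)
    have "absval (\<pi>F * u ^ n) < 1"
      using u0 uniformizerF by (simp add: absval_less_1_iff val_mult val_power)
    then have "absval (\<iota> (\<pi>F * u ^ n)) < 1"
      by (rule absval_incl_less_1)
    then have "0 < val (\<iota> \<pi>F) + int n * val (\<iota> u)"
      using u0 uniformizerF by (simp add: absval_less_1_iff incl_mult incl_power val_mult val_power)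
    also have "\<dots> = val (\<iota> \<pi>F) * (1 + val (\<iota> u))"
      using val_incl_pi_pos by (simp add: n_def algebra_simps)
    finally show False
      using val_incl_pi_pos neg by (simp add: zero_less_mult_iff)
  qed
  moreover have "inverse u \<in> int_units"
    using u by (auto simp: int_units_def val_inverse)
  ultimately have "0 \<le> val (\<iota> u)" "0 \<le> val (\<iota> (inverse u))"
    using u by blast+
  then show ?thesis
    using u by (simp add: incl_inverse val_inverse int_units_def)
qed

lemma incl_unit: "u \<in> int_units \<Longrightarrow> \<iota> u \<in> int_units"
  using val_incl_unit by (auto simp: int_units_def)

lemma val_incl:
  assumes "a \<noteq> 0"
  shows "val (\<iota> a) = val (\<iota> \<pi>F) * val a"
proof -
  have "\<pi>F powi (- val a) * a \<in> int_units" (is "?u \<in> _")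
    using assms uniformizerF by (simp add: int_units_def val_mult val_power_int)
  then have u: "val (\<iota> ?u) = 0"
    by (rule val_incl_unit)
  have pw: "\<iota> (\<pi>F powi n) = \<iota> \<pi>F powi n" for n
    by (simp add: power_int_def incl_power incl_inverse)
  show ?thesis
    using u assms uniformizerF by (simp add: incl_mult pw val_mult val_power_int)
qed

text \<open>In both cases q_E^e = q_F^2, where e = \<open>val (\<iota> \<pi>F)\<close> is the
  ramification index.\<close>

lemma absval_incl: "absval (\<iota> a) = absval a ^ 2"
proof (cases "a = 0")
  case False
  let ?e = "val (\<iota> \<pi>F)"
  have sq: "qcard TYPE('f) powi (- val a) * qcard TYPE('f) powi (- val a) = (qcard TYPE('f) powi (- val a)) ^ 2"
    by (simp only: power2_eq_square)
  have "qcard TYPE('e) powi (- (?e * val a)) = (qcard TYPE('f) powi (- val a)) ^ 2"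
    using unramified_or_ramified
  proof (elim disjE conjE)
    assume e: "residue_card TYPE('e) = residue_card TYPE('f) ^ 2" "\<iota> \<pi>F = \<pi>E"
    have "(qcard TYPE('f) * qcard TYPE('f)) powi (- val a) = (qcard TYPE('f) powi (- val a)) ^ 2"
      by (simp only: power_int_mult_distrib sq)
    then show ?thesis
      using e uniformizerE by (simp add: power2_eq_square)
  next
    assume e: "residue_card TYPE('e) = residue_card TYPE('f)" "\<iota> \<pi>F = \<pi>E ^ 2"
    have "qcard TYPE('f) powi (- (2 * val a)) = qcard TYPE('f) powi (- val a + - val a)"
      by (rule arg_cong[where f = "power_int _"]) simp
    also have "\<dots> = (qcard TYPE('f) powi (- val a)) ^ 2"
      by (subst power_int_add) (simp_all only: sq, simp)
    finally show ?thesis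
      using e uniformizerE by (simp add: val_power)
  qed
  then show ?thesis
    using False val_incl[OF False] by (simp add: absval_eq)
qed simp

abbreviation c1 :: "'e \<Rightarrow> 'f" where "c1 x \<equiv> fst (coords \<iota> \<alpha> x)"
abbreviation c2 :: "'e \<Rightarrow> 'f" where "c2 x \<equiv> snd (coords \<iota> \<alpha> x)"

lemma coords_unique:
  assumes "\<iota> a + \<iota> b * \<alpha> = \<iota> a' + \<iota> b' * \<alpha>"
  shows "a = a'" "b = b'"
proof -
  show b: "b = b'"
  proof (rule ccontr)
    assume "b \<noteq> b'"
    have "\<alpha> * \<iota> (b - b') = \<iota> (a' - a)"
      using assms by (simp add: incl_diff algebra_simps)
    then have "\<alpha> = \<iota> ((a' - a) / (b - b'))"
      using \<open>b \<noteq> b'\<close> by (simp only: incl_divide) (simp add: field_simps)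
    then show False
      using alpha_notin by blast
  qed
  then have "\<iota> a = \<iota> a'"
    using assms by simp
  then show "a = a'"
    using inj_incl by (simp add: inj_eq)
qed

lemma coords_eq [simp]: "coords \<iota> \<alpha> (\<iota> a + \<iota> b * \<alpha>) = (a, b)"
  unfolding coords_def by (rule the_equality) (auto dest: coords_unique)

lemma coords_decomp: "\<iota> (c1 x) + \<iota> (c2 x) * \<alpha> = x"
  using generated[of x] by auto

lemma c_add: "c1 (x + y) = c1 x + c1 y" "c2 (x + y) = c2 x + c2 y"
proof -
  have "x + y = \<iota> (c1 x + c1 y) + \<iota> (c2 x + c2 y) * \<alpha>"
    using coords_decomp[of x] coords_decomp[of y] by (simp add: incl_add algebra_simps)
  then have "coords \<iota> \<alpha> (x + y) = (c1 x + c1 y, c2 x + c2 y)"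
    by (metis coords_eq)
  then show "c1 (x + y) = c1 x + c1 y" "c2 (x + y) = c2 x + c2 y"
    by simp_all
qed

lemma c_scale: "c1 (\<iota> a * x) = a * c1 x" "c2 (\<iota> a * x) = a * c2 x"
proof -
  have "\<iota> a * x = \<iota> a * (\<iota> (c1 x) + \<iota> (c2 x) * \<alpha>)"
    by (simp add: coords_decomp)
  also have "\<dots> = \<iota> (a * c1 x) + \<iota> (a * c2 x) * \<alpha>"
    by (simp add: incl_mult algebra_simps)
  finally have "coords \<iota> \<alpha> (\<iota> a * x) = (a * c1 x, a * c2 x)"
    by (metis coords_eq)
  then show "c1 (\<iota> a * x) = a * c1 x" "c2 (\<iota> a * x) = a * c2 x"
    by simp_all
qed

lemma coords_incl [simp]: "coords \<iota> \<alpha> (\<iota> a) = (a, 0)"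
  using coords_eq[of a 0] by simp

lemma coords_0 [simp]: "coords \<iota> \<alpha> 0 = (0, 0)"
  using coords_incl[of 0] by simp

lemma c_diff: "c1 (x - y) = c1 x - c1 y" "c2 (x - y) = c2 x - c2 y"
  using c_add[of "x - y" y] by simp_all

lemma c2_eq_0_iff: "c2 x = 0 \<longleftrightarrow> x \<in> range \<iota>"
  using coords_decomp[of x] by (auto intro: range_eqI[of _ _ "c1 x"])

lemma eq_0_iff_coords: "x = 0 \<longleftrightarrow> c1 x = 0 \<and> c2 x = 0"
  using coords_decomp[of x] by auto

text \<open>By \<open>absval_incl\<close> a Cauchy sequence in the image comes from a Cauchy
  sequence in F, and F is complete.\<close>

lemma closed_range_incl: "closed (range \<iota>)"
  unfolding closed_sequential_limits
proof (intro allI impI, elim conjE)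
  fix z l assume z: "\<forall>n. z n \<in> range \<iota>" "z \<longlonglongrightarrow> l"
  from z(1) have "\<forall>n. \<exists>a. z n = \<iota> a"
    by blast
  then obtain a where a: "\<And>n. z n = \<iota> (a n)"
    by metis
  have "Cauchy a"
    unfolding Cauchy_def
  proof (intro allI impI)
    fix e :: real assume e: "e > 0"
    have "Cauchy z"
      using z(2) by (rule LIMSEQ_imp_Cauchy)
    then obtain N where N: "\<And>m n. m \<ge> N \<Longrightarrow> n \<ge> N \<Longrightarrow> dist (z m) (z n) < e ^ 2"
      using e unfolding Cauchy_def by (elim allE[of _ "e ^ 2"]) auto
    have "dist (a m) (a n) < e" if "m \<ge> N" "n \<ge> N" for m n
    proof -
      have "(dist (a m) (a n)) ^ 2 < e ^ 2"
        using N[OF that] by (simp add: a dist_absval absval_incl flip: incl_diff)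
      then show ?thesis
        by (rule power_less_imp_less_base) (use e in simp)
    qed
    then show "\<exists>N. \<forall>m\<ge>N. \<forall>n\<ge>N. dist (a m) (a n) < e"
      by blast
  qed
  then obtain b where "a \<longlonglongrightarrow> b"
    using Cauchy_convergent convergent_def by blast
  then have "(\<lambda>n. \<iota> (a n)) \<longlonglongrightarrow> \<iota> b"
    by (rule tendsto_incl)
  then have "z \<longlonglongrightarrow> \<iota> b"
    by (simp only: a[symmetric])
  with z(2) have "l = \<iota> b"
    by (rule LIMSEQ_unique)
  then show "l \<in> range \<iota>"
    by blast
qed

text \<open>\<alpha> has positive distance \<delta> from the closed set F, and x =
  \<open>\<iota> (c2 x)\<close> times the difference of \<alpha> and an element of F if
  \<open>c2 x\<close> is nonzero. The bound yields continuity of the coordinates.\<close>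

lemma absval_c2_bound: obtains \<delta> where "\<delta> > 0" "\<And>x. \<delta> * absval (c2 x) ^ 2 \<le> absval x"
proof -
  have "open (- range \<iota>)" "\<alpha> \<in> - range \<iota>"
    using closed_range_incl alpha_notin by auto
  then obtain \<delta> where d: "\<delta> > 0" "ball \<alpha> \<delta> \<subseteq> - range \<iota>"
    using open_contains_ball by blast
  have "\<delta> * absval (c2 x) ^ 2 \<le> absval x" for x
  proof (cases "c2 x = 0")
    case False
    have "x = \<iota> (c2 x) * (\<alpha> - \<iota> (- c1 x / c2 x))"
      using False coords_decomp[of x] by (simp add: incl_divide incl_uminus field_simps)
    then have "absval x = absval (c2 x) ^ 2 * absval (\<alpha> - \<iota> (- c1 x / c2 x))"
      by (metis absval_mult absval_incl)
    moreover have "\<delta> \<le> absval (\<alpha> - \<iota> (- c1 x / c2 x))"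
    proof -
      have "\<iota> (- c1 x / c2 x) \<notin> ball \<alpha> \<delta>"
        using d(2) by blast
      then show ?thesis
        by (simp add: dist_absval not_less)
    qed
    ultimately show ?thesis
      by (simp add: mult.commute[of \<delta>] mult_left_mono)
  qed simp
  then show ?thesis
    using that d(1) by blast
qed

lemma tendsto_c2 [tendsto_intros]:
  assumes "(f \<longlongrightarrow> l) F"
  shows "((\<lambda>x. c2 (f x)) \<longlongrightarrow> c2 l) F"
proof -
  obtain \<delta> where d: "\<delta> > 0" "\<And>x. \<delta> * absval (c2 x) ^ 2 \<le> absval x"
    using absval_c2_bound by blast
  have "((\<lambda>x. absval (f x - l) / \<delta>) \<longlongrightarrow> 0 / \<delta>) F"
    using assms d(1) by (intro tendsto_divide tendsto_const) (auto simp flip: tendsto_iff_absval)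
  then have 1: "((\<lambda>x. absval (f x - l) / \<delta>) \<longlongrightarrow> 0) F"
    by simp
  have "absval (c2 (f x) - c2 l) ^ 2 \<le> absval (f x - l) / \<delta>" for x
    using d(2)[of "f x - l"] d(1) by (simp add: c_diff field_simps)
  then have "((\<lambda>x. absval (c2 (f x) - c2 l) ^ 2) \<longlongrightarrow> 0) F"
    by (intro tendsto_sandwich[OF _ _ tendsto_const 1] always_eventually) simp_all
  then have "((\<lambda>x. sqrt (absval (c2 (f x) - c2 l) ^ 2)) \<longlongrightarrow> sqrt 0) F"
    by (rule tendsto_real_sqrt)
  then show ?thesis
    by (simp add: tendsto_iff_absval[of "\<lambda>x. c2 (f x)"])
qed

lemma tendsto_c1 [tendsto_intros]:
  assumes "(f \<longlongrightarrow> l) F"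
  shows "((\<lambda>x. c1 (f x)) \<longlongrightarrow> c1 l) F"
proof -
  have "((\<lambda>x. absval (f x - \<iota> (c2 (f x)) * \<alpha> - (l - \<iota> (c2 l) * \<alpha>))) \<longlongrightarrow>
      absval (l - \<iota> (c2 l) * \<alpha> - (l - \<iota> (c2 l) * \<alpha>))) F"
    using assms by (intro tendsto_intros)
  moreover have "x - \<iota> (c2 x) * \<alpha> = \<iota> (c1 x)" for x
    using coords_decomp[of x] by (simp add: diff_eq_eq)
  ultimately have "((\<lambda>x. absval (c1 (f x) - c1 l) ^ 2) \<longlongrightarrow> 0) F"
    by (simp add: absval_incl flip: incl_diff)
  then have "((\<lambda>x. sqrt (absval (c1 (f x) - c1 l) ^ 2)) \<longlongrightarrow> sqrt 0) F"
    by (rule tendsto_real_sqrt)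
  then show ?thesis
    by (simp add: tendsto_iff_absval[of "\<lambda>x. c1 (f x)"])
qed

end

section \<open>The kernel\<close>

context quadratic_extension
begin

lemma not_in_range_nonzero: "x \<notin> range \<iota> \<Longrightarrow> x \<noteq> 0"
  using rangeI[of \<iota> 0] by auto

text \<open>\<open>Y x\<close> is minus the second coordinate of \<open>1 / x\<close>, which makes the invariance of the
  kernel under the Moebius action evident.\<close>

definition Y :: "'e \<Rightarrow> 'f" where
  "Y x = - c2 (inverse x)"

definition dsq :: 'f where
  "dsq = inv \<iota> (\<alpha> ^ 2)"

lemma incl_dsq: "\<iota> dsq = \<alpha> ^ 2"
proof -
  obtain d where "\<alpha> ^ 2 = \<iota> d"
    using alpha_sq by blast
  then show ?thesis
    by (simp add: dsq_def inv_f_f[OF inj_incl])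
qed

text \<open>Multiply x by its conjugate x', which gives the norm n in F. At x = 0 both sides are 0
  by division by zero.\<close>

lemma Y_eq: "Y x = c2 x / (c1 x ^ 2 - c2 x ^ 2 * dsq)"
proof (cases "x = 0")
  case True
  then show ?thesis by (simp add: Y_def)
next
  case False
  define n where "n = c1 x ^ 2 - c2 x ^ 2 * dsq"
  define x' where "x' = \<iota> (c1 x) + \<iota> (- c2 x) * \<alpha>"
  have "x' \<noteq> 0"
    using False unfolding x'_def eq_0_iff_coords by simp
  have "x * x' = (\<iota> (c1 x) + \<iota> (c2 x) * \<alpha>) * x'"
    by (simp add: coords_decomp)
  also have "\<dots> = \<iota> n"
    by (simp add: x'_def n_def incl_uminus incl_diff incl_power incl_mult incl_dsq algebra_simps power2_eq_square)
  finally have "x * x' = \<iota> n" .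
  moreover from this have "\<iota> n \<noteq> 0"
    using False \<open>x' \<noteq> 0\<close> by auto
  ultimately have "inverse x = inverse (\<iota> n) * x'"
    using False by (simp add: field_simps)
  also have "\<dots> = \<iota> (c1 x / n) + \<iota> (- c2 x / n) * \<alpha>"
    by (simp add: x'_def incl_mult incl_inverse incl_uminus divide_inverse algebra_simps)
  finally have "coords \<iota> \<alpha> (inverse x) = (c1 x / n, - c2 x / n)"
    by (metis coords_eq)
  then show ?thesis
    by (simp add: Y_def n_def)
qed

lemma Y_eq_0_iff: "Y x = 0 \<longleftrightarrow> x \<in> range \<iota>"
proof -
  have *: "inverse x \<in> range \<iota>" if "x \<in> range \<iota>" for x
    using that by (auto simp flip: incl_inverse)
  show ?thesis
    using *[of x] *[of "inverse x"] by (auto simp: Y_def c2_eq_0_iff)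
qed

lemma Y_scale: "Y (\<iota> a * x) = Y x / a"
proof -
  have "inverse (\<iota> a * x) = \<iota> (inverse a) * inverse x"
    by (simp add: incl_inverse)
  then show ?thesis
    by (simp only: Y_def c_scale) (simp add: divide_inverse mult.commute)
qed

text \<open>Inversion turns the Moebius map into translation by b in F, which leaves the second
  coordinate alone.\<close>

lemma Y_moebius:
  assumes "1 + \<iota> b * x \<noteq> 0"
  shows "Y (x / (1 + \<iota> b * x)) = Y x"
proof (cases "x = 0")
  case False
  then have "inverse (x / (1 + \<iota> b * x)) = inverse x + \<iota> b"
    by (simp add: field_simps)
  then show ?thesis
    by (simp add: Y_def c_add)
qed simp

lemma tendsto_Y:
  assumes "(f \<longlongrightarrow> l) F" "l \<noteq> 0"
  shows "((\<lambda>x. Y (f x)) \<longlongrightarrow> Y l) F"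
  unfolding Y_def using assms by (intro tendsto_intros)

text \<open>F-linear and the identity on F, but in general not E-linear; for |c| < 1 it contracts
  towards F.\<close>

definition T :: "'f \<Rightarrow> 'e \<Rightarrow> 'e" where
  "T c x = \<iota> (c1 x) + \<iota> (c * c2 x) * \<alpha>"

lemma coords_T [simp]: "coords \<iota> \<alpha> (T c x) = (c1 x, c * c2 x)"
  by (simp add: T_def)

lemma T_add: "T c (x + y) = T c x + T c y"
  by (simp add: T_def c_add incl_add incl_mult algebra_simps)

lemma T_T: "T c (T d x) = T (c * d) x"
  by (simp add: T_def mult.assoc)

lemma T_1 [simp]: "T 1 x = x"
  by (simp add: T_def coords_decomp)

lemma T_inverse: "c \<noteq> 0 \<Longrightarrow> T (inverse c) (T c x) = x" "c \<noteq> 0 \<Longrightarrow> T c (T (inverse c) x) = x"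
  by (simp_all add: T_T)

lemma continuous_T: "continuous_on UNIV (T c)"
  unfolding T_def continuous_on_def
  by (intro ballI tendsto_intros tendsto_ident_at)

text \<open>S scales the first coordinate instead. Multiplication by \<alpha> conjugates
  \<open>T c\<close> to S, so both have the same modulus k, and \<open>T c\<close> composed with S
  is multiplication by c, of modulus |c|_E = |c|_F^2. Hence k^2 = |c|_F^2. This replaces a splitting
  of dx into coordinates.\<close>

lemma has_modulus_T:
  assumes "haar M" and c: "c \<noteq> 0"
  shows "haar.has_modulus M (T c) (absval c)"
proof -
  interpret haar M by fact
  define S where "S x = \<iota> (c * c1 x) + \<iota> (c2 x) * \<alpha>" for x
  define S' where "S' x = \<iota> (inverse c * c1 x) + \<iota> (c2 x) * \<alpha>" for x
  have a0: "\<alpha> \<noteq> 0"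
    using alpha_notin by (rule not_in_range_nonzero)
  have "\<exists>k. has_modulus (T c) k"
    using c by (intro has_modulus_exists[where S = "T (inverse c)"] T_add continuous_T T_inverse)
  then obtain k where k: "has_modulus (T c) k" ..
  have "\<exists>l. has_modulus S l"
  proof (rule has_modulus_exists[where S = S'])
    show "S (x + y) = S x + S y" for x y
      by (simp add: S_def c_add incl_add incl_mult algebra_simps)
    show "continuous_on UNIV S" "continuous_on UNIV S'"
      unfolding S_def S'_def continuous_on_def by (intro ballI tendsto_intros tendsto_ident_at)+
    show "S (S' x) = x" "S' (S x) = x" for x
      using c by (simp_all add: S_def S'_def coords_decomp flip: mult.assoc)
  qed
  then obtain l where l: "has_modulus S l" ..
  have comm: "T c (\<alpha> * x) = \<alpha> * S x" for x
  proof -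
    have "\<alpha> * x = \<alpha> * (\<iota> (c1 x) + \<iota> (c2 x) * \<alpha>)"
      by (simp add: coords_decomp)
    also have "\<dots> = \<iota> (c2 x * dsq) + \<iota> (c1 x) * \<alpha>"
      by (simp add: incl_mult incl_dsq algebra_simps power2_eq_square)
    finally have "coords \<iota> \<alpha> (\<alpha> * x) = (c2 x * dsq, c1 x)"
      by (metis coords_eq)
    then show ?thesis
      by (simp add: T_def S_def incl_mult incl_dsq algebra_simps power2_eq_square)
  qed
  have "has_modulus (\<lambda>x. T c (\<alpha> * x)) (k * absval \<alpha>)"
    by (rule has_modulus_comp[OF k has_modulus_mult[OF a0]])
  moreover have "has_modulus (\<lambda>x. T c (\<alpha> * x)) (absval \<alpha> * l)"
    unfolding comm by (rule has_modulus_comp[OF has_modulus_mult[OF a0] l])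
  ultimately have "k * absval \<alpha> = absval \<alpha> * l"
    by (rule has_modulus_unique)
  then have kl: "l = k"
    using a0 by simp
  have "T c (S x) = \<iota> c * x" for x
  proof -
    have "T c (S x) = \<iota> c * (\<iota> (c1 x) + \<iota> (c2 x) * \<alpha>)"
      by (simp only: T_def S_def coords_eq fst_conv snd_conv) (simp add: incl_mult algebra_simps)
    then show ?thesis
      by (simp add: coords_decomp)
  qed
  then have "has_modulus (\<lambda>x. \<iota> c * x) (k * l)"
    using has_modulus_comp[OF k l] by simp
  then have "k * l = absval (\<iota> c)"
    using has_modulus_unique has_modulus_mult[of "\<iota> c"] c by auto
  then have "k ^ 2 = absval c ^ 2"
    by (simp add: kl absval_incl power2_eq_square)
  then have "k = absval c"
    using k by (simp add: has_modulus_def)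
  with k show ?thesis by simp
qed

end

section \<open>The kernel off F and its symmetries\<close>

locale kernel_setup = quadratic_extension \<iota> \<alpha> \<pi>E \<pi>F + haar dx
  for \<iota> :: "'f::nonarch_local_field \<Rightarrow> 'e::nonarch_local_field" and \<alpha> \<pi>E \<pi>F and dx :: "'e measure" +
  fixes chi :: "'e \<Rightarrow> complex" and eta :: "'f \<Rightarrow> complex"
  assumes chi: "chi \<in> unit_characters" and eta: "eta \<in> unit_characters"
begin

sublocale E: quasicharacter \<pi>E chi
  using uniformizerE chi by unfold_locales
sublocale F: quasicharacter \<pi>F eta
  using uniformizerF eta by unfold_locales

text \<open>The parameters are shifted: \<open>\<sigma> = s - 1/2\<close> and \<open>\<tau> = t + 1/2\<close>.\<close>

definition K :: "complex \<Rightarrow> complex \<Rightarrow> 'e \<Rightarrow> complex" where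
  "K \<sigma> \<tau> x = E.Q \<sigma> (x ^ 2) * (E.Q \<sigma> (\<iota> (Y x)) * F.Q \<tau> (Y x))"

lemma kernel_eq: "kernel \<iota> \<alpha> \<pi>E \<pi>F chi eta s t = K (s - 1/2) (t + 1/2)"
  by (rule ext) (simp add: kernel_def K_def Y_eq dsq_def Let_def)

lemma K_eq_0: "x \<in> range \<iota> \<Longrightarrow> K \<sigma> \<tau> x = 0"
  using Y_eq_0_iff[of x] by (simp add: K_def)

lemma eventually_K_eq:
  assumes "x \<notin> range \<iota>"
  shows "\<forall>\<^sub>F y in nhds x. \<forall>\<sigma> \<tau>. K \<sigma> \<tau> y = K \<sigma> \<tau> x"
proof -
  have x: "x \<noteq> 0" "Y x \<noteq> 0"
    using assms Y_eq_0_iff not_in_range_nonzero by blast+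
  have id: "((\<lambda>y. y) \<longlongrightarrow> x) (nhds x)"
    by (rule filterlim_ident)
  have Y: "(Y \<longlongrightarrow> Y x) (nhds x)"
    using tendsto_Y[OF id x(1)] .
  have "\<forall>\<^sub>F y in nhds x. \<forall>s. E.Q s (y ^ 2) = E.Q s (x ^ 2)"
    using x by (intro E.Q_locally_constant tendsto_intros id) auto
  moreover have "\<forall>\<^sub>F y in nhds x. \<forall>s. E.Q s (\<iota> (Y y)) = E.Q s (\<iota> (Y x))"
    using x by (intro E.Q_locally_constant tendsto_intros Y) auto
  moreover have "\<forall>\<^sub>F y in nhds x. \<forall>s. F.Q s (Y y) = F.Q s (Y x)"
    using x by (intro F.Q_locally_constant Y)
  ultimately show ?thesis
    by eventually_elim (simp add: K_def)
qed

lemma K_borel [measurable]: "K \<sigma> \<tau> \<in> borel_measurable borel"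
proof (rule borel_measurable_continuous_on_open_const)
  show "open (- range \<iota>)"
    using closed_range_incl by auto
  have "isCont (K \<sigma> \<tau>) x" if "x \<notin> range \<iota>" for x
    unfolding isCont_def using eventually_K_eq[OF that]
    by (intro tendsto_eventually) (auto simp: eventually_at_filter elim: eventually_mono)
  then show "continuous_on (- range \<iota>) (K \<sigma> \<tau>)"
    by (intro continuous_at_imp_continuous_on) auto
  show "K \<sigma> \<tau> x = 0" if "x \<notin> - range \<iota>" for x
    using that K_eq_0 by auto
qed

text \<open>The coefficient of \<sigma> in the logarithm of the kernel; \<open>expF\<close> is that
  of \<tau>.\<close>

definition expE :: "'e \<Rightarrow> real" where
  "expE x = ln (absval (x ^ 2)) + ln (absval (\<iota> (Y x)))"

definition expF :: "'e \<Rightarrow> real" where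
  "expF x = ln (absval (Y x))"

lemma K_exp: "K \<sigma> \<tau> x = K 0 0 x * exp (\<sigma> * of_real (expE x) + \<tau> * of_real (expF x))"
proof (cases "x \<in> range \<iota>")
  case True
  then show ?thesis by (simp add: K_eq_0)
next
  case False
  then have x: "x ^ 2 \<noteq> 0" "Y x \<noteq> 0" "\<iota> (Y x) \<noteq> 0"
    using Y_eq_0_iff not_in_range_nonzero by auto
  show ?thesis
    unfolding K_def E.Q_exp[OF x(1), of \<sigma>] E.Q_exp[OF x(3), of \<sigma>] F.Q_exp[OF x(2), of \<tau>]
    by (simp add: expE_def expF_def exp_add algebra_simps)
qed

lemma eventually_exponents_eq:
  assumes "x \<notin> range \<iota>"
  shows "\<forall>\<^sub>F y in nhds x. expE y = expE x \<and> expF y = expF x"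
proof -
  have x: "x \<noteq> 0" "Y x \<noteq> 0"
    using assms Y_eq_0_iff not_in_range_nonzero by blast+
  have id: "((\<lambda>y. y) \<longlongrightarrow> x) (nhds x)"
    by (rule filterlim_ident)
  show ?thesis
    using eventually_absval_eq[OF id x(1)] eventually_absval_eq[OF tendsto_Y[OF id x(1)] x(2)]
    by eventually_elim (simp add: expE_def expF_def absval_power absval_incl)
qed

text \<open>x^2 contributes a^2 and Y contributes 1/a: chi sees a^2/a = a, and eta sees 1/a.\<close>

lemma K_scale:
  assumes "a \<noteq> 0"
  shows "K \<sigma> \<tau> (\<iota> a * x) = E.Q \<sigma> (\<iota> a) / F.Q \<tau> a * K \<sigma> \<tau> x"
proof (cases "x \<in> range \<iota>")
  case True
  then have "\<iota> a * x \<in> range \<iota>"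
    by (auto simp flip: incl_mult)
  with True show ?thesis
    by (simp add: K_eq_0)
next
  case False
  then have x: "x \<noteq> 0" "Y x \<noteq> 0"
    using Y_eq_0_iff not_in_range_nonzero by blast+
  have a: "\<iota> a \<noteq> 0" "E.Q \<sigma> (\<iota> a) \<noteq> 0"
    using assms E.Q_nonzero by auto
  show ?thesis
    using assms x a
    by (simp add: K_def Y_scale E.Q_power2 E.Q_mult incl_divide E.Q_divide F.Q_divide power2_eq_square)
qed

text \<open>Y is invariant, so only the factor with x^2 changes.\<close>

lemma K_moebius:
  assumes "1 + \<iota> b * x \<noteq> 0"
  shows "K \<sigma> \<tau> (x / (1 + \<iota> b * x)) = inverse (E.Q \<sigma> ((1 + \<iota> b * x) ^ 2)) * K \<sigma> \<tau> x"
proof (cases "x = 0")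
  case False
  have "E.Q \<sigma> (x ^ 2 / (1 + \<iota> b * x) ^ 2) = E.Q \<sigma> (x ^ 2) / E.Q \<sigma> ((1 + \<iota> b * x) ^ 2)"
    using False assms by (intro E.Q_divide) auto
  then show ?thesis
    by (simp only: K_def Y_moebius[OF assms] power_divide) (simp add: divide_inverse)
qed (simp add: K_def)

section \<open>A cone around F on which the kernel is homogeneous\<close>

text \<open>Both 1 + w \<alpha> and its norm 1 - w^2 \<open>dsq\<close> tend to 1 as w tends to 0,
  and quasicharacters are trivial near 1 uniformly in s.\<close>

lemma near_F_radius:
  obtains m :: nat where
    "\<And>w. w \<in> vball 0 (int m) \<Longrightarrow> absval (1 + \<iota> w * \<alpha>) = 1 \<and> (\<forall>s. E.Q s (1 + \<iota> w * \<alpha>) = 1) \<and>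
       (\<forall>s. E.Q s (\<iota> (1 - w ^ 2 * dsq)) = 1) \<and> (\<forall>s. F.Q s (1 - w ^ 2 * dsq) = 1)"
proof -
  let ?P = "\<lambda>w. absval (1 + \<iota> w * \<alpha>) = absval (1 :: 'e) \<and> (\<forall>s. E.Q s (1 + \<iota> w * \<alpha>) = E.Q s 1) \<and>
       (\<forall>s. E.Q s (\<iota> (1 - w ^ 2 * dsq)) = E.Q s 1) \<and> (\<forall>s. F.Q s (1 - w ^ 2 * dsq) = F.Q s 1)"
  have id: "((\<lambda>w. w) \<longlongrightarrow> 0) (nhds (0::'f))"
    by (rule filterlim_ident)
  have "((\<lambda>w. 1 + \<iota> w * \<alpha>) \<longlongrightarrow> 1 + \<iota> 0 * \<alpha>) (nhds 0)"
    by (intro tendsto_intros id)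
  then have 1: "((\<lambda>w. 1 + \<iota> w * \<alpha>) \<longlongrightarrow> 1) (nhds 0)"
    by simp
  have "((\<lambda>w. 1 - w ^ 2 * dsq) \<longlongrightarrow> 1 - 0 ^ 2 * dsq) (nhds 0)"
    by (intro tendsto_intros id)
  then have 2: "((\<lambda>w. 1 - w ^ 2 * dsq) \<longlongrightarrow> 1) (nhds 0)"
    by simp
  have 3: "((\<lambda>w. \<iota> (1 - w ^ 2 * dsq)) \<longlongrightarrow> 1) (nhds 0)"
    using tendsto_incl[OF 2] by (simp add: incl_one)
  have "\<forall>\<^sub>F w in nhds 0. ?P w"
    by (intro eventually_conj eventually_absval_eq E.Q_locally_constant F.Q_locally_constant 1 2 3) simp_all
  then obtain S where S: "open S" "0 \<in> S" "\<And>w. w \<in> S \<Longrightarrow> ?P w"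
    unfolding eventually_nhds by blast
  then obtain m :: nat where "vball 0 (int m) \<subseteq> S"
    using vball_in_open by blast
  with S(3) show ?thesis
    by (intro that[of m]) auto
qed

text \<open>Chosen once for chi and eta, independently of s and t, so that the cone below does not
  move with the parameters.\<close>

definition m :: nat where
  "m = (SOME m. \<forall>w \<in> vball 0 (int m). absval (1 + \<iota> w * \<alpha>) = 1 \<and> (\<forall>s. E.Q s (1 + \<iota> w * \<alpha>) = 1) \<and>
       (\<forall>s. E.Q s (\<iota> (1 - w ^ 2 * dsq)) = 1) \<and> (\<forall>s. F.Q s (1 - w ^ 2 * dsq) = 1))"

lemma m_trivializes:
  assumes "w \<in> vball 0 (int m)"
  shows "absval (1 + \<iota> w * \<alpha>) = 1" "E.Q s (1 + \<iota> w * \<alpha>) = 1"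
    "E.Q s (\<iota> (1 - w ^ 2 * dsq)) = 1" "F.Q s (1 - w ^ 2 * dsq) = 1"
proof -
  have "\<exists>m. \<forall>w \<in> vball 0 (int m). absval (1 + \<iota> w * \<alpha>) = 1 \<and> (\<forall>s. E.Q s (1 + \<iota> w * \<alpha>) = 1) \<and>
       (\<forall>s. E.Q s (\<iota> (1 - w ^ 2 * dsq)) = 1) \<and> (\<forall>s. F.Q s (1 - w ^ 2 * dsq) = 1)"
    using near_F_radius by metis
  from someI_ex[OF this] show "absval (1 + \<iota> w * \<alpha>) = 1" "E.Q s (1 + \<iota> w * \<alpha>) = 1"
    "E.Q s (\<iota> (1 - w ^ 2 * dsq)) = 1" "F.Q s (1 - w ^ 2 * dsq) = 1"
    using assms unfolding m_def[symmetric] by blast+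
qed

text \<open>A cone of directions close to F, without its apex: the ratio of the coordinates is in
  the range of \<open>m_trivializes\<close>.\<close>

definition R :: "'e set" where
  "R = {x. x \<noteq> 0 \<and> absval (c2 x) \<le> qcard TYPE('f) powi (- int m) * absval (c1 x)}"

lemma R_c1_nonzero: "x \<in> R \<Longrightarrow> c1 x \<noteq> 0"
  by (auto simp: R_def eq_0_iff_coords)

lemma R_ratio: "x \<in> R \<Longrightarrow> c2 x / c1 x \<in> vball 0 (int m)"
  using R_c1_nonzero[of x] by (simp add: R_def vball_def absval_divide pos_divide_le_eq)

lemma R_factor:
  assumes "x \<in> R"
  shows "x = \<iota> (c1 x) * (1 + \<iota> (c2 x / c1 x) * \<alpha>)"
  using R_c1_nonzero[OF assms] coords_decomp[of x] by (simp add: incl_divide algebra_simps)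

lemma absval_R: "x \<in> R \<Longrightarrow> absval x = absval (\<iota> (c1 x))"
  using R_factor[of x] m_trivializes(1)[OF R_ratio[of x]] by (metis absval_mult mult.right_neutral)

text \<open>On the cone x = c1 (1 + w \<alpha>) has norm c1^2 (1 - w^2 \<open>dsq\<close>), and the
  quasicharacters do not see the factors close to 1. What remains is homogeneous in each coordinate
  separately.\<close>

lemma K_R:
  assumes "x \<in> R"
  shows "K \<sigma> \<tau> x = E.Q \<sigma> (\<iota> (c1 x)) ^ 2 *
    (E.Q \<sigma> (\<iota> (c2 x / c1 x ^ 2)) * F.Q \<tau> (c2 x / c1 x ^ 2))"
proof -
  let ?w = "c2 x / c1 x"
  note w = m_trivializes[OF R_ratio[OF assms]]
  have c1: "c1 x \<noteq> 0"
    using assms by (rule R_c1_nonzero)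
  have nz: "1 + \<iota> ?w * \<alpha> \<noteq> 0" "1 - ?w ^ 2 * dsq \<noteq> 0"
  proof -
    show "1 + \<iota> ?w * \<alpha> \<noteq> 0"
      using w(1) by auto
    show "1 - ?w ^ 2 * dsq \<noteq> 0"
      using w(4)[of 0] by auto
  qed
  have "E.Q \<sigma> x = E.Q \<sigma> (\<iota> (c1 x))"
    using arg_cong[OF R_factor[OF assms], of "E.Q \<sigma>"] E.Q_mult[of "\<iota> (c1 x)" "1 + \<iota> ?w * \<alpha>" \<sigma>] nz(1) c1 w(2)
    by simp
  moreover have "Y x = (c2 x / c1 x ^ 2) / (1 - ?w ^ 2 * dsq)"
  proof -
    have "c1 x ^ 2 - c2 x ^ 2 * dsq = c1 x ^ 2 * (1 - ?w ^ 2 * dsq)"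
      using c1 by (simp add: power_divide right_diff_distrib)
    then show ?thesis
      by (simp add: Y_eq)
  qed
  \<comment> \<open>\<open>Q_divide\<close> asks for a nonzero numerator; for
    \<open>c2 x = 0\<close> both sides are 0.\<close>
  moreover have "E.Q \<sigma> (\<iota> ((c2 x / c1 x ^ 2) / (1 - ?w ^ 2 * dsq))) = E.Q \<sigma> (\<iota> (c2 x / c1 x ^ 2))"
    using E.Q_divide[of "\<iota> (c2 x / c1 x ^ 2)" "\<iota> (1 - ?w ^ 2 * dsq)" \<sigma>] w(3) nz(2)
    by (cases "c2 x = 0") (simp_all only: incl_divide[of _ "1 - _"] incl_eq_0_iff, use c1 in auto)
  moreover have "F.Q \<tau> ((c2 x / c1 x ^ 2) / (1 - ?w ^ 2 * dsq)) = F.Q \<tau> (c2 x / c1 x ^ 2)"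
    using F.Q_divide[of "c2 x / c1 x ^ 2" "1 - ?w ^ 2 * dsq" \<tau>] w(4) nz(2) c1
    by (cases "c2 x = 0") simp_all
  ultimately show ?thesis
    by (simp only: K_def E.Q_power2)
qed

lemma T_R:
  assumes "x \<in> R" "absval c \<le> 1"
  shows "T c x \<in> R"
proof -
  have "absval c * absval (c2 x) \<le> 1 * (qcard TYPE('f) powi (- int m) * absval (c1 x))"
    using assms by (intro mult_mono) (auto simp: R_def)
  moreover have "T c x \<noteq> 0"
    using R_c1_nonzero[OF assms(1)] by (simp add: eq_0_iff_coords)
  ultimately show ?thesis
    by (simp add: R_def absval_mult)
qed

text \<open>On the cone the absolute value depends only on the first coordinate, which
  \<open>T c\<close> preserves.\<close>

lemma absval_T: "x \<in> R \<Longrightarrow> absval c \<le> 1 \<Longrightarrow> absval (T c x) = absval x"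
  using absval_R[of x] absval_R[OF T_R] by simp

lemma K_T:
  assumes x: "x \<in> R" and c: "c \<noteq> 0" "absval c \<le> 1"
  shows "K \<sigma> \<tau> (T c x) = E.Q \<sigma> (\<iota> c) * F.Q \<tau> c * K \<sigma> \<tau> x"
proof (cases "c2 x = 0")
  case True
  then show ?thesis
    by (simp add: K_R[OF x] K_R[OF T_R[OF x c(2)]])
next
  case False
  let ?z = "c2 x / c1 x ^ 2"
  have z: "?z \<noteq> 0"
    using False R_c1_nonzero[OF x] by simp
  have "c * c2 x / c1 x ^ 2 = c * ?z"
    by simp
  then have "K \<sigma> \<tau> (T c x) = E.Q \<sigma> (\<iota> (c1 x)) ^ 2 * (E.Q \<sigma> (\<iota> (c * ?z)) * F.Q \<tau> (c * ?z))"
    by (simp only: K_R[OF T_R[OF x c(2)]] coords_T fst_conv snd_conv)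
  also have "\<dots> = E.Q \<sigma> (\<iota> c) * F.Q \<tau> c * K \<sigma> \<tau> x"
    using c z E.Q_mult[of "\<iota> c" "\<iota> ?z" \<sigma>] F.Q_mult[of c ?z \<tau>]
    by (simp only: K_R[OF x] incl_mult incl_eq_0_iff) (simp add: mult_ac)
  finally show ?thesis .
qed

text \<open>The value group is discrete, so the closed condition that cuts out R can also be written
  with a strict inequality. At 0 this breaks down, since the cone reaches its apex.\<close>

lemma R_locally_constant:
  assumes "x \<noteq> 0"
  shows "\<forall>\<^sub>F y in nhds x. (y \<in> R) = (x \<in> R)"
proof -
  let ?q = "qcard TYPE('f)"
  have c1: "continuous_on UNIV (\<lambda>x. absval (c1 x))" and c2: "continuous_on UNIV (\<lambda>x. absval (c2 x))"
    unfolding continuous_on_def by (intro ballI tendsto_intros tendsto_ident_at)+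
  show ?thesis
  proof (cases "x \<in> R")
    case True
    \<comment> \<open>No absolute value lies strictly between q^(-m) |c1 x| and q^(1 - m) |c1 x|, so
      U is contained in R.\<close>
    define U where "U = {x. absval (c2 x) < ?q powi (1 - int m) * absval (c1 x)}"
    have "open U"
      unfolding U_def by (intro open_Collect_less continuous_on_mult continuous_on_const c1 c2)
    moreover have "U \<subseteq> R"
    proof
      fix y assume y: "y \<in> U"
      then have y1: "c1 y \<noteq> 0"
        using absval_nonneg[of "c2 y"] by (auto simp: U_def simp del: absval_nonneg)
      obtain p :: 'f where p: "p \<noteq> 0" "val p = int m - 1"
        using val_surj by blast
      obtain p' :: 'f where p': "p' \<noteq> 0" "val p' = int m"
        using val_surj by blast
      have "absval (c2 y) \<le> absval (p' * c1 y)"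
      proof (cases "c2 y = 0")
        case False
        have "absval (c2 y) < absval (p * c1 y)"
          using y p by (simp add: U_def absval_mult absval_eq[of p])
        then have "val (p * c1 y) < val (c2 y)"
          using absval_le_iff[of "p * c1 y" "c2 y"] False p y1 by (simp add: not_le[symmetric])
        then have "val (p' * c1 y) \<le> val (c2 y)"
          using p p' y1 by (simp add: val_mult)
        then show ?thesis
          using False p' y1 by (subst absval_le_iff) auto
      qed simp
      then show "y \<in> R"
        using p' y1 by (auto simp: R_def absval_mult absval_eq[of p'])
    qed
    moreover have "x \<in> U"
    proof -
      have "?q powi (- int m) * absval (c1 x) < ?q powi (1 - int m) * absval (c1 x)"
        using R_c1_nonzero[OF True] qcard_gt_1[where 'a='f]
        by (intro mult_strict_right_mono power_int_strict_increasing) auto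
      then show ?thesis
        using True by (auto simp: U_def R_def)
    qed
    ultimately show ?thesis
      using True by (intro eventually_mono[OF eventually_nhds_in_open[of U x]]) auto
  next
    case False
    define U where "U = {x. ?q powi (- int m) * absval (c1 x) < absval (c2 x)}"
    have "open U"
      unfolding U_def by (intro open_Collect_less continuous_on_mult continuous_on_const c1 c2)
    moreover have "x \<in> U" "U \<inter> R = {}"
      using False assms by (auto simp: U_def R_def)
    ultimately show ?thesis
      using False by (intro eventually_mono[OF eventually_nhds_in_open[of U x]]) auto
  qed
qed

end

section \<open>Holomorphic functions of two variables and self-similar integrals\<close>

lemma holomorphic2_const: "holomorphic2 (\<lambda>z. c)"
  unfolding holomorphic2_def by (intro allI exI[of _ 0]) simp

lemma holomorphic2_exp: "holomorphic2 (\<lambda>z. exp (fst z * a + snd z * b))"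
  unfolding holomorphic2_def
proof
  fix z :: "complex \<times> complex"
  let ?e = "exp (fst z * a + snd z * b)"
  have "((\<lambda>z. fst z * a + snd z * b) has_derivative (\<lambda>h. fst h * a + snd h * b)) (at z)"
    by (intro has_derivative_add has_derivative_mult_left has_derivative_fst has_derivative_snd has_derivative_ident)
  from has_derivative_compose[OF this DERIV_exp[unfolded has_field_derivative_def]]
  have "((\<lambda>z. exp (fst z * a + snd z * b)) has_derivative (\<lambda>h. ?e * a * fst h + ?e * b * snd h)) (at z)"
    by (rule has_derivative_eq_rhs) (simp add: algebra_simps)
  then show "\<exists>a' b'. ((\<lambda>z. exp (fst z * a + snd z * b)) has_derivative (\<lambda>h. a' * fst h + b' * snd h)) (at z)"
    by blast
qed

lemma holomorphic2_add:
  assumes "holomorphic2 f" "holomorphic2 g"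
  shows "holomorphic2 (\<lambda>z. f z + g z)"
  unfolding holomorphic2_def
proof
  fix z
  obtain a b a' b' where d: "(f has_derivative (\<lambda>h. a * fst h + b * snd h)) (at z)"
    "(g has_derivative (\<lambda>h. a' * fst h + b' * snd h)) (at z)"
    using assms unfolding holomorphic2_def by metis
  have "((\<lambda>z. f z + g z) has_derivative (\<lambda>h. (a + a') * fst h + (b + b') * snd h)) (at z)"
    by (rule has_derivative_eq_rhs[OF has_derivative_add[OF d]]) (simp add: algebra_simps)
  then show "\<exists>a b. ((\<lambda>z. f z + g z) has_derivative (\<lambda>h. a * fst h + b * snd h)) (at z)"
    by blast
qed

lemma holomorphic2_mult:
  assumes "holomorphic2 f" "holomorphic2 g"
  shows "holomorphic2 (\<lambda>z. f z * g z)"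
  unfolding holomorphic2_def
proof
  fix z
  obtain a b a' b' where d: "(f has_derivative (\<lambda>h. a * fst h + b * snd h)) (at z)"
    "(g has_derivative (\<lambda>h. a' * fst h + b' * snd h)) (at z)"
    using assms unfolding holomorphic2_def by metis
  have "((\<lambda>z. f z * g z) has_derivative
      (\<lambda>h. (f z * a' + a * g z) * fst h + (f z * b' + b * g z) * snd h)) (at z)"
    by (rule has_derivative_eq_rhs[OF has_derivative_mult[OF d]]) (simp add: algebra_simps)
  then show "\<exists>a b. ((\<lambda>z. f z * g z) has_derivative (\<lambda>h. a * fst h + b * snd h)) (at z)"
    by blast
qed

lemma holomorphic2_cmult: "holomorphic2 f \<Longrightarrow> holomorphic2 (\<lambda>z. c * f z)"
  by (intro holomorphic2_mult holomorphic2_const)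

lemma holomorphic2_diff:
  assumes "holomorphic2 f" "holomorphic2 g"
  shows "holomorphic2 (\<lambda>z. f z - g z)"
  using holomorphic2_add[OF assms(1) holomorphic2_cmult[OF assms(2), of "- 1"]] by simp

lemma holomorphic2_sum:
  assumes "\<And>i. i \<in> I \<Longrightarrow> holomorphic2 (f i)"
  shows "holomorphic2 (\<lambda>z. \<Sum>i\<in>I. f i z)"
  using assms by (induction I rule: infinite_finite_induct) (auto intro: holomorphic2_const holomorphic2_add)

lemma holomorphic2_line:
  assumes "holomorphic2 f"
  shows "(\<lambda>w. f (s + w, t)) holomorphic_on UNIV"
  unfolding holomorphic_on_def field_differentiable_def
proof
  fix w
  obtain a b where d: "(f has_derivative (\<lambda>h. a * fst h + b * snd h)) (at (s + w, t))"
    using assms unfolding holomorphic2_def by metis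
  have "((\<lambda>w. (s + w, t)) has_derivative (\<lambda>h. (h, 0))) (at w)"
    by (rule derivative_eq_intros refl | simp)+
  from has_derivative_compose[OF this d] have "((\<lambda>w. f (s + w, t)) has_field_derivative a) (at w)"
    by (simp add: has_field_derivative_def)
  then show "\<exists>f'. ((\<lambda>w. f (s + w, t)) has_field_derivative f') (at w within UNIV)"
    by auto
qed

text \<open>For fixed t, moving s far to the right enters the range of convergence. The identity
  theorem in the single variable w, applied to s + w, then reaches w = 0.\<close>

lemma holomorphic2_eq_0:
  assumes f: "holomorphic2 f"
    and z: "\<And>s t. 0 < Re (2 * s + t + 1/2) \<Longrightarrow> 0 < Re (2 * s - t + 1/2) \<Longrightarrow> f (s, t) = 0"
  shows "f (s, t) = 0"
proof -
  \<comment> \<open>Re w > N gives 2 Re (s + w) > |Re t|, hence both inequalities.\<close>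
  define N where "N = \<bar>Re s\<bar> + \<bar>Re t\<bar> + 1"
  let ?U = "{w. N < Re w}"
  have o: "open ?U"
    by (rule open_halfspace_Re_gt)
  have "f (s + 0, t) = 0"
  proof (rule analytic_continuation[OF holomorphic2_line[OF f], where U = ?U and \<xi> = "of_real (N + 1)"])
    show "of_real (N + 1) islimpt ?U"
      using o by (intro interior_limit_point) (simp add: interior_open)
    show "f (s + w, t) = 0" if "w \<in> ?U" for w
      using that by (intro z) (auto simp: N_def)
  qed auto
  then show ?thesis by simp
qed

text \<open>Peel off the shell of points that leave W under one application of S. Self-similarity
  reproduces the integral over the rest with the factor \<rho>/k < 1, so a geometric series bounds
  the whole; on points that never leave W the integrand is 0.\<close>

lemma (in haar) nn_integral_selfsimilar_finite:
  fixes h :: "'a \<Rightarrow> real" and W :: "'a set"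
  assumes h [measurable]: "h \<in> borel_measurable borel" and h0: "\<And>x. 0 \<le> h x"
    and S: "has_modulus S k" and W [measurable]: "W \<in> sets borel"
    and SW: "\<And>x. S x \<in> W \<Longrightarrow> x \<in> W"
    and hS: "\<And>x. S x \<in> W \<Longrightarrow> h x = \<rho> * h (S x)"
    and \<rho>: "0 \<le> \<rho>" "\<rho> / k < 1"
    and null: "\<And>x. (\<And>n. (S ^^ n) x \<in> W) \<Longrightarrow> h x = 0"
    and fin: "(\<integral>\<^sup>+x. ennreal (h x) * indicator {x. x \<in> W \<and> S x \<notin> W} x \<partial>M) < \<infinity>"
  shows "(\<integral>\<^sup>+x. ennreal (h x) * indicator W x \<partial>M) < \<infinity>"
proof -
  have k: "k > 0" and mS [measurable]: "S \<in> borel \<rightarrow>\<^sub>M borel"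
    using S by (auto simp: has_modulus_def)
  have [measurable]: "(S ^^ n) \<in> borel \<rightarrow>\<^sub>M borel" for n
    by (induction n) auto
  \<comment> \<open>Restricting to the points that have left W after n steps makes the recursion an
    induction on finite quantities.\<close>
  define f where "f n x = ennreal (h x) * indicator {x. x \<in> W \<and> (S ^^ n) x \<notin> W} x" for n x
  have f [measurable]: "f n \<in> borel_measurable borel" for n
    unfolding f_def by measurable
  obtain A where A: "A \<ge> 0" "(\<integral>\<^sup>+x. f 1 x \<partial>M) = ennreal A"
    using fin by (cases "\<integral>\<^sup>+x. f 1 x \<partial>M") (auto simp: f_def)
  define \<kappa> where "\<kappa> = \<rho> / k"
  have \<kappa>: "0 \<le> \<kappa>" "\<kappa> < 1"
    using \<rho> k by (auto simp: \<kappa>_def)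
  \<comment> \<open>A/(1 - \<kappa>) is the fixed point of X -> A + \<kappa> X, hence stable under
    the recursion.\<close>
  have bound: "(\<integral>\<^sup>+x. f n x \<partial>M) \<le> ennreal (A / (1 - \<kappa>))" for n
  proof (induction n)
    case 0
    then show ?case by (simp add: f_def)
  next
    case (Suc n)
    \<comment> \<open>Either S x has already left W, which is the first term, or S x is in W and has
      left it after n further steps.\<close>
    have "f (Suc n) x \<le> f 1 x + ennreal \<rho> * f n (S x)" for x
    proof (cases "x \<in> W \<and> (S ^^ n) (S x) \<notin> W \<and> S x \<in> W")
      case True
      then show ?thesis
        using hS[of x] h0 \<rho>(1) by (simp add: f_def funpow_swap1 ennreal_mult)
    next
      case False
      then show ?thesis
        by (auto simp: f_def funpow_swap1 indicator_def)
    qed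
    then have "(\<integral>\<^sup>+x. f (Suc n) x \<partial>M) \<le> (\<integral>\<^sup>+x. f 1 x + ennreal \<rho> * f n (S x) \<partial>M)"
      by (intro nn_integral_mono)
    also have "\<dots> = (\<integral>\<^sup>+x. f 1 x \<partial>M) + ennreal \<rho> * (\<integral>\<^sup>+x. f n (S x) \<partial>M)"
      by (subst nn_integral_add) (auto simp: nn_integral_cmult)
    also have "(\<integral>\<^sup>+x. f n (S x) \<partial>M) = ennreal (1 / k) * (\<integral>\<^sup>+x. f n x \<partial>M)"
      by (rule has_modulus_nn_integral[OF S f])
    also have "(\<integral>\<^sup>+x. f 1 x \<partial>M) + ennreal \<rho> * (ennreal (1 / k) * (\<integral>\<^sup>+x. f n x \<partial>M))
      \<le> ennreal A + ennreal \<rho> * (ennreal (1 / k) * ennreal (A / (1 - \<kappa>)))"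
      unfolding A(2) by (intro add_mono mult_left_mono Suc order_refl) auto
    also have "\<dots> = ennreal A + ennreal (\<kappa> * (A / (1 - \<kappa>)))"
      using \<rho>(1) k A(1) \<kappa> by (simp add: \<kappa>_def flip: ennreal_mult)
    also have "\<dots> = ennreal (A + \<kappa> * (A / (1 - \<kappa>)))"
      using A(1) \<kappa> by (intro ennreal_plus[symmetric]) auto
    also have "A + \<kappa> * (A / (1 - \<kappa>)) = A / (1 - \<kappa>)"
      using \<kappa> by (simp add: field_simps)
    finally show ?case .
  qed
  have anti: "(S ^^ n) x \<in> W" if "(S ^^ Suc n) x \<in> W" for n x
    using SW that by simp
  have "incseq f"
  proof (rule incseq_SucI, rule le_funI)
    fix n x
    show "f n x \<le> f (Suc n) x"
      unfolding f_def by (intro mult_left_mono indicator_leI) (use anti in auto)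
  qed
  then have "(\<integral>\<^sup>+x. (SUP n. f n x) \<partial>M) = (SUP n. \<integral>\<^sup>+x. f n x \<partial>M)"
    by (intro nn_integral_monotone_convergence_SUP) auto
  also have "\<dots> \<le> ennreal (A / (1 - \<kappa>))"
    by (intro SUP_least bound)
  finally have *: "(\<integral>\<^sup>+x. (SUP n. f n x) \<partial>M) \<le> ennreal (A / (1 - \<kappa>))" .
  have "ennreal (h x) * indicator W x \<le> (SUP n. f n x)" for x
  proof (cases "x \<in> W \<and> (\<exists>n. (S ^^ n) x \<notin> W)")
    case True
    then obtain n where n: "x \<in> W" "(S ^^ n) x \<notin> W"
      by blast
    then have "ennreal (h x) * indicator W x = f n x"
      by (simp add: f_def)
    then show ?thesis
      using SUP_upper[of n UNIV "\<lambda>n. f n x"] by simp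
  next
    case False
    then have "x \<notin> W \<or> h x = 0"
      using null by blast
    then show ?thesis by auto
  qed
  then have "(\<integral>\<^sup>+x. ennreal (h x) * indicator W x \<partial>M) \<le> (\<integral>\<^sup>+x. (SUP n. f n x) \<partial>M)"
    by (intro nn_integral_mono)
  also note *
  finally show ?thesis
    by (rule le_less_trans) simp
qed

section \<open>Regularization of test functions\<close>

context kernel_setup
begin

text \<open>A locally constant function that vanishes on F vanishes near F, so its support stays
  where K is locally constant.\<close>

definition good :: "('e \<Rightarrow> complex) set" where
  "good = {\<phi> \<in> test_functions UNIV. \<forall>x \<in> range \<iota>. \<phi> x = 0}"

text \<open>If the integrand is not integrable this is 0 by convention, so additivity in \<phi> is
  available on \<open>good\<close> or in the range of convergence.\<close>

definition I :: "complex \<Rightarrow> complex \<Rightarrow> ('e \<Rightarrow> complex) \<Rightarrow> complex" where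
  "I \<sigma> \<tau> \<phi> = (\<integral>x. K \<sigma> \<tau> x * \<phi> x \<partial>dx)"

lemma goodD: "\<phi> \<in> good \<Longrightarrow> \<phi> \<in> test_functions UNIV" "\<phi> \<in> good \<Longrightarrow> \<phi> x \<noteq> 0 \<Longrightarrow> x \<notin> range \<iota>"
  by (auto simp: good_def)

lemma K_times_good:
  assumes "\<phi> \<in> good"
  shows "(\<lambda>x. K \<sigma> \<tau> x * \<phi> x) \<in> test_functions UNIV"
proof (rule test_functions_times[OF goodD(1)[OF assms]])
  fix x assume "\<phi> x \<noteq> 0"
  from eventually_K_eq[OF goodD(2)[OF assms this]]
  show "\<forall>\<^sub>F y in nhds x. K \<sigma> \<tau> y = K \<sigma> \<tau> x"
    by (rule eventually_mono) blast
qed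

lemma integrable_good: "\<phi> \<in> good \<Longrightarrow> integrable dx (\<lambda>x. K \<sigma> \<tau> x * \<phi> x)"
  by (rule test_functions_integrable[OF K_times_good])

lemma I_add:
  assumes "\<phi> \<in> good" "\<psi> \<in> good"
  shows "I \<sigma> \<tau> (\<lambda>x. \<phi> x + \<psi> x) = I \<sigma> \<tau> \<phi> + I \<sigma> \<tau> \<psi>"
  unfolding I_def by (simp add: distrib_left integrable_good assms)

lemma I_cmult: "I \<sigma> \<tau> (\<lambda>x. c * \<phi> x) = c * I \<sigma> \<tau> \<phi>"
proof -
  have "K \<sigma> \<tau> x * (c * \<phi> x) = c * (K \<sigma> \<tau> x * \<phi> x)" for x
    by (rule mult.left_commute)
  then show ?thesis
    by (simp only: I_def integral_mult_right_zero)
qed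

text \<open>On the compact support of \<phi> the exponents of K take finitely many values. Sorting
  the support by these values gives a finite sum of exponentials in (s, t).\<close>

lemma holomorphic2_I:
  assumes \<phi>: "\<phi> \<in> good"
  shows "holomorphic2 (\<lambda>(s, t). I (s - 1/2) (t + 1/2) \<phi>)"
proof -
  define g where "g x = (expE x, expF x)" for x
  have g: "\<forall>\<^sub>F y in nhds x. g y = g x" if "\<phi> x \<noteq> 0" for x
    using eventually_exponents_eq[OF goodD(2)[OF \<phi> that]] by eventually_elim (simp add: g_def)
  define P where "P = g ` {x. \<phi> x \<noteq> 0}"
  have P: "finite P"
    unfolding P_def using g by (intro finite_image_locally_constant test_functionsD(2)[OF goodD(1)[OF \<phi>]]) auto
  define \<phi>p where "\<phi>p p x = (if g x = p then 1 else 0) * \<phi> x" for p x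
  have \<phi>p: "\<phi>p p \<in> good" for p
  proof -
    have "\<phi>p p \<in> test_functions UNIV"
      unfolding \<phi>p_def
    proof (rule test_functions_times[OF goodD(1)[OF \<phi>]])
      fix x assume "\<phi> x \<noteq> 0"
      from g[OF this] show "\<forall>\<^sub>F y in nhds x. (if g y = p then 1 else 0) = (if g x = p then 1 else 0 :: complex)"
        by (rule eventually_mono) simp
    qed
    then show ?thesis
      using \<phi> by (auto simp: good_def \<phi>p_def)
  qed
  have "I \<sigma> \<tau> \<phi> = (\<Sum>p\<in>P. I 0 0 (\<phi>p p) * exp (\<sigma> * of_real (fst p) + \<tau> * of_real (snd p)))" for \<sigma> \<tau>
  proof -
    have "K \<sigma> \<tau> x * \<phi> x =
        (\<Sum>p\<in>P. K 0 0 x * \<phi>p p x * exp (\<sigma> * of_real (fst p) + \<tau> * of_real (snd p)))" for x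
    proof (cases "\<phi> x = 0")
      case True
      then show ?thesis by (simp add: \<phi>p_def)
    next
      case False
      then have "g x \<in> P"
        by (simp add: P_def)
      have "(\<Sum>p\<in>P. K 0 0 x * \<phi>p p x * exp (\<sigma> * of_real (fst p) + \<tau> * of_real (snd p)))
        = (\<Sum>p\<in>P. if p = g x then K 0 0 x * \<phi> x * exp (\<sigma> * of_real (fst p) + \<tau> * of_real (snd p)) else 0)"
        by (intro sum.cong) (auto simp: \<phi>p_def)
      also have "\<dots> = K 0 0 x * \<phi> x * exp (\<sigma> * of_real (expE x) + \<tau> * of_real (expF x))"
        using P \<open>g x \<in> P\<close> by (simp add: g_def)
      also have "\<dots> = K \<sigma> \<tau> x * \<phi> x"
        by (simp add: K_exp[of \<sigma> \<tau>])
      finally show ?thesis ..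
    qed
    then show ?thesis
      unfolding I_def by (simp add: integrable_good[OF \<phi>p])
  qed
  then have eq: "(\<lambda>(s, t). I (s - 1/2) (t + 1/2) \<phi>) = (\<lambda>z. \<Sum>p\<in>P.
      I 0 0 (\<phi>p p) * exp (- of_real (fst p) / 2 + of_real (snd p) / 2) *
      exp (fst z * of_real (fst p) + snd z * of_real (snd p)))"
    by (auto simp: fun_eq_iff algebra_simps diff_divide_distrib simp flip: exp_add)
  show ?thesis
    unfolding eq by (intro holomorphic2_sum holomorphic2_cmult holomorphic2_exp)
qed

text \<open>Dilation kills the singularity at \<open>0\<close>, scaling the second coordinate the one along \<open>F\<close>.\<close>

definition reg0 :: "'f \<Rightarrow> ('e \<Rightarrow> complex) \<Rightarrow> 'e \<Rightarrow> complex" where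
  "reg0 a \<phi> = (\<lambda>x. \<phi> x - \<phi> (inverse (\<iota> a) * x))"

text \<open>K is homogeneous under T only on R. Hence \<open>reg0\<close> is cut into this piece,
  which T can regularize, and the piece \<open>off\<close>, which is already supported off
  F.\<close>

definition nearF :: "'f \<Rightarrow> ('e \<Rightarrow> complex) \<Rightarrow> 'e \<Rightarrow> complex" where
  "nearF a \<phi> = (\<lambda>x. (if x \<in> R then 1 else 0) * reg0 a \<phi> x)"

definition off :: "'f \<Rightarrow> ('e \<Rightarrow> complex) \<Rightarrow> 'e \<Rightarrow> complex" where
  "off a \<phi> = (\<lambda>x. reg0 a \<phi> x - nearF a \<phi> x)"

definition regF :: "'f \<Rightarrow> 'f \<Rightarrow> ('e \<Rightarrow> complex) \<Rightarrow> 'e \<Rightarrow> complex" where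
  "regF a c \<phi> = (\<lambda>x. nearF a \<phi> x - nearF a \<phi> (T (inverse c) x))"

lemma dilate_test:
  assumes "a \<noteq> 0" "\<phi> \<in> test_functions UNIV"
  shows "(\<lambda>x. \<phi> (inverse (\<iota> a) * x)) \<in> test_functions UNIV"
proof (rule test_functions_compose[OF assms(2), where S = "\<lambda>x. \<iota> a * x"])
  show "\<iota> a * (inverse (\<iota> a) * x) = x" for x
    using assms(1) by (simp flip: mult.assoc)
qed (intro continuous_intros)+

lemma reg0_test: "a \<noteq> 0 \<Longrightarrow> \<phi> \<in> test_functions UNIV \<Longrightarrow> reg0 a \<phi> \<in> test_functions UNIV"
  unfolding reg0_def by (intro test_functions_lincomb(2) dilate_test)

lemma reg0_0: "reg0 a \<phi> 0 = 0"
  by (simp add: reg0_def)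

text \<open>The indicator of R is not locally constant at 0. There \<open>reg0\<close> vanishes,
  which is why dilation comes before the cutoff.\<close>

lemma nearF_test:
  assumes "a \<noteq> 0" "\<phi> \<in> test_functions UNIV"
  shows "nearF a \<phi> \<in> test_functions UNIV"
  unfolding nearF_def
proof (rule test_functions_times[OF reg0_test[OF assms]])
  fix x assume "reg0 a \<phi> x \<noteq> 0"
  then have "x \<noteq> 0"
    using reg0_0 by metis
  from R_locally_constant[OF this]
  show "\<forall>\<^sub>F y in nhds x. (if y \<in> R then 1 else 0) = (if x \<in> R then 1 else 0 :: complex)"
    by (rule eventually_mono) simp
qed

lemma range_subset_R: "x \<in> range \<iota> \<Longrightarrow> x \<noteq> 0 \<Longrightarrow> x \<in> R"
  by (auto simp: R_def)

text \<open>F - {0} lies in R, where the two terms cancel, and at 0 \<open>reg0\<close>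
  vanishes.\<close>

lemma off_good:
  assumes "a \<noteq> 0" "\<phi> \<in> test_functions UNIV"
  shows "off a \<phi> \<in> good"
proof -
  have "off a \<phi> \<in> test_functions UNIV"
    unfolding off_def by (intro test_functions_lincomb(2) reg0_test nearF_test assms)
  moreover have "off a \<phi> x = 0" if "x \<in> range \<iota>" for x
    using range_subset_R[OF that] by (cases "x = 0") (simp_all add: off_def nearF_def reg0_0)
  ultimately show ?thesis
    by (simp add: good_def)
qed

text \<open>T fixes F pointwise, so the two terms cancel there.\<close>

lemma regF_good:
  assumes "a \<noteq> 0" "c \<noteq> 0" "\<phi> \<in> test_functions UNIV"
  shows "regF a c \<phi> \<in> good"
proof -
  have "(\<lambda>x. nearF a \<phi> (T (inverse c) x)) \<in> test_functions UNIV"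
    by (rule test_functions_compose[OF nearF_test[OF assms(1,3)] continuous_T continuous_T
        T_inverse(2)[OF assms(2)]])
  then have "regF a c \<phi> \<in> test_functions UNIV"
    unfolding regF_def using assms by (intro test_functions_lincomb(2) nearF_test)
  moreover have "T (inverse c) x = x" if "x \<in> range \<iota>" for x
    using that by (auto simp: T_def)
  ultimately show ?thesis
    by (simp add: good_def regF_def)
qed

text \<open>The continuation up to a constant. The pairing with \<open>regF\<close> already carries
  the factor produced by \<open>T c\<close>, so the pairing with \<open>off\<close> has to be
  multiplied by it. Both pairings make sense for all parameters.\<close>

definition D :: "'f \<Rightarrow> 'f \<Rightarrow> complex \<Rightarrow> complex \<Rightarrow> ('e \<Rightarrow> complex) \<Rightarrow> complex" where
  "D a c \<sigma> \<tau> \<phi> = (1 - absval c * (E.Q \<sigma> (\<iota> c) * F.Q \<tau> c)) * I \<sigma> \<tau> (off a \<phi>) + I \<sigma> \<tau> (regF a c \<phi>)"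

lemma D_add:
  assumes "a \<noteq> 0" "c \<noteq> 0" "\<phi> \<in> test_functions UNIV" "\<psi> \<in> test_functions UNIV"
  shows "D a c \<sigma> \<tau> (\<lambda>x. \<phi> x + \<psi> x) = D a c \<sigma> \<tau> \<phi> + D a c \<sigma> \<tau> \<psi>"
proof -
  have "off a (\<lambda>x. \<phi> x + \<psi> x) = (\<lambda>x. off a \<phi> x + off a \<psi> x)"
    "regF a c (\<lambda>x. \<phi> x + \<psi> x) = (\<lambda>x. regF a c \<phi> x + regF a c \<psi> x)"
    by (auto simp: off_def regF_def nearF_def reg0_def algebra_simps)
  then show ?thesis
    using assms by (simp add: D_def I_add off_good regF_good algebra_simps)
qed

lemma D_cmult: "D a c \<sigma> \<tau> (\<lambda>x. d * \<phi> x) = d * D a c \<sigma> \<tau> \<phi>"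
proof -
  have "off a (\<lambda>x. d * \<phi> x) = (\<lambda>x. d * off a \<phi> x)" "regF a c (\<lambda>x. d * \<phi> x) = (\<lambda>x. d * regF a c \<phi> x)"
    by (auto simp: off_def regF_def nearF_def reg0_def algebra_simps)
  then show ?thesis
    by (simp add: D_def I_cmult algebra_simps)
qed

lemma holomorphic2_D:
  assumes "a \<noteq> 0" "c \<noteq> 0" "\<phi> \<in> test_functions UNIV"
  shows "holomorphic2 (\<lambda>(s, t). D a c (s - 1/2) (t + 1/2) \<phi>)"
proof -
  let ?e = "complex_of_real (ln (absval (\<iota> c)))" and ?f = "complex_of_real (ln (absval c))"
  let ?k = "absval c * (E.Q 0 (\<iota> c) * F.Q 0 c) * exp (?f / 2 - ?e / 2)"
  \<comment> \<open>The constant \<open>exp (?f / 2 - ?e / 2)\<close> comes from the shifts by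
    1/2.\<close>
  have "E.Q (s - 1/2) (\<iota> c) * F.Q (t + 1/2) c =
      E.Q 0 (\<iota> c) * F.Q 0 c * exp (?f / 2 - ?e / 2) * exp (s * ?e + t * ?f)" for s t
    using assms(2) E.Q_exp[of "\<iota> c" "s - 1/2"] F.Q_exp[of c "t + 1/2"]
    by (simp add: algebra_simps diff_divide_distrib flip: exp_add)
  then have "(\<lambda>(s, t). D a c (s - 1/2) (t + 1/2) \<phi>) = (\<lambda>z.
      (1 - ?k * exp (fst z * ?e + snd z * ?f)) * (\<lambda>(s, t). I (s - 1/2) (t + 1/2) (off a \<phi>)) z
      + (\<lambda>(s, t). I (s - 1/2) (t + 1/2) (regF a c \<phi>)) z)"
    by (auto simp: fun_eq_iff D_def mult.assoc)
  then show ?thesis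
    using assms
    by (simp only:) (intro holomorphic2_add holomorphic2_mult holomorphic2_diff holomorphic2_const
      holomorphic2_cmult holomorphic2_exp holomorphic2_I off_good regF_good)
qed

end

section \<open>Convergence\<close>

text \<open>Serves for points whose whole orbit under an expanding map stays bounded.\<close>

lemma unbounded_powers:
  fixes q a C :: real
  assumes "1 < q" "0 \<le> a" "\<And>n. q ^ n * a \<le> C"
  shows "a = 0"
proof (rule ccontr)
  assume "a \<noteq> 0"
  with assms(2) have a: "a > 0" by simp
  obtain n where "C / a < q ^ n"
    using real_arch_pow[OF assms(1)] by blast
  then have "C < q ^ n * a"
    using a by (simp add: divide_less_eq)
  with assms(3)[of n] show False by simp
qed

context kernel_setup
begin

lemma absval_pi: "absval \<pi>F = exp (- ln (qcard TYPE('f)))"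
  using uniformizerF qcard_pos[where 'a='f] by (simp add: absval_eq power_int_minus exp_minus)

lemma absval_pi_less_1: "absval \<pi>F < 1"
  unfolding absval_pi using qcard_gt_1[where 'a='f] by simp

text \<open>As \<open>\<iota> \<pi>F\<close> is \<open>\<pi>E\<close> or its square, the unit
  character contributes 1. The factor 2 comes from |\<iota> \<pi>F|_E = q_F^(-2).\<close>

lemma E_Q_pi: "E.Q \<sigma> (\<iota> \<pi>F) = exp (- (2 * \<sigma> * of_real (ln (qcard TYPE('f)))))"
proof -
  have "E.Q 0 \<pi>E = 1"
    using uniformizerE by (simp add: E.Q_pi)
  then have "E.Q 0 (\<iota> \<pi>F) = 1"
    using unramified_or_ramified by (auto simp: E.Q_power2)
  then show ?thesis
    using E.Q_exp[of "\<iota> \<pi>F" \<sigma>] uniformizerF(1) by (simp add: absval_incl absval_pi ln_realpow algebra_simps)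
qed

lemma F_Q_pi: "F.Q \<tau> \<pi>F = exp (- (\<tau> * of_real (ln (qcard TYPE('f)))))"
proof -
  have "F.Q 0 \<pi>F = 1"
    using uniformizerF by (simp add: F.Q_pi)
  then show ?thesis
    using F.Q_exp[of \<pi>F \<tau>] uniformizerF(1) by (simp add: absval_pi)
qed

text \<open>k is the exponent in the modulus: 1 for scaling the second coordinate, 2 for dilation of
  E. If the character of the units is trivial, the uniformizer and \<gamma> = 1 work. Otherwise a
  unit on which it is not 1 makes the factor in parentheses a nonzero constant, which \<gamma>
  inverts.\<close>

lemma lambda_factor_scaling:
  assumes \<epsilon>: "\<epsilon> = 1 \<and> k = 1 \<or> \<epsilon> = - 1 \<and> k = (2::nat)"
  shows "\<exists>a \<gamma>. a \<noteq> 0 \<and> absval a \<le> 1 \<and> (\<forall>s t. lambda_factor \<epsilon> \<iota> chi eta s t =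
    \<gamma> * (1 - of_real (absval a ^ k) * (E.Q (s - 1/2) (\<iota> a) * F.Q (t + 1/2) a powi \<epsilon>)))"
proof (cases "\<forall>u\<in>int_units. chi (\<iota> u) * eta u powi \<epsilon> = 1")
  case True
  have "lambda_factor \<epsilon> \<iota> chi eta s t =
      1 * (1 - of_real (absval \<pi>F ^ k) * (E.Q (s - 1/2) (\<iota> \<pi>F) * F.Q (t + 1/2) \<pi>F powi \<epsilon>))" for s t
  proof -
    let ?z = "complex_of_real (ln (qcard TYPE('f)))"
    have a: "complex_of_real (absval \<pi>F) = exp (- ?z)"
      unfolding absval_pi by (metis exp_of_real of_real_minus)
    have "of_nat (residue_card TYPE('f)) powr (- (2 * s + of_int \<epsilon> * t + 1/2)) =
        exp (- (2 * s + of_int \<epsilon> * t + 1/2) * of_real (ln (qcard TYPE('f))))"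
      by (simp add: powr_def Ln_of_nat)
    \<comment> \<open>The exponents add up to 1 + (2s - 1) + (t + 1/2) for \<epsilon> = 1 and to 2 +
      (2s - 1) - (t + 1/2) for \<epsilon> = -1.\<close>
    also have "\<dots> = of_real (absval \<pi>F ^ k) * (E.Q (s - 1/2) (\<iota> \<pi>F) * F.Q (t + 1/2) \<pi>F powi \<epsilon>)"
      using \<epsilon>
    proof (elim disjE conjE)
      assume e: "\<epsilon> = 1" "k = 1"
      have "of_real (absval \<pi>F ^ k) * (E.Q (s - 1/2) (\<iota> \<pi>F) * F.Q (t + 1/2) \<pi>F powi \<epsilon>) =
          exp (- ?z) * (exp (- (2 * (s - 1/2) * ?z)) * exp (- ((t + 1/2) * ?z)))"
        unfolding E_Q_pi F_Q_pi e of_real_power a by simp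
      also have "\<dots> = exp (- ?z + (- (2 * (s - 1/2) * ?z) + - ((t + 1/2) * ?z)))"
        by (simp only: exp_add)
      also have "\<dots> = exp (- (2 * s + of_int \<epsilon> * t + 1/2) * ?z)"
        unfolding e by (rule arg_cong[where f = exp]) (simp add: field_simps)
      finally show ?thesis ..
    next
      assume e: "\<epsilon> = - 1" "k = 2"
      have "of_real (absval \<pi>F ^ k) * (E.Q (s - 1/2) (\<iota> \<pi>F) * F.Q (t + 1/2) \<pi>F powi \<epsilon>) =
          exp (- ?z) * exp (- ?z) * (exp (- (2 * (s - 1/2) * ?z)) * exp ((t + 1/2) * ?z))"
        unfolding E_Q_pi F_Q_pi e of_real_power a
        by (simp add: power2_eq_square power_int_minus exp_minus)
      also have "\<dots> = exp (- ?z + - ?z + (- (2 * (s - 1/2) * ?z) + (t + 1/2) * ?z))"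
        by (simp only: exp_add)
      also have "\<dots> = exp (- (2 * s + of_int \<epsilon> * t + 1/2) * ?z)"
        unfolding e by (rule arg_cong[where f = exp]) (simp add: field_simps)
      finally show ?thesis ..
    qed
    finally show ?thesis
      using True by (simp add: lambda_factor_def)
  qed
  then show ?thesis
    using uniformizerF(1) absval_pi_less_1 by (intro exI[of _ \<pi>F] exI[of _ 1]) auto
next
  case False
  then obtain u where u: "u \<in> int_units" "chi (\<iota> u) * eta u powi \<epsilon> \<noteq> 1"
    by blast
  have abs: "absval u = 1"
    using u(1) by (simp add: int_units_def absval_eq)
  have "lambda_factor \<epsilon> \<iota> chi eta s t = inverse (1 - chi (\<iota> u) * eta u powi \<epsilon>) *
      (1 - of_real (absval u ^ k) * (E.Q (s - 1/2) (\<iota> u) * F.Q (t + 1/2) u powi \<epsilon>))" for s t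
    unfolding lambda_factor_def if_not_P[OF False] using u by (simp add: abs E.Q_unit F.Q_unit incl_unit)
  then show ?thesis
    using u(1) abs by (intro exI[of _ u]) (auto simp: int_units_def)
qed

text \<open>Self-similarity is used twice. Dilation reduces a ball to the shell between two balls;
  outside the cone K is harmless on that shell, and inside the cone T reduces it to a shell away
  from F. The two inequalities make the two geometric ratios less than 1.\<close>

lemma integrable_K:
  assumes conv: "0 < Re (2 * \<sigma> + \<tau> + 1)" "0 < Re (2 * \<sigma> - \<tau> + 2)"
    and \<phi>: "\<phi> \<in> test_functions UNIV"
  shows "integrable dx (\<lambda>x. K \<sigma> \<tau> x * \<phi> x)"
proof -
  define h where "h x = norm (K \<sigma> \<tau> x)" for x
  have h [measurable]: "h \<in> borel_measurable borel"
    unfolding h_def by measurable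
  have h0: "0 \<le> h x" for x
    by (simp add: h_def)
  have L: "0 < ln (qcard TYPE('f))"
    using qcard_gt_1[where 'a='f] by simp
  have pi: "\<pi>F \<noteq> 0" "0 < absval \<pi>F" "absval \<pi>F < 1"
    using uniformizerF absval_pi_less_1 by auto
  obtain n where n: "{x. \<phi> x \<noteq> 0} \<subseteq> vball 0 n"
    using bounded_in_vball compact_imp_bounded[OF test_functionsD(2)[OF \<phi>]] by blast
  define W where "W = vball (0::'e) n"
  define r where "r = qcard TYPE('e) powi (- n)"
  have W: "x \<in> W \<longleftrightarrow> absval x \<le> r" for x
    by (simp add: W_def r_def vball_def)
  have Wb [measurable]: "W \<in> sets borel"
    by (simp add: W_def)
  \<comment> \<open>For the indicator of a ball the regularizations are indicators of shells, so the
    results on \<open>good\<close> functions make the shell integrals finite.\<close>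
  define \<phi>0 :: "'e \<Rightarrow> complex" where "\<phi>0 x = (if x \<in> W then 1 else 0)" for x
  have \<phi>0: "\<phi>0 \<in> test_functions UNIV"
  proof (rule test_functionsI)
    show "compact W"
      by (simp add: W_def)
    show "\<forall>\<^sub>F y in nhds x. \<phi>0 y = \<phi>0 x" for x
    proof (cases "x \<in> W")
      case True
      then show ?thesis
        by (intro eventually_mono[OF eventually_nhds_in_open[of W x]]) (auto simp: W_def \<phi>0_def)
    next
      case False
      have "open (- W)"
        unfolding W_def by (rule open_Compl) simp
      then show ?thesis
        using False by (intro eventually_mono[OF eventually_nhds_in_open[of "- W" x]]) (auto simp: \<phi>0_def)
    qed
  qed (simp add: \<phi>0_def split: if_splits)

  \<comment> \<open>S1 and S2 invert the contractions by \<open>\<pi>F\<close>, so their orbits move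
    outwards.\<close>
  define S1 where "S1 x = inverse (\<iota> \<pi>F) * x" for x
  define S2 where "S2 = T (inverse \<pi>F)"
  have abs_S1: "absval (S1 x) = absval x / absval \<pi>F ^ 2" for x
    by (simp add: S1_def absval_mult absval_inverse absval_incl divide_inverse mult.commute)
  have S1W: "x \<in> W" if "S1 x \<in> W" for x
  proof -
    have "absval \<pi>F ^ 2 \<le> 1"
      using pi by (simp add: power_le_one)
    then have "absval (S1 x) * absval \<pi>F ^ 2 \<le> absval (S1 x)"
      by (simp add: mult_left_le)
    moreover have "absval (S1 x) * absval \<pi>F ^ 2 = absval x"
      using pi by (simp add: abs_S1)
    ultimately show ?thesis
      using that by (simp add: W)
  qed
  \<comment> \<open>The part inside the cone of the shell between W and its image under dilation by
    \<open>\<pi>F\<close>.\<close>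
  define W2 where "W2 = {x. x \<in> R \<and> x \<in> W \<and> S1 x \<notin> W}"
  have reg0: "reg0 \<pi>F \<phi>0 x = (if x \<in> W \<and> S1 x \<notin> W then 1 else 0)" for x
    using S1W[of x] by (auto simp: reg0_def \<phi>0_def S1_def)
  have nearF: "nearF \<pi>F \<phi>0 x = (if x \<in> W2 then 1 else 0)" for x
    by (auto simp: nearF_def reg0 W2_def)
  have W2b [measurable]: "W2 \<in> sets borel"
  proof -
    have "W2 = {x. nearF \<pi>F \<phi>0 x \<noteq> 0}"
      by (auto simp: nearF)
    then show ?thesis
      using test_functionsD(2)[OF nearF_test[OF pi(1) \<phi>0]] by (simp add: borel_closed compact_imp_closed)
  qed
  have S2R: "x = T \<pi>F (S2 x)" for x
    using pi(1) by (simp add: S2_def T_T)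
  have S2W: "x \<in> W2" if x: "S2 x \<in> W2" for x
  proof -
    have y: "S2 x \<in> R" "S2 x \<in> W" "S1 (S2 x) \<notin> W"
      using x by (auto simp: W2_def)
    have "x \<in> R"
      using S2R[of x] T_R[OF y(1), of \<pi>F] pi by simp
    moreover have "absval x = absval (S2 x)"
      using S2R[of x] absval_T[OF y(1), of \<pi>F] pi by simp
    ultimately show ?thesis
      using y by (simp add: W2_def W abs_S1)
  qed

  have fin2: "(\<integral>\<^sup>+x. ennreal (h x) * indicator W2 x \<partial>dx) < \<infinity>"
  proof (rule nn_integral_selfsimilar_finite[OF h h0, where S = S2 and k = "absval (inverse \<pi>F)"
        and \<rho> = "norm (E.Q \<sigma> (\<iota> \<pi>F) * F.Q \<tau> \<pi>F)"])
    show "has_modulus S2 (absval (inverse \<pi>F))"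
      unfolding S2_def using pi(1) by (intro has_modulus_T haar_axioms) simp
    show "h x = norm (E.Q \<sigma> (\<iota> \<pi>F) * F.Q \<tau> \<pi>F) * h (S2 x)" if "S2 x \<in> W2" for x
    proof -
      have "K \<sigma> \<tau> x = E.Q \<sigma> (\<iota> \<pi>F) * F.Q \<tau> \<pi>F * K \<sigma> \<tau> (S2 x)"
        using K_T[of "S2 x" \<pi>F \<sigma> \<tau>] that pi S2R[of x] by (simp add: W2_def)
      then show ?thesis
        by (simp add: h_def norm_mult)
    qed
    \<comment> \<open>In the exponent 2 \<sigma> + \<tau> + 1 the last term is due to the modulus of
      S2.\<close>
    show "norm (E.Q \<sigma> (\<iota> \<pi>F) * F.Q \<tau> \<pi>F) / absval (inverse \<pi>F) < 1"
    proof -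
      have "norm (E.Q \<sigma> (\<iota> \<pi>F) * F.Q \<tau> \<pi>F) / absval (inverse \<pi>F) =
          exp (- (2 * Re \<sigma> * ln (qcard TYPE('f)))) * exp (- (Re \<tau> * ln (qcard TYPE('f)))) * exp (- ln (qcard TYPE('f)))"
        by (simp add: E_Q_pi F_Q_pi norm_mult absval_inverse divide_inverse del: exp_minus) (simp add: absval_pi)
      also have "\<dots> = exp (- (2 * Re \<sigma> * ln (qcard TYPE('f))) + - (Re \<tau> * ln (qcard TYPE('f))) + - ln (qcard TYPE('f)))"
        by (simp only: exp_add)
      also have "\<dots> = exp (- (Re (2 * \<sigma> + \<tau> + 1) * ln (qcard TYPE('f))))"
        by (rule arg_cong[where f = exp]) (simp add: algebra_simps)
      finally have "norm (E.Q \<sigma> (\<iota> \<pi>F) * F.Q \<tau> \<pi>F) / absval (inverse \<pi>F) = exp (- (Re (2 * \<sigma> + \<tau> + 1) * ln (qcard TYPE('f))))" .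
      then show ?thesis
        using conv(1) L by simp
    qed
    \<comment> \<open>Expansion of the second coordinate leaves the cone unless that coordinate is
      0, that is, unless x lies on F, where K is 0.\<close>
    show "h x = 0" if x: "\<And>n. (S2 ^^ n) x \<in> W2" for x
    proof -
      have S2n: "(S2 ^^ n) x = T (inverse \<pi>F ^ n) x" for n
        by (induction n) (simp_all add: S2_def T_T)
      have "absval (inverse \<pi>F) ^ n * absval (c2 x) \<le> qcard TYPE('f) powi (- int m) * absval (c1 x)" for n
        using x[of n] by (simp add: S2n W2_def R_def absval_mult absval_power)
      then have "absval (c2 x) = 0"
        using pi by (intro unbounded_powers[of "absval (inverse \<pi>F)"])
          (auto simp: absval_inverse one_less_inverse_iff)
      then show ?thesis
        using c2_eq_0_iff[of x] K_eq_0[of x] by (simp add: h_def)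
    qed
    \<comment> \<open>By \<open>S2W\<close> the difference of indicators that forms
      \<open>regF\<close> is the indicator of exactly this shell.\<close>
    have "(\<integral>\<^sup>+x. ennreal (h x) * indicator {x. x \<in> W2 \<and> S2 x \<notin> W2} x \<partial>dx) =
        (\<integral>\<^sup>+x. ennreal (norm (K \<sigma> \<tau> x * regF \<pi>F \<pi>F \<phi>0 x)) \<partial>dx)"
      using S2W by (intro nn_integral_cong)
        (auto simp: regF_def nearF h_def indicator_def simp flip: S2_def)
    also have "\<dots> < \<infinity>"
      using integrable_good[OF regF_good[OF pi(1) pi(1) \<phi>0]] unfolding integrable_iff_bounded by blast
    finally show "(\<integral>\<^sup>+x. ennreal (h x) * indicator {x. x \<in> W2 \<and> S2 x \<notin> W2} x \<partial>dx) < \<infinity>" .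
  qed (use S2W in auto)

  have fin1: "(\<integral>\<^sup>+x. ennreal (h x) * indicator W x \<partial>dx) < \<infinity>"
  proof (rule nn_integral_selfsimilar_finite[OF h h0, where S = S1 and k = "absval (inverse (\<iota> \<pi>F))"
        and \<rho> = "norm (E.Q \<sigma> (\<iota> \<pi>F) / F.Q \<tau> \<pi>F)"])
    show "has_modulus S1 (absval (inverse (\<iota> \<pi>F)))"
      unfolding S1_def using pi(1) by (intro has_modulus_mult) simp
    show "h x = norm (E.Q \<sigma> (\<iota> \<pi>F) / F.Q \<tau> \<pi>F) * h (S1 x)" for x
    proof -
      have "\<iota> \<pi>F * S1 x = x"
        using pi(1) by (simp add: S1_def flip: mult.assoc)
      then have "K \<sigma> \<tau> x = E.Q \<sigma> (\<iota> \<pi>F) / F.Q \<tau> \<pi>F * K \<sigma> \<tau> (S1 x)"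
        using K_scale[OF pi(1), of \<sigma> \<tau> "S1 x"] by simp
      then show ?thesis
        by (simp add: h_def norm_mult norm_divide)
    qed
    \<comment> \<open>Here the modulus of dilation contributes 2 to the exponent, and eta enters
      inversely.\<close>
    show "norm (E.Q \<sigma> (\<iota> \<pi>F) / F.Q \<tau> \<pi>F) / absval (inverse (\<iota> \<pi>F)) < 1"
    proof -
      have "norm (E.Q \<sigma> (\<iota> \<pi>F) / F.Q \<tau> \<pi>F) / absval (inverse (\<iota> \<pi>F)) =
          exp (- (2 * Re \<sigma> * ln (qcard TYPE('f)))) / exp (- (Re \<tau> * ln (qcard TYPE('f)))) * absval \<pi>F ^ 2"
        by (simp add: E_Q_pi F_Q_pi norm_mult norm_inverse absval_inverse absval_incl divide_inverse)
      also have "\<dots> = exp (- (2 * Re \<sigma> * ln (qcard TYPE('f))) - - (Re \<tau> * ln (qcard TYPE('f))) + - ln (qcard TYPE('f)) + - ln (qcard TYPE('f)))"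
        by (simp only: exp_add exp_diff absval_pi power2_eq_square mult.assoc)
      also have "\<dots> = exp (- (Re (2 * \<sigma> - \<tau> + 2) * ln (qcard TYPE('f))))"
        by (rule arg_cong[where f = exp]) (simp add: algebra_simps)
      finally have "norm (E.Q \<sigma> (\<iota> \<pi>F) / F.Q \<tau> \<pi>F) / absval (inverse (\<iota> \<pi>F)) =
          exp (- (Re (2 * \<sigma> - \<tau> + 2) * ln (qcard TYPE('f))))" .
      then show ?thesis
        using conv(2) L by simp
    qed
    show "h x = 0" if x: "\<And>n. (S1 ^^ n) x \<in> W" for x
    proof -
      have S1n: "absval ((S1 ^^ n) x) = absval (inverse (\<iota> \<pi>F)) ^ n * absval x" for n
        by (induction n) (simp_all add: S1_def absval_mult)
      have "absval (inverse (\<iota> \<pi>F)) ^ n * absval x \<le> r" for n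
        using x[of n] by (simp add: S1n W)
      moreover have "1 < absval (inverse (\<iota> \<pi>F))"
        using pi by (simp add: absval_inverse absval_incl one_less_inverse_iff power_less_one_iff)
      ultimately have "absval x = 0"
        by (intro unbounded_powers[of "absval (inverse (\<iota> \<pi>F))"]) auto
      then show ?thesis
        using K_eq_0[of 0] rangeI[of \<iota> 0] by (simp add: h_def)
    qed
    let ?o = "\<lambda>x. K \<sigma> \<tau> x * off \<pi>F \<phi>0 x"
    have o: "integrable dx ?o"
      by (rule integrable_good[OF off_good[OF pi(1) \<phi>0]])
    then have [measurable]: "?o \<in> borel_measurable dx"
      by (rule borel_measurable_integrable)
    \<comment> \<open>The shell splits into W2, settled by \<open>fin2\<close>, and the part outside
      the cone, on which \<open>off\<close> equals 1.\<close>
    have "(\<integral>\<^sup>+x. ennreal (h x) * indicator {x. x \<in> W \<and> S1 x \<notin> W} x \<partial>dx) \<le>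
        (\<integral>\<^sup>+x. ennreal (h x) * indicator W2 x + ennreal (norm (?o x)) \<partial>dx)"
      by (intro nn_integral_mono) (auto simp: off_def nearF reg0 h_def indicator_def W2_def)
    also have "\<dots> = (\<integral>\<^sup>+x. ennreal (h x) * indicator W2 x \<partial>dx) + (\<integral>\<^sup>+x. ennreal (norm (?o x)) \<partial>dx)"
      by (intro nn_integral_add) auto
    also have "\<dots> < \<infinity>"
      using fin2 o unfolding integrable_iff_bounded by simp
    finally show "(\<integral>\<^sup>+x. ennreal (h x) * indicator {x. x \<in> W \<and> S1 x \<notin> W} x \<partial>dx) < \<infinity>" .
  qed (use S1W in auto)

  obtain B where B: "\<And>x. norm (\<phi> x) \<le> B" "0 \<le> B"
  proof -
    have "finite (\<phi> ` {x. \<phi> x \<noteq> 0})"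
      using \<phi> test_functionsD by (intro finite_image_locally_constant) blast+
    then obtain B where B: "\<And>x. \<phi> x \<noteq> 0 \<Longrightarrow> norm (\<phi> x) \<le> B"
      using finite_imp_bounded by (force simp: bounded_iff)
    have "norm (\<phi> x) \<le> max 0 B" for x
      using B[of x] by (cases "\<phi> x = 0") auto
    then show ?thesis
      using that[of "max 0 B"] by simp
  qed
  have [measurable]: "\<phi> \<in> borel_measurable borel"
    by (rule test_functions_borel[OF \<phi>])
  show ?thesis
  proof (rule integrableI_bounded)
    have "(\<integral>\<^sup>+x. ennreal (norm (K \<sigma> \<tau> x * \<phi> x)) \<partial>dx) \<le> (\<integral>\<^sup>+x. ennreal B * (ennreal (h x) * indicator W x) \<partial>dx)"
    proof (rule nn_integral_mono)
      fix x
      show "ennreal (norm (K \<sigma> \<tau> x * \<phi> x)) \<le> ennreal B * (ennreal (h x) * indicator W x)"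
      proof (cases "\<phi> x = 0")
        case False
        then have "x \<in> W"
          using n by (auto simp: W_def)
        moreover have "norm (K \<sigma> \<tau> x * \<phi> x) \<le> B * h x"
          using B(1)[of x] by (simp add: norm_mult h_def mult.commute mult_right_mono)
        ultimately show ?thesis
          using B(2) h0 by (simp flip: ennreal_mult)
      qed simp
    qed
    also have "\<dots> = ennreal B * (\<integral>\<^sup>+x. ennreal (h x) * indicator W x \<partial>dx)"
      by (intro nn_integral_cmult) auto
    also have "\<dots> < \<infinity>"
      using fin1 by (simp add: ennreal_mult_less_top)
    finally show "(\<integral>\<^sup>+x. ennreal (norm (K \<sigma> \<tau> x * \<phi> x)) \<partial>dx) < \<infinity>" .
  qed auto
qed

end

section \<open>Equivariance\<close>

context kernel_setup
begin

text \<open>Substitution x = a y: the modulus contributes |a|_E and \<open>K_scale\<close> the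
  quasicharacters. It holds for all parameters, because a divergent integral is 0 on both
  sides.\<close>

lemma I_dilate:
  assumes a: "a \<noteq> 0" and \<phi>: "\<phi> \<in> test_functions UNIV"
  shows "I \<sigma> \<tau> (\<lambda>x. \<phi> (inverse (\<iota> a) * x)) = absval (\<iota> a) * (E.Q \<sigma> (\<iota> a) / F.Q \<tau> a) * I \<sigma> \<tau> \<phi>"
proof -
  have [measurable]: "\<phi> \<in> borel_measurable borel"
    by (rule test_functions_borel[OF \<phi>])
  define f where "f y = E.Q \<sigma> (\<iota> a) / F.Q \<tau> a * (K \<sigma> \<tau> y * \<phi> y)" for y
  have f: "f \<in> borel_measurable borel"
    unfolding f_def by measurable
  have "f (inverse (\<iota> a) * x) = K \<sigma> \<tau> x * \<phi> (inverse (\<iota> a) * x)" for x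
  proof -
    have "\<iota> a * (inverse (\<iota> a) * x) = x"
      using a by (simp flip: mult.assoc)
    then have "K \<sigma> \<tau> x = E.Q \<sigma> (\<iota> a) / F.Q \<tau> a * K \<sigma> \<tau> (inverse (\<iota> a) * x)"
      using K_scale[OF a, of \<sigma> \<tau> "inverse (\<iota> a) * x"] by (simp only:)
    then show ?thesis
      by (simp only: f_def mult.assoc)
  qed
  then have "I \<sigma> \<tau> (\<lambda>x. \<phi> (inverse (\<iota> a) * x)) = (\<integral>x. f (inverse (\<iota> a) * x) \<partial>dx)"
    by (simp add: I_def)
  also have "\<dots> = of_real (1 / absval (inverse (\<iota> a))) * (\<integral>x. f x \<partial>dx)"
    using a by (intro has_modulus_integral[OF has_modulus_mult f]) simp
  also have "\<dots> = absval (\<iota> a) * (E.Q \<sigma> (\<iota> a) / F.Q \<tau> a) * I \<sigma> \<tau> \<phi>"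
    unfolding f_def I_def integral_mult_right_zero by (simp add: absval_inverse divide_inverse)
  finally show ?thesis .
qed

text \<open>Substitution x = \<open>T c y\<close>; the condition on the support puts y in the cone,
  where \<open>K_T\<close> applies.\<close>

lemma I_T:
  assumes c: "c \<noteq> 0" "absval c \<le> 1" and \<psi>: "\<psi> \<in> test_functions UNIV" "\<And>x. \<psi> x \<noteq> 0 \<Longrightarrow> x \<in> R"
  shows "I \<sigma> \<tau> (\<lambda>x. \<psi> (T (inverse c) x)) = absval c * (E.Q \<sigma> (\<iota> c) * F.Q \<tau> c) * I \<sigma> \<tau> \<psi>"
proof -
  have [measurable]: "\<psi> \<in> borel_measurable borel"
    by (rule test_functions_borel[OF \<psi>(1)])
  define f where "f y = E.Q \<sigma> (\<iota> c) * F.Q \<tau> c * (K \<sigma> \<tau> y * \<psi> y)" for y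
  have f: "f \<in> borel_measurable borel"
    unfolding f_def by measurable
  have "f (T (inverse c) x) = K \<sigma> \<tau> x * \<psi> (T (inverse c) x)" for x
  proof (cases "\<psi> (T (inverse c) x) = 0")
    case False
    from K_T[OF \<psi>(2)[OF this] c, of \<sigma> \<tau>] show ?thesis
      by (simp add: f_def T_inverse(2)[OF c(1)])
  qed (simp add: f_def)
  then have "I \<sigma> \<tau> (\<lambda>x. \<psi> (T (inverse c) x)) = (\<integral>x. f (T (inverse c) x) \<partial>dx)"
    by (simp add: I_def)
  also have "\<dots> = of_real (1 / absval (inverse c)) * (\<integral>x. f x \<partial>dx)"
    using c by (intro has_modulus_integral[OF has_modulus_T f] haar_axioms) simp
  also have "\<dots> = absval c * (E.Q \<sigma> (\<iota> c) * F.Q \<tau> c) * I \<sigma> \<tau> \<psi>"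
    unfolding f_def I_def integral_mult_right_zero by (simp add: absval_inverse divide_inverse)
  finally show ?thesis .
qed

text \<open>Let k be the multiplier of \<open>T c\<close>. When all integrals converge,
  \<open>regF\<close> pairs to (1 - k) times \<open>nearF\<close>, and \<open>off\<close> to
  \<open>reg0\<close> minus \<open>nearF\<close>. The terms in \<open>nearF\<close> cancel, and
  dilation supplies the second factor.\<close>

lemma D_eq:
  assumes conv: "0 < Re (2 * \<sigma> + \<tau> + 1)" "0 < Re (2 * \<sigma> - \<tau> + 2)"
    and a: "a \<noteq> 0" and c: "c \<noteq> 0" "absval c \<le> 1" and \<phi>: "\<phi> \<in> test_functions UNIV"
  shows "D a c \<sigma> \<tau> \<phi> = (1 - absval c * (E.Q \<sigma> (\<iota> c) * F.Q \<tau> c)) *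
    ((1 - absval (\<iota> a) * (E.Q \<sigma> (\<iota> a) / F.Q \<tau> a)) * I \<sigma> \<tau> \<phi>)"
proof -
  note int = integrable_K[OF conv]
  have diff: "I \<sigma> \<tau> (\<lambda>x. f x - g x) = I \<sigma> \<tau> f - I \<sigma> \<tau> g"
    if "f \<in> test_functions UNIV" "g \<in> test_functions UNIV" for f g
    unfolding I_def using int that by (simp add: right_diff_distrib)
  note nF = nearF_test[OF a \<phi>] and r0 = reg0_test[OF a \<phi>]
  have 1: "I \<sigma> \<tau> (reg0 a \<phi>) = (1 - absval (\<iota> a) * (E.Q \<sigma> (\<iota> a) / F.Q \<tau> a)) * I \<sigma> \<tau> \<phi>"
    unfolding reg0_def diff[OF \<phi> dilate_test[OF a \<phi>]] I_dilate[OF a \<phi>] by (simp add: left_diff_distrib)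
  have 2: "I \<sigma> \<tau> (off a \<phi>) = I \<sigma> \<tau> (reg0 a \<phi>) - I \<sigma> \<tau> (nearF a \<phi>)"
    unfolding off_def by (rule diff[OF r0 nF])
  have "(\<lambda>x. nearF a \<phi> (T (inverse c) x)) \<in> test_functions UNIV"
    by (rule test_functions_compose[OF nF continuous_T continuous_T T_inverse(2)[OF c(1)]])
  then have "I \<sigma> \<tau> (regF a c \<phi>) = I \<sigma> \<tau> (nearF a \<phi>) - I \<sigma> \<tau> (\<lambda>x. nearF a \<phi> (T (inverse c) x))"
    unfolding regF_def by (rule diff[OF nF])
  also have "I \<sigma> \<tau> (\<lambda>x. nearF a \<phi> (T (inverse c) x)) =
      absval c * (E.Q \<sigma> (\<iota> c) * F.Q \<tau> c) * I \<sigma> \<tau> (nearF a \<phi>)"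
    by (rule I_T[OF c nF]) (auto simp: nearF_def split: if_splits)
  finally have 3: "I \<sigma> \<tau> (regF a c \<phi>) = (1 - absval c * (E.Q \<sigma> (\<iota> c) * F.Q \<tau> c)) * I \<sigma> \<tau> (nearF a \<phi>)"
    by (simp add: left_diff_distrib)
  show ?thesis
    unfolding D_def 2 3 1[symmetric] by (simp add: right_diff_distrib)
qed

lemma moebius_denominator_nonzero:
  assumes "b \<noteq> 0" "\<phi> \<in> test_functions (- {inverse (\<iota> b)})" "\<phi> z \<noteq> 0"
  shows "1 - \<iota> b * z \<noteq> 0"
proof
  assume "1 - \<iota> b * z = 0"
  then have "z = inverse (\<iota> b)"
    using assms(1) by (simp add: field_simps)
  then show False
    using test_functionsD(3)[OF assms(2)] assms(3) by auto
qed

lemma moebius_factor_test: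
  assumes "b \<noteq> 0" "\<phi> \<in> test_functions (- {inverse (\<iota> b)})"
  shows "(\<lambda>x. inverse (E.Q \<sigma> ((1 - \<iota> b * x) ^ 2)) * \<phi> x) \<in> test_functions UNIV"
proof (rule test_functions_times[OF test_functions_mono[OF assms(2)]])
  fix x assume "\<phi> x \<noteq> 0"
  then have "(1 - \<iota> b * x) ^ 2 \<noteq> 0"
    using moebius_denominator_nonzero[OF assms] by simp
  moreover have "((\<lambda>y. (1 - \<iota> b * y) ^ 2) \<longlongrightarrow> (1 - \<iota> b * x) ^ 2) (nhds x)"
    by (intro tendsto_intros filterlim_ident)
  ultimately have "\<forall>\<^sub>F y in nhds x. \<forall>s. E.Q s ((1 - \<iota> b * y) ^ 2) = E.Q s ((1 - \<iota> b * x) ^ 2)"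
    by (intro E.Q_locally_constant)
  then show "\<forall>\<^sub>F y in nhds x. inverse (E.Q \<sigma> ((1 - \<iota> b * y) ^ 2)) = inverse (E.Q \<sigma> ((1 - \<iota> b * x) ^ 2))"
    by eventually_elim simp
qed

text \<open>The function is supported in the image of the support of \<phi> under the inverse map
  z/(1 - b z), whose denominator has no zero there. The pole -1/b lies outside this compact set, and
  the weight \<open>inverse 0\<close> gives the value 0 at it.\<close>

lemma moebius_test:
  assumes b: "b \<noteq> 0" and \<phi>: "\<phi> \<in> test_functions (- {inverse (\<iota> b)})"
  shows "(\<lambda>x. inverse (complex_of_real (absval (1 + \<iota> b * x) ^ 2)) * \<phi> (x / (1 + \<iota> b * x)))
    \<in> test_functions UNIV" (is "?g \<in> _")
proof -
  let ?A = "{z. \<phi> z \<noteq> 0}"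
  have nz: "1 - \<iota> b * z \<noteq> 0" if "z \<in> ?A" for z
    using moebius_denominator_nonzero[OF b \<phi>] that by simp
  define C where "C = (\<lambda>z. z / (1 - \<iota> b * z)) ` ?A"
  have C: "compact C"
    unfolding C_def
  proof (rule compact_continuous_image[OF _ test_functionsD(2)[OF \<phi>]])
    show "continuous_on ?A (\<lambda>z. z / (1 - \<iota> b * z))"
      unfolding continuous_on_def using nz by (intro ballI tendsto_intros tendsto_ident_at) auto
  qed
  have zero: "?g x = 0" if "x \<notin> C" for x
  proof (rule ccontr)
    assume nz: "?g x \<noteq> 0"
    then have x: "1 + \<iota> b * x \<noteq> 0" "\<phi> (x / (1 + \<iota> b * x)) \<noteq> 0"
      by auto
    have "1 - \<iota> b * (x / (1 + \<iota> b * x)) = inverse (1 + \<iota> b * x)"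
      using x(1) by (simp add: field_simps)
    then have "x = (x / (1 + \<iota> b * x)) / (1 - \<iota> b * (x / (1 + \<iota> b * x)))"
      using x(1) by simp
    then have "x \<in> C"
      unfolding C_def using x(2) by (intro image_eqI[of _ _ "x / (1 + \<iota> b * x)"]) auto
    with that show False ..
  qed
  show ?thesis
  proof (rule test_functionsI[OF _ C])
    show "x \<in> C" if "?g x \<noteq> 0" for x
      using zero that by blast
    show "\<forall>\<^sub>F y in nhds x. ?g y = ?g x" for x
    proof (cases "x \<in> C")
      case False
      have "open (- C)"
        using C by (intro open_Compl compact_imp_closed)
      then have "\<forall>\<^sub>F y in nhds x. y \<in> - C"
        using False by (intro eventually_nhds_in_open) auto
      then show ?thesis
        unfolding zero[OF False] by (rule eventually_mono) (rule zero, simp)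
    next
      case True
      then obtain z where z: "\<phi> z \<noteq> 0" "x = z / (1 - \<iota> b * z)"
        by (auto simp: C_def)
      have "x * (1 - \<iota> b * z) = z"
        using z nz[of z] by simp
      moreover have "(1 + \<iota> b * x) * (1 - \<iota> b * z) = 1 - \<iota> b * z + \<iota> b * (x * (1 - \<iota> b * z))"
        by (simp add: algebra_simps)
      ultimately have "(1 + \<iota> b * x) * (1 - \<iota> b * z) = 1"
        by simp
      then have x: "1 + \<iota> b * x \<noteq> 0"
        by auto
      have id: "((\<lambda>y. y) \<longlongrightarrow> x) (nhds x)"
        by (rule filterlim_ident)
      have 1: "((\<lambda>y. 1 + \<iota> b * y) \<longlongrightarrow> 1 + \<iota> b * x) (nhds x)"
        by (intro tendsto_intros id)
      have "((\<lambda>y. y / (1 + \<iota> b * y)) \<longlongrightarrow> x / (1 + \<iota> b * x)) (nhds x)"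
        by (intro tendsto_intros id x)
      from eventually_compose_filterlim[OF test_functionsD(1)[OF \<phi>] this]
      have "\<forall>\<^sub>F y in nhds x. \<phi> (y / (1 + \<iota> b * y)) = \<phi> (x / (1 + \<iota> b * x))" .
      then show ?thesis
        using eventually_absval_eq[OF 1 x] by eventually_elim simp
    qed
  qed
qed

text \<open>For z = x/(1 + b x) one has 1 - b z = 1/(1 + b x), so the factor attached to \<phi> at z
  cancels the one from \<open>K_moebius\<close>. The remaining weight is the density of the change
  of variables.\<close>

lemma I_moebius:
  assumes b: "b \<noteq> 0" and \<phi>: "\<phi> \<in> test_functions (- {inverse (\<iota> b)})"
  shows "I \<sigma> \<tau> (\<lambda>x. inverse (complex_of_real (absval (1 + \<iota> b * x) ^ 2)) * \<phi> (x / (1 + \<iota> b * x)))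
    = I \<sigma> \<tau> (\<lambda>x. inverse (E.Q \<sigma> ((1 - \<iota> b * x) ^ 2)) * \<phi> x)"
proof -
  let ?g = "\<lambda>z. inverse (E.Q \<sigma> ((1 - \<iota> b * z) ^ 2)) * \<phi> z"
  have "?g \<in> test_functions UNIV"
    by (rule moebius_factor_test[OF b \<phi>])
  then have g [measurable]: "?g \<in> borel_measurable borel"
    by (rule test_functions_borel)
  have "K \<sigma> \<tau> x * (inverse (complex_of_real (absval (1 + \<iota> b * x) ^ 2)) * \<phi> (x / (1 + \<iota> b * x))) =
      of_real (inverse (absval (1 + \<iota> b * x) ^ 2)) * (K \<sigma> \<tau> (x / (1 + \<iota> b * x)) * ?g (x / (1 + \<iota> b * x)))" for x
  proof (cases "1 + \<iota> b * x = 0")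
    case False
    have "1 - \<iota> b * (x / (1 + \<iota> b * x)) = inverse (1 + \<iota> b * x)"
      using False by (simp add: field_simps)
    then have "inverse (E.Q \<sigma> ((1 - \<iota> b * (x / (1 + \<iota> b * x))) ^ 2)) = E.Q \<sigma> ((1 + \<iota> b * x) ^ 2)"
      by (simp add: E.Q_inverse power_inverse)
    then show ?thesis
      using E.Q_nonzero[of "(1 + \<iota> b * x) ^ 2" \<sigma>] False K_moebius[OF False, of \<sigma> \<tau>] by simp
  qed simp
  then have "I \<sigma> \<tau> (\<lambda>x. inverse (complex_of_real (absval (1 + \<iota> b * x) ^ 2)) * \<phi> (x / (1 + \<iota> b * x))) =
      (\<integral>x. of_real (inverse (absval (1 + \<iota> b * x) ^ 2)) *
        (K \<sigma> \<tau> (x / (1 + \<iota> b * x)) * ?g (x / (1 + \<iota> b * x))) \<partial>dx)"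
    unfolding I_def by (intro Bochner_Integration.integral_cong refl)
  also have "\<dots> = (\<integral>z. K \<sigma> \<tau> z * ?g z \<partial>dx)"
    using b by (intro integral_moebius[of "\<iota> b" "\<lambda>z. K \<sigma> \<tau> z * ?g z"]) simp_all
  finally show ?thesis
    by (simp only: I_def)
qed

lemma distributions_add:
  "u \<in> distributions \<Longrightarrow> \<phi> \<in> test_functions UNIV \<Longrightarrow> \<psi> \<in> test_functions UNIV \<Longrightarrow>
    u (\<lambda>x. \<phi> x + \<psi> x) = u \<phi> + u \<psi>"
  by (simp add: distributions_def)

lemma distributions_cmult:
  "u \<in> distributions \<Longrightarrow> \<phi> \<in> test_functions UNIV \<Longrightarrow> u (\<lambda>x. c * \<phi> x) = c * u \<phi>"
  by (simp add: distributions_def)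

lemma distributions_sum:
  assumes u: "u \<in> distributions" and f: "\<And>i. i \<in> P \<Longrightarrow> f i \<in> test_functions UNIV" and "finite P"
  shows "u (\<lambda>x. \<Sum>i\<in>P. c i * f i x) = (\<Sum>i\<in>P. c i * u (f i))"
  using assms(3) f
proof (induction P)
  case empty
  have "(\<lambda>x. 0) \<in> test_functions UNIV"
    by (simp add: test_functions_iff)
  from distributions_cmult[OF u this, of 0] show ?case
    by simp
next
  case (insert i P)
  have t: "f i \<in> test_functions UNIV" "(\<lambda>x. c i * f i x) \<in> test_functions UNIV"
    "(\<lambda>x. \<Sum>i\<in>P. c i * f i x) \<in> test_functions UNIV"
    using insert.prems by (auto intro!: test_functions_cmult test_functions_sum)
  have "u (\<lambda>x. \<Sum>i\<in>P. c i * f i x) = (\<Sum>i\<in>P. c i * u (f i))"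
    using insert.IH insert.prems by blast
  then show ?case
    using distributions_add[OF u t(2,3)] distributions_cmult[OF u t(1), of "c i"] insert.hyps by simp
qed

text \<open>The test function itself varies with s. On the support of \<phi> the quantity |1 - b x|
  takes finitely many values, so it is a finite combination of fixed test functions with
  coefficients exponential in s, and linearity of u applies.\<close>

lemma holomorphic2_moebius_factor:
  fixes u :: "complex \<Rightarrow> complex \<Rightarrow> ('e \<Rightarrow> complex) \<Rightarrow> complex"
  assumes u: "\<And>s t. u s t \<in> distributions"
    and hol: "\<And>\<psi>. \<psi> \<in> test_functions UNIV \<Longrightarrow> holomorphic2 (\<lambda>(s, t). u s t \<psi>)"
    and b: "b \<noteq> 0" and \<phi>: "\<phi> \<in> test_functions (- {inverse (\<iota> b)})"
  shows "holomorphic2 (\<lambda>(s, t). u s t (\<lambda>x. inverse (E.Q (s - 1/2) ((1 - \<iota> b * x) ^ 2)) * \<phi> x))"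
proof -
  define l where "l x = ln (absval ((1 - \<iota> b * x) ^ 2))" for x
  define P where "P = l ` {x. \<phi> x \<noteq> 0}"
  have l: "\<forall>\<^sub>F y in nhds x. l y = l x" if "\<phi> x \<noteq> 0" for x
  proof -
    have "(1 - \<iota> b * x) ^ 2 \<noteq> 0"
      using moebius_denominator_nonzero[OF b \<phi> that] by simp
    moreover have "((\<lambda>y. (1 - \<iota> b * y) ^ 2) \<longlongrightarrow> (1 - \<iota> b * x) ^ 2) (nhds x)"
      by (intro tendsto_intros filterlim_ident)
    ultimately have "\<forall>\<^sub>F y in nhds x. absval ((1 - \<iota> b * y) ^ 2) = absval ((1 - \<iota> b * x) ^ 2)"
      by (intro eventually_absval_eq)
    then show ?thesis
      by eventually_elim (simp add: l_def)
  qed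
  have P: "finite P"
    unfolding P_def using l by (intro finite_image_locally_constant test_functionsD(2)[OF \<phi>]) auto
  define f where "f p x = (if l x = p then 1 else 0) * (inverse (E.Q 0 ((1 - \<iota> b * x) ^ 2)) * \<phi> x)" for p x
  have f: "f p \<in> test_functions UNIV" for p
    unfolding f_def
  proof (rule test_functions_times[OF moebius_factor_test[OF b \<phi>]])
    fix x assume "inverse (E.Q 0 ((1 - \<iota> b * x) ^ 2)) * \<phi> x \<noteq> 0"
    then have "\<phi> x \<noteq> 0" by auto
    from l[OF this] show "\<forall>\<^sub>F y in nhds x. (if l y = p then 1 else 0) = (if l x = p then 1 else 0 :: complex)"
      by (rule eventually_mono) simp
  qed
  have "inverse (E.Q (s - 1/2) ((1 - \<iota> b * x) ^ 2)) * \<phi> x = (\<Sum>p\<in>P. exp (- (s - 1/2) * of_real p) * f p x)" for s x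
  proof (cases "\<phi> x = 0")
    case False
    then have "(1 - \<iota> b * x) ^ 2 \<noteq> 0"
      using moebius_denominator_nonzero[OF b \<phi>] by simp
    then have Q: "E.Q (s - 1/2) ((1 - \<iota> b * x) ^ 2) = E.Q 0 ((1 - \<iota> b * x) ^ 2) * exp ((s - 1/2) * of_real (l x))"
      unfolding l_def by (rule E.Q_exp)
    have "(\<Sum>p\<in>P. exp (- (s - 1/2) * of_real p) * f p x) = (\<Sum>p\<in>P. if p = l x then
        exp (- (s - 1/2) * of_real p) * (inverse (E.Q 0 ((1 - \<iota> b * x) ^ 2)) * \<phi> x) else 0)"
      by (intro sum.cong) (auto simp: f_def)
    also have "\<dots> = exp (- (s - 1/2) * of_real (l x)) * (inverse (E.Q 0 ((1 - \<iota> b * x) ^ 2)) * \<phi> x)"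
      using P False by (simp add: P_def)
    also have "\<dots> = inverse (E.Q (s - 1/2) ((1 - \<iota> b * x) ^ 2)) * \<phi> x"
      unfolding Q inverse_mult_distrib mult_minus_left exp_minus by (simp only: mult_ac)
    finally show ?thesis ..
  qed (simp add: f_def)
  then have "u s t (\<lambda>x. inverse (E.Q (s - 1/2) ((1 - \<iota> b * x) ^ 2)) * \<phi> x) =
      (\<Sum>p\<in>P. exp (- (s - 1/2) * of_real p) * u s t (f p))" for s t
    using distributions_sum[OF u f P, of s t "\<lambda>p. exp (- (s - 1/2) * of_real p)"] by simp
  moreover have "exp (- (s - 1/2) * of_real p) = exp (of_real p / 2) * exp (s * of_real (- p) + t * 0)"
    for s t :: complex and p :: real
    unfolding exp_add[symmetric] by (rule arg_cong[where f = exp]) (simp add: field_simps)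
  ultimately have eq: "(\<lambda>(s, t). u s t (\<lambda>x. inverse (E.Q (s - 1/2) ((1 - \<iota> b * x) ^ 2)) * \<phi> x)) =
      (\<lambda>z. \<Sum>p\<in>P. exp (of_real p / 2) * exp (fst z * of_real (- p) + snd z * 0) * (\<lambda>(s, t). u s t (f p)) z)"
    by (simp add: fun_eq_iff split: prod.split)
  show ?thesis
    unfolding eq by (intro holomorphic2_sum holomorphic2_mult holomorphic2_const holomorphic2_exp hol f)
qed

section \<open>The continuation and its equivariance\<close>

theorem normalized_kernel_continuation:
  "\<exists>Kt :: complex \<Rightarrow> complex \<Rightarrow> ('e \<Rightarrow> complex) \<Rightarrow> complex.
    (\<forall>s t. Kt s t \<in> distributions) \<and>
    (\<forall>s t. 0 < Re (2 * s + t + 1/2) \<and> 0 < Re (2 * s - t + 1/2) \<longrightarrow>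
       (\<forall>\<phi>\<in>test_functions UNIV.
          Kt s t \<phi> = fun_distribution dx (normalized_kernel \<iota> \<alpha> \<pi>E \<pi>F chi eta s t) \<phi>)) \<and>
    (\<forall>\<phi>\<in>test_functions UNIV. holomorphic2 (\<lambda>(s, t). Kt s t \<phi>)) \<and>
    (\<forall>s t. Kt s t \<in> equivariant_distributions \<iota> \<pi>E \<pi>F chi eta s t)"
proof -
  have p: "z powi 1 = z" "z powi - 1 = inverse z" for z :: complex
    by (simp_all add: power_int_def)
  obtain c \<gamma>1 where c: "c \<noteq> 0" "absval c \<le> 1" and c': "\<forall>s t. lambda_factor 1 \<iota> chi eta s t =
      \<gamma>1 * (1 - of_real (absval c ^ 1) * (E.Q (s - 1/2) (\<iota> c) * F.Q (t + 1/2) c powi 1))"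
    using lambda_factor_scaling[OF disjI1[OF conjI[OF refl refl]]] by blast
  obtain a \<gamma>2 where a: "a \<noteq> 0" and a': "\<forall>s t. lambda_factor (- 1) \<iota> chi eta s t =
      \<gamma>2 * (1 - of_real (absval a ^ 2) * (E.Q (s - 1/2) (\<iota> a) * F.Q (t + 1/2) a powi - 1))"
    using lambda_factor_scaling[OF disjI2[OF conjI[OF refl refl]]] by blast
  have lf1: "lambda_factor 1 \<iota> chi eta s t = \<gamma>1 * (1 - absval c * (E.Q (s - 1/2) (\<iota> c) * F.Q (t + 1/2) c))" for s t
    by (simp only: c' p power_one_right)
  have lf2: "lambda_factor (- 1) \<iota> chi eta s t = \<gamma>2 * (1 - absval (\<iota> a) * (E.Q (s - 1/2) (\<iota> a) / F.Q (t + 1/2) a))" for s t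
    by (simp only: a' p absval_incl divide_inverse)
  \<comment> \<open>The constants \<gamma>1 and \<gamma>2 convert the multipliers in D into the
    inverse L-factors, also where these are 1.\<close>
  define Kt where "Kt s t \<phi> = \<gamma>1 * \<gamma>2 * D a c (s - 1/2) (t + 1/2) \<phi>" for s t \<phi>
  define lam where "lam s t = lambda_factor 1 \<iota> chi eta s t * lambda_factor (- 1) \<iota> chi eta s t" for s t
  have distr: "Kt s t \<in> distributions" for s t
    using a c(1) by (auto simp: distributions_def Kt_def D_add D_cmult algebra_simps)
  have hol: "holomorphic2 (\<lambda>(s, t). Kt s t \<phi>)" if "\<phi> \<in> test_functions UNIV" for \<phi>
    using holomorphic2_cmult[OF holomorphic2_D[OF a c(1) that], of "\<gamma>1 * \<gamma>2"]
    by (simp add: Kt_def case_prod_unfold)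
  have conv: "Kt s t \<phi> = lam s t * I (s - 1/2) (t + 1/2) \<phi>"
    if "0 < Re (2 * s + t + 1/2)" "0 < Re (2 * s - t + 1/2)" "\<phi> \<in> test_functions UNIV" for s t \<phi>
  proof -
    \<comment> \<open>The shifted expressions are 2s + t + 1/2 and 2s - t + 1/2 again.\<close>
    have "0 < Re (2 * (s - 1/2) + (t + 1/2) + 1)" "0 < Re (2 * (s - 1/2) - (t + 1/2) + 2)"
      using that by simp_all
    from D_eq[OF this a c(1,2) that(3)] show ?thesis
      by (simp add: Kt_def lam_def lf1 lf2)
  qed
  have 1: "Kt s t \<phi> = fun_distribution dx (normalized_kernel \<iota> \<alpha> \<pi>E \<pi>F chi eta s t) \<phi>"
    if "0 < Re (2 * s + t + 1/2)" "0 < Re (2 * s - t + 1/2)" "\<phi> \<in> test_functions UNIV" for s t \<phi>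
  proof -
    have "normalized_kernel \<iota> \<alpha> \<pi>E \<pi>F chi eta s t x * \<phi> x = lam s t * (K (s - 1/2) (t + 1/2) x * \<phi> x)" for x
      by (simp add: normalized_kernel_def lam_def kernel_eq)
    then show ?thesis
      unfolding conv[OF that] fun_distribution_def I_def by (simp only: integral_mult_right_zero)
  qed
  have 2: "distr_dilate (\<iota> d) (Kt s t) \<phi> =
      quasichar \<pi>E chi (s - 1/2) (\<iota> d) * inverse (quasichar \<pi>F eta (t + 1/2) d) * Kt s t \<phi>"
    if d: "d \<noteq> 0" and \<phi>: "\<phi> \<in> test_functions UNIV" for d s t \<phi>
  proof -
    let ?e = "complex_of_real (ln (absval (\<iota> d)))" and ?f = "complex_of_real (ln (absval d))"
    let ?\<psi> = "\<lambda>x. \<phi> (inverse (\<iota> d) * x)"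
    let ?g = "\<lambda>(s, t). inverse (complex_of_real (absval (\<iota> d))) * Kt s t ?\<psi> -
      E.Q (s - 1/2) (\<iota> d) * inverse (F.Q (t + 1/2) d) * Kt s t \<phi>"
    have \<psi>: "?\<psi> \<in> test_functions UNIV"
      by (rule dilate_test[OF d \<phi>])
    have Q: "E.Q (s - 1/2) (\<iota> d) * inverse (F.Q (t + 1/2) d) =
        E.Q 0 (\<iota> d) * inverse (F.Q 0 d) * exp (- ?e / 2 - ?f / 2) * exp (s * ?e + t * (- ?f))" for s t
    proof -
      have "E.Q (s - 1/2) (\<iota> d) * inverse (F.Q (t + 1/2) d) = E.Q 0 (\<iota> d) * inverse (F.Q 0 d) *
          (exp ((s - 1/2) * ?e) * exp (- ((t + 1/2) * ?f)))"
        using d E.Q_exp[of "\<iota> d" "s - 1/2"] F.Q_exp[of d "t + 1/2"] by (simp add: exp_minus)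
      also have "exp ((s - 1/2) * ?e) * exp (- ((t + 1/2) * ?f)) = exp (- ?e / 2 - ?f / 2) * exp (s * ?e + t * (- ?f))"
        unfolding exp_add[symmetric] by (rule arg_cong[where f = exp]) (simp add: field_simps)
      finally show ?thesis by (simp only: mult.assoc)
    qed
    have eq: "?g = (\<lambda>z. inverse (complex_of_real (absval (\<iota> d))) * (\<lambda>(s, t). Kt s t ?\<psi>) z -
        E.Q 0 (\<iota> d) * inverse (F.Q 0 d) * exp (- ?e / 2 - ?f / 2) * exp (fst z * ?e + snd z * (- ?f)) *
        (\<lambda>(s, t). Kt s t \<phi>) z)"
      by (simp only: Q case_prod_unfold)
    \<comment> \<open>The difference of the two sides vanishes in the range of convergence by
      \<open>I_dilate\<close>; holomorphy carries this to all (s, t).\<close>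
    have "holomorphic2 ?g"
      unfolding eq by (intro holomorphic2_diff holomorphic2_mult holomorphic2_const holomorphic2_exp hol \<phi> \<psi>)
    then have "?g (s, t) = 0"
    proof (rule holomorphic2_eq_0)
      fix s t assume st: "0 < Re (2 * s + t + 1/2)" "0 < Re (2 * s - t + 1/2)"
      show "?g (s, t) = 0"
        using d by (simp add: conv[OF st \<phi>] conv[OF st \<psi>] I_dilate[OF d \<phi>]
            divide_inverse[of "E.Q (s - 1/2) (\<iota> d)"])
    qed
    then show ?thesis
      by (simp add: distr_dilate_def)
  qed
  have 3: "distr_moebius (\<iota> b) (Kt s t) \<phi> =
      distr_times (\<lambda>x. inverse (quasichar \<pi>E chi (s - 1/2) ((1 - \<iota> b * x) ^ 2))) (Kt s t) \<phi>"
    if b: "b \<noteq> 0" and \<phi>: "\<phi> \<in> test_functions (- {inverse (\<iota> b)})" for b s t \<phi>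
  proof -
    let ?\<psi> = "\<lambda>x. inverse (complex_of_real (absval (1 + \<iota> b * x) ^ 2)) * \<phi> (x / (1 + \<iota> b * x))"
    let ?\<phi> = "\<lambda>s x. inverse (E.Q (s - 1/2) ((1 - \<iota> b * x) ^ 2)) * \<phi> x"
    let ?g = "\<lambda>z. (\<lambda>(s, t). Kt s t ?\<psi>) z - (\<lambda>(s, t). Kt s t (?\<phi> s)) z"
    have \<psi>: "?\<psi> \<in> test_functions UNIV"
      by (rule moebius_test[OF b \<phi>])
    \<comment> \<open>The second test function depends on s, so \<open>hol\<close> has to be
      combined with \<open>holomorphic2_moebius_factor\<close>.\<close>
    have "holomorphic2 ?g"
      by (rule holomorphic2_diff[OF hol[OF \<psi>] holomorphic2_moebius_factor[OF distr hol b \<phi>]])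
    then have "?g (s, t) = 0"
    proof (rule holomorphic2_eq_0)
      fix s t assume st: "0 < Re (2 * s + t + 1/2)" "0 < Re (2 * s - t + 1/2)"
      show "?g (s, t) = 0"
        by (simp only: case_prod_conv conv[OF st \<psi>] conv[OF st moebius_factor_test[OF b \<phi>]]
            I_moebius[OF b \<phi>] diff_self)
    qed
    then show ?thesis
      by (simp only: case_prod_conv distr_moebius_def distr_times_def of_real_power right_minus_eq)
  qed
  show ?thesis
  proof (intro exI[of _ Kt] conjI allI impI ballI)
    show "Kt s t \<in> equivariant_distributions \<iota> \<pi>E \<pi>F chi eta s t" for s t
      unfolding equivariant_distributions_def using distr 2 3 by blast
  qed (use distr hol 1 in auto)
qed

end

theorem theorem3p10:
  fixes \<iota> :: "'f::nonarch_local_field \<Rightarrow> 'e::nonarch_local_field"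
    and \<alpha> \<pi>E :: 'e and \<pi>F :: 'f and dx :: "'e measure"
    and chi :: "'e \<Rightarrow> complex" and eta :: "'f \<Rightarrow> complex"
  assumes "quadratic_extension \<iota> \<alpha> \<pi>E \<pi>F"
    and "normalized_haar_measure dx"
    and "chi \<in> unit_characters" and "eta \<in> unit_characters"
  shows "\<exists>Kt :: complex \<Rightarrow> complex \<Rightarrow> ('e \<Rightarrow> complex) \<Rightarrow> complex.
    (\<forall>s t. Kt s t \<in> distributions) \<and>
    (\<forall>s t. 0 < Re (2 * s + t + 1/2) \<and> 0 < Re (2 * s - t + 1/2) \<longrightarrow>
       (\<forall>\<phi>\<in>test_functions UNIV.
          Kt s t \<phi> = fun_distribution dx (normalized_kernel \<iota> \<alpha> \<pi>E \<pi>F chi eta s t) \<phi>)) \<and>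
    (\<forall>\<phi>\<in>test_functions UNIV. holomorphic2 (\<lambda>(s, t). Kt s t \<phi>)) \<and>
    (\<forall>s t. Kt s t \<in> equivariant_distributions \<iota> \<pi>E \<pi>F chi eta s t)"
proof -
  interpret kernel_setup \<iota> \<alpha> \<pi>E \<pi>F dx chi eta
    using assms by (intro kernel_setup.intro haar.intro kernel_setup_axioms.intro)
  show ?thesis
    by (rule normalized_kernel_continuation)
qed

end
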